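(* Let $A\in\mathrm{GL}(n,\mathbb{Z})$ be a Kato matrix of type $l>0$ and let $M_A$ be the associated Kato manifold. Then the compact torus $\mathbb{T}^l=(S^1)^l$ acts effectively by biholomorphisms on $M_A$.
   Context: Kato matrices. Let $e_1,\dots,e_n$ be the standard basis (column vectors) and $c=\sum_j e_j$. For $1\le j\le n$ let $A_j$ be the $n\times n$ matrix with columns $e_1,\dots,e_{j-1},e_{j+1},\dots,e_n,c$ (elementary matrices). A Kato matrix is a product $A=A_{j_1}\cdots A_{j_k}$, $k\ge1$, repetitions allowed, which is not of the form $A_n^p$, $p\ge 1$; the factorization is unique. For $A=(a_{pq})$ put $F_A(z)=(\prod_q z_q^{a_{1q}},\dots,\prod_q z_q^{a_{nq}})$. The type of $A$ is the largest $l\ge0$ such that $A=\begin{pmatrix} I_l & G\\ 0& B\end{pmatrix}$ with $B\in\mathrm{GL}(n-l,\mathbb{Z})$ a Kato matrix; it equals $\min_p j_p-1\le n-2$. The manifold $M_A$. Let $D=\{z\in\mathbb{C}^n:\sum_{j<n}|z_j|^2+2|z_n|^2<1\}$, let $\Pi:\hat{\mathbb{C}}^n\to\mathbb{C}^n$ be the blow-up at $0$, $\hat D=\Pi^{-1}(D)$, with standard charts $f_j:\mathbb{C}^n\to\hat{\mathbb{C}}^n\subset\mathbb{C}^n\times\mathbb{CP}^{n-1}$, $f_j(z)=(F_{A_j}(z),[z_1:\dots:z_{j-1}:1:z_j:\dots:z_{n-1}])$. Put $\hat D^{(0)}=D$, $\sigma_0=\mathrm{id}$; for $1\le p\le k$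 let $\pi_p:\hat D^{(p)}\to\hat D^{(p-1)}$ be the blow-up at the point $\sigma_{p-1}(0)$, $\iota_p:\hat D\to\hat D^{(p)}$ the embedding with $\pi_p\circ\iota_p=\sigma_{p-1}\circ\Pi$, and $\sigma_p=\iota_p\circ f_{j_p}:D\to\hat D^{(p)}$. Let $\pi=\pi_1\circ\dots\circ\pi_k:\hat D^{(k)}\to D$, $\sigma=\sigma_k$, so $\pi\circ\sigma=F_A$; $\sigma$ extends to an embedding of $\overline D$ in $\hat D^{(k)}$. With $W=\hat D^{(k)}\setminus\sigma(D)$, $M_A$ is the compact complex manifold obtained from $W$ completed with its outer boundary $\partial\hat D^{(k)}\cong\partial D$ by gluing $x\in\partial\hat D^{(k)}$ with $\sigma(\pi(x))\in\sigma(\partial D)$. *)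

theory Defs
  imports
    "HOL-Analysis.Analysis"
    "HOL-Algebra.Group_Action"
    "HOL-Algebra.Product_Groups"
    "Jordan_Normal_Form.Matrix"
begin

section \<open>Kato matrices\<close>

text \<open>Row, column and coordinate indices run over 0, ..., n - 1 throughout, so \<open>kato_elem n j\<close> is
  the elementary matrix that is written with index j + 1 when indices start at 1.\<close>

definition kato_elem :: "nat \<Rightarrow> nat \<Rightarrow> int mat" where
  "kato_elem n j =
     mat_of_cols n (map (unit_vec n) ([0..<j] @ [Suc j..<n]) @ [vec n (\<lambda>_. 1)])"

definition kato_word :: "nat \<Rightarrow> int mat \<Rightarrow> nat list \<Rightarrow> bool" where
  "kato_word n A js \<longleftrightarrow>
     js \<noteq> [] \<and> set js \<subseteq> {..<n} \<and> A = foldr (*) (map (kato_elem n) js) (1\<^sub>m n)"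

definition kato_matrix :: "nat \<Rightarrow> int mat \<Rightarrow> bool" where
  "kato_matrix n A \<longleftrightarrow>
     (\<exists>js. kato_word n A js) \<and> (\<forall>p\<ge>1. A \<noteq> kato_elem n (n - 1) ^\<^sub>m p)"

text \<open>Elementary matrices are unimodular, so \<open>kato_matrix (n - l) B\<close> already makes \<open>B\<close> an
  (n - l) by (n - l) matrix that is invertible over the integers.  It also forces l < n.\<close>

definition kato_type :: "nat \<Rightarrow> int mat \<Rightarrow> nat" where
  "kato_type n A = (GREATEST l. l \<le> n \<and>
     (\<exists>G B. G \<in> carrier_mat l (n - l) \<and> kato_matrix (n - l) B \<and>
            A = four_block_mat (1\<^sub>m l) G (0\<^sub>m (n - l) l) B))"


section \<open>Holomorphic functions on open subsets of \<open>\<complex>\<^sup>n\<close>\<close>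

text \<open>\<open>Cn n\<close> is complex n-space inside \<open>nat \<Rightarrow> complex\<close>, whose topology is the product topology.\<close>

type_synonym cvec = "nat \<Rightarrow> complex"

definition Cn :: "nat \<Rightarrow> cvec set" where
  "Cn n = {z. \<forall>i\<ge>n. z i = 0}"

abbreviation origin :: cvec where
  "origin \<equiv> (\<lambda>_. 0)"

definition open_Cn :: "nat \<Rightarrow> cvec set \<Rightarrow> bool" where
  "open_Cn n U \<longleftrightarrow> openin (top_of_set (Cn n)) U"

text \<open>Complex Frechet differentiability at \<open>z\<close> of a function of n variables; a function on an open
  set is holomorphic iff this holds at each of its points.\<close>

definition complex_differentiable_at :: "nat \<Rightarrow> (cvec \<Rightarrow> complex) \<Rightarrow> cvec \<Rightarrow> bool" where
  "complex_differentiable_at n f z \<longleftrightarrow>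
     (\<exists>c. ((\<lambda>w. cmod (f w - f z - (\<Sum>i<n. c i * (w i - z i))) / (\<Sum>i<n. cmod (w i - z i))) \<longlongrightarrow> 0)
            (at z within Cn n))"


section \<open>Complex manifolds given by an atlas\<close>

text \<open>An atlas is given by inverse charts: a pair \<open>(U, \<psi>)\<close> consists of an open subset \<open>U\<close> of \<open>Cn n\<close>
  and an injective map \<open>\<psi>\<close> from \<open>U\<close> to the manifold.  The topology is the one determined by the
  atlas: a set is open iff its preimages under all inverse charts are.\<close>

record 'a cmfd =
  pts :: "'a set"
  charts :: "(cvec set \<times> (cvec \<Rightarrow> 'a)) set"

definition mfd_top :: "nat \<Rightarrow> 'a cmfd \<Rightarrow> 'a topology" where
  "mfd_top n M = topology (\<lambda>V. V \<subseteq> pts M \<and>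
     (\<forall>(U, \<psi>) \<in> charts M. open_Cn n {z \<in> U. \<psi> z \<in> V}))"

lemma openin_mfd_top:
  assumes "\<And>U \<psi>. (U, \<psi>) \<in> charts M \<Longrightarrow> open_Cn n U"
  shows "openin (mfd_top n M) V \<longleftrightarrow>
    V \<subseteq> pts M \<and> (\<forall>(U, \<psi>) \<in> charts M. open_Cn n {z \<in> U. \<psi> z \<in> V})"
proof -
  have "istopology (\<lambda>V. V \<subseteq> pts M \<and> (\<forall>(U, \<psi>) \<in> charts M. open_Cn n {z \<in> U. \<psi> z \<in> V}))"
    unfolding istopology_def
  proof (intro conjI allI impI)
    fix S T
    assume S: "S \<subseteq> pts M \<and> (\<forall>(U, \<psi>) \<in> charts M. open_Cn n {z \<in> U. \<psi> z \<in> S})"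
      and T: "T \<subseteq> pts M \<and> (\<forall>(U, \<psi>) \<in> charts M. open_Cn n {z \<in> U. \<psi> z \<in> T})"
    show "S \<inter> T \<subseteq> pts M" using S by blast
    have "open_Cn n {z \<in> U. \<psi> z \<in> S \<inter> T}" if "(U, \<psi>) \<in> charts M" for U \<psi>
    proof -
      have "{z \<in> U. \<psi> z \<in> S \<inter> T} = {z \<in> U. \<psi> z \<in> S} \<inter> {z \<in> U. \<psi> z \<in> T}" by blast
      then show ?thesis using S T that unfolding open_Cn_def by (auto intro!: openin_Int)
    qed
    then show "\<forall>(U, \<psi>) \<in> charts M. open_Cn n {z \<in> U. \<psi> z \<in> S \<inter> T}" by blast
  next
    fix K
    assume K: "\<forall>S\<in>K. S \<subseteq> pts M \<and> (\<forall>(U, \<psi>) \<in> charts M. open_Cn n {z \<in> U. \<psi> z \<in> S})"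
    then show "\<Union>K \<subseteq> pts M" by blast
    have "open_Cn n {z \<in> U. \<psi> z \<in> \<Union>K}" if "(U, \<psi>) \<in> charts M" for U \<psi>
    proof -
      have "{z \<in> U. \<psi> z \<in> \<Union>K} = (\<Union>S\<in>K. {z \<in> U. \<psi> z \<in> S})" by blast
      then show ?thesis using K that unfolding open_Cn_def by (auto intro!: openin_Union)
    qed
    then show "\<forall>(U, \<psi>) \<in> charts M. open_Cn n {z \<in> U. \<psi> z \<in> \<Union>K}" by blast
  qed
  then show ?thesis by (simp add: mfd_top_def)
qed

definition holomorphic_map :: "nat \<Rightarrow> 'a cmfd \<Rightarrow> 'b cmfd \<Rightarrow> ('a \<Rightarrow> 'b) \<Rightarrow> bool" where
  "holomorphic_map n M M' f \<longleftrightarrow>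
     continuous_map (mfd_top n M) (mfd_top n M') f \<and>
     (\<forall>(U, \<psi>) \<in> charts M. \<forall>(V, \<phi>) \<in> charts M'. \<forall>z\<in>U. f (\<psi> z) \<in> \<phi> ` V \<longrightarrow>
        (\<forall>i<n. complex_differentiable_at n (\<lambda>w. inv_into V \<phi> (f (\<psi> w)) i) z))"

definition biholomorphism :: "nat \<Rightarrow> 'a cmfd \<Rightarrow> 'b cmfd \<Rightarrow> ('a \<Rightarrow> 'b) \<Rightarrow> bool" where
  "biholomorphism n M M' f \<longleftrightarrow>
     bij_betw f (pts M) (pts M') \<and> holomorphic_map n M M' f \<and>
     holomorphic_map n M' M (inv_into (pts M) f)"


section \<open>Blow-ups at a point\<close>

text \<open>Points of complex projective space are lines through the origin; \<open>line v\<close> is the point with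
  homogeneous coordinates \<open>v\<close>.\<close>

definition line :: "cvec \<Rightarrow> cvec set" where
  "line v = {(\<lambda>i. c * v i) | c. True}"

definition CP :: "nat \<Rightarrow> cvec set set" where
  "CP n = line ` (Cn n - {origin})"

definition bl_Cn :: "nat \<Rightarrow> (cvec \<times> cvec set) set" where
  "bl_Cn n = {(z, L). z \<in> Cn n \<and> L \<in> CP n \<and> z \<in> L}"

definition mat_monomial :: "nat \<Rightarrow> int mat \<Rightarrow> cvec \<Rightarrow> cvec" where
  "mat_monomial n A z = (\<lambda>p. if p < n then (\<Prod>q<n. z q powi (A $$ (p, q))) else 0)"

definition std_chart :: "nat \<Rightarrow> nat \<Rightarrow> cvec \<Rightarrow> cvec \<times> cvec set" where
  "std_chart n j z = (mat_monomial n (kato_elem n j) z,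
     line (\<lambda>p. if n \<le> p then 0 else if p < j then z p else if p = j then 1 else z (p - 1)))"

text \<open>Points of the iterated blow-ups of \<open>Cn n\<close>: \<open>Base z\<close> is a point of \<open>Cn n\<close> and \<open>Exc p L\<close> is
  the point \<open>L\<close> of the exceptional divisor of the p-th blow-up.\<close>

datatype bpt = Base (base_of: cvec) | Exc nat "cvec set"

text \<open>The p-th blow-up, performed in a manifold \<open>M\<close> with a holomorphic open embedding \<open>s\<close> of \<open>Cn n\<close>,
  at the point \<open>s origin\<close>: remove that point and glue in the blow-up of \<open>Cn n\<close> at the origin by
  means of \<open>s\<close>.  \<open>blow_iota s p\<close> is the embedding of the blow-up of \<open>Cn n\<close> into the result.\<close>

definition blow_iota :: "(cvec \<Rightarrow> bpt) \<Rightarrow> nat \<Rightarrow> cvec \<times> cvec set \<Rightarrow> bpt" where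
  "blow_iota s p = (\<lambda>(z, L). if z = origin then Exc p L else s z)"

definition blow_down :: "(cvec \<Rightarrow> bpt) \<Rightarrow> nat \<Rightarrow> bpt \<Rightarrow> bpt" where
  "blow_down s p x = (if \<exists>L. x = Exc p L then s origin else x)"

definition blow_up :: "nat \<Rightarrow> (cvec \<Rightarrow> bpt) \<Rightarrow> nat \<Rightarrow> bpt cmfd \<Rightarrow> bpt cmfd" where
  "blow_up n s p M = \<lparr>
     pts = (pts M - {s origin}) \<union> blow_iota s p ` bl_Cn n,
     charts = {({z \<in> U. \<psi> z \<noteq> s origin}, \<psi>) | U \<psi>. (U, \<psi>) \<in> charts M}
            \<union> {(Cn n, blow_iota s p \<circ> std_chart n j) | j. j < n}\<rparr>"


section \<open>The manifold of a Kato matrix\<close>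

text \<open>The blow-ups are carried out over all of \<open>Cn n\<close>.  The blow-up tower over the domain \<open>kato_D n\<close>
  is the part lying over \<open>kato_D n\<close>, and the outer boundary as well as the extension of the
  embedding \<open>kato_sigma\<close> beyond \<open>kato_D n\<close> are then available without further construction.\<close>

definition kato_D :: "nat \<Rightarrow> cvec set" where
  "kato_D n = {z \<in> Cn n. (\<Sum>j<n - 1. (cmod (z j))\<^sup>2) + 2 * (cmod (z (n - 1)))\<^sup>2 < 1}"

primrec kato_sigma :: "nat \<Rightarrow> nat list \<Rightarrow> nat \<Rightarrow> cvec \<Rightarrow> bpt" where
  "kato_sigma n js 0 = Base"
| "kato_sigma n js (Suc p) = blow_iota (kato_sigma n js p) (Suc p) \<circ> std_chart n (js ! p)"

primrec kato_tower :: "nat \<Rightarrow> nat list \<Rightarrow> nat \<Rightarrow> bpt cmfd" where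
  "kato_tower n js 0 = \<lparr>pts = Base ` Cn n, charts = {(Cn n, Base)}\<rparr>"
| "kato_tower n js (Suc p) = blow_up n (kato_sigma n js p) (Suc p) (kato_tower n js p)"

primrec kato_pi :: "nat \<Rightarrow> nat list \<Rightarrow> nat \<Rightarrow> bpt \<Rightarrow> cvec" where
  "kato_pi n js 0 = base_of"
| "kato_pi n js (Suc p) = kato_pi n js p \<circ> blow_down (kato_sigma n js p) (Suc p)"

text \<open>\<open>kato_W\<close> is W completed with its outer boundary, which consists of the points over the
  boundary of \<open>kato_D n\<close>; it contains the inner boundary.  \<open>kato_W_interior\<close> omits both.  As
  \<open>Cn n\<close> is closed, \<open>closure\<close> agrees with the closure in \<open>Cn n\<close>.\<close>

definition kato_W :: "nat \<Rightarrow> nat list \<Rightarrow> bpt set" where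
  "kato_W n js = (let k = length js in
     {x \<in> pts (kato_tower n js k). kato_pi n js k x \<in> closure (kato_D n)}
       - kato_sigma n js k ` kato_D n)"

definition kato_W_interior :: "nat \<Rightarrow> nat list \<Rightarrow> bpt set" where
  "kato_W_interior n js = (let k = length js in
     {x \<in> pts (kato_tower n js k). kato_pi n js k x \<in> kato_D n}
       - kato_sigma n js k ` closure (kato_D n))"

definition kato_outer :: "nat \<Rightarrow> nat list \<Rightarrow> bpt set" where
  "kato_outer n js = {x \<in> pts (kato_tower n js (length js)).
     kato_pi n js (length js) x \<in> closure (kato_D n) - kato_D n}"

definition kato_glue :: "nat \<Rightarrow> nat list \<Rightarrow> (bpt \<times> bpt) set" where
  "kato_glue n js = (let g = (\<lambda>x. kato_sigma n js (length js) (kato_pi n js (length js) x)) in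
     {(x, y) \<in> kato_W n js \<times> kato_W n js.
        x = y \<or> x \<in> kato_outer n js \<and> y = g x \<or> y \<in> kato_outer n js \<and> x = g y})"

definition kato_class :: "nat \<Rightarrow> nat list \<Rightarrow> bpt \<Rightarrow> bpt set" where
  "kato_class n js x = kato_glue n js `` {x}"

text \<open>The collar identifies a neighbourhood of the glued hypersurface with a neighbourhood of the
  boundary of \<open>kato_D n\<close>: on the inside it is the inverse of the blow-down (which is \<open>Base\<close> away
  from the origin), on the outside it is \<open>kato_sigma\<close>; on the boundary itself the two agree modulo
  \<open>kato_glue\<close>.  Thus the complex structures on the two sides are matched by the holomorphic map
  extending \<open>x \<mapsto> \<sigma> (\<pi> x)\<close> to a neighbourhood of the outer boundary.\<close>

definition kato_collar :: "nat \<Rightarrow> nat list \<Rightarrow> cvec \<Rightarrow> bpt" where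
  "kato_collar n js z = (if z \<in> closure (kato_D n) then Base z else kato_sigma n js (length js) z)"

definition kato_manifold :: "nat \<Rightarrow> nat list \<Rightarrow> bpt set cmfd" where
  "kato_manifold n js = \<lparr>
     pts = kato_W n js // kato_glue n js,
     charts =
       {({z \<in> U. \<psi> z \<in> kato_W_interior n js}, kato_class n js \<circ> \<psi>) | U \<psi>.
          (U, \<psi>) \<in> charts (kato_tower n js (length js))} \<union>
       {(N, kato_class n js \<circ> kato_collar n js) | N.
          open_Cn n N \<and> kato_collar n js ` N \<subseteq> kato_W n js \<and>
          inj_on (kato_class n js \<circ> kato_collar n js) N}\<rparr>"


section \<open>The compact torus\<close>

definition circle_group :: "complex monoid" where
  "circle_group = \<lparr>carrier = sphere 0 1, mult = (*), one = 1\<rparr>"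

definition torus_group :: "nat \<Rightarrow> (nat \<Rightarrow> complex) monoid" where
  "torus_group l = product_group {..<l} (\<lambda>_. circle_group)"

definition torus_top :: "nat \<Rightarrow> (nat \<Rightarrow> complex) topology" where
  "torus_top l = product_topology (\<lambda>_. top_of_set (sphere 0 1)) {..<l}"

end

(* Type l > 0 forces all letters of the word to be at least l (counted from 0).  Hence rotating the
   first l coordinates by unit complex numbers commutes with every standard chart that occurs in the
   word, so the rotations lift through the blow-ups, fix all centres and commute with sigma and
   pi.  As they also preserve D, they descend to the quotient.  In every inverse chart of the tower
   and in every collar chart the lifted action is a diagonal linear map, so that it is holomorphic
   as soon as the given charts form a holomorphic atlas.  The latter rests on F_A mapping the closure
   of D into D, which holds because the word contains a letter other than the last one.  The action
   is effective because it moves a point of D with non-zero first l coordinates that lies outside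
   the image of the closure of D under F_A.  Its continuity can be tested in charts because the
   torus is compact. *)
theory Submission
  imports Defs
begin

section \<open>Elementary Kato matrices and standard charts\<close>

text \<open>The atlas of \<open>kato_manifold\<close> is prescribed and large: it contains charts
  for every \<open>j < n\<close> at every level, including \<open>j < l\<close>, and every
  admissible collar domain. In charts with \<open>j < l\<close> the weights of the action are
  quotients of coordinates of \<open>u\<close>, and a rotation carries a collar domain to another
  one, so the target chart may depend on the torus element. The contraction depends on the weight 2
  in \<open>kato_D\<close>. For the round ball, each elementary monomial map would send the last
  basis vector to the j-th one, hence a boundary point to a boundary point. With weight 2 this can
  only happen for \<open>j = n - 1\<close>, whose map fixes the boundary points that have all
  coordinates but the last equal to 0. This is where powers of that single matrix have to be
  excluded. By compactness, one contracting letter bounds the quadratic form by some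
  \<open>m < 1\<close> on the image of the closed domain. The gap between \<open>m\<close> and 1
  leaves room both for a collar and for a point with trivial stabiliser.\<close>

lemma kato_elem_carrier [simp]: "kato_elem n j \<in> carrier_mat n n" if "j < n"
  using that unfolding kato_elem_def
  by (intro carrier_matI) (auto simp: mat_of_cols_def)

lemma kato_elem_index:
  assumes "j < n" "p < n" "q < n"
  shows "kato_elem n j $$ (p, q) =
    (if q = n - 1 \<or> p = (if q < j then q else Suc q) then 1 else 0)"
proof -
  let ?cs = "map (unit_vec n) ([0..<j] @ [Suc j..<n]) @ [vec n (\<lambda>_. 1)] :: int vec list"
  have len: "length ?cs = n" using assms by simp
  have "kato_elem n j $$ (p, q) = vec_index (?cs ! q) p"
    unfolding kato_elem_def using assms by (subst mat_of_cols_index) auto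
  also have "?cs ! q = (if q = n - 1 then vec n (\<lambda>_. 1) else unit_vec n (if q < j then q else Suc q))"
    using assms by (auto simp: nth_append)
  finally show ?thesis using assms by auto
qed

text \<open>Right multiplication deletes column \<open>j\<close> and appends the sum of all columns.
  This is why products are analysed from their last letter.\<close>

lemma mult_kato_elem_index:
  assumes "M \<in> carrier_mat n n" "j < n" "p < n" "q < n"
  shows "(M * kato_elem n j) $$ (p, q) =
    (if q = n - 1 then (\<Sum>r<n. M $$ (p, r)) else M $$ (p, if q < j then q else Suc q))"
proof -
  have "(M * kato_elem n j) $$ (p, q) = (\<Sum>r<n. M $$ (p, r) * kato_elem n j $$ (r, q))"
    using assms carrier_matD[OF kato_elem_carrier[of j n]]
    by (auto simp: times_mat_def scalar_prod_def atLeast0LessThan intro!: sum.cong)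
  also have "\<dots> = (\<Sum>r<n. if q = n - 1 \<or> r = (if q < j then q else Suc q) then M $$ (p, r) else 0)"
    using assms by (intro sum.cong) (auto simp: kato_elem_index)
  also have "\<dots> = (if q = n - 1 then (\<Sum>r<n. M $$ (p, r)) else M $$ (p, if q < j then q else Suc q))"
    using assms by (auto simp: sum.delta)
  finally show ?thesis .
qed

definition kato_prod :: "nat \<Rightarrow> nat list \<Rightarrow> int mat" where
  "kato_prod n js = foldr (*) (map (kato_elem n) js) (1\<^sub>m n)"

lemma kato_prod_Nil [simp]: "kato_prod n [] = 1\<^sub>m n"
  and kato_prod_Cons [simp]: "kato_prod n (j # js) = kato_elem n j * kato_prod n js"
  by (simp_all add: kato_prod_def)

lemma kato_prod_carrier [simp]: "set js \<subseteq> {..<n} \<Longrightarrow> kato_prod n js \<in> carrier_mat n n"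
  by (induction js) (auto intro!: mult_carrier_mat[of _ n n])

lemma kato_prod_snoc:
  "set js \<subseteq> {..<n} \<Longrightarrow> j < n \<Longrightarrow> kato_prod n (js @ [j]) = kato_prod n js * kato_elem n j"
proof (induction js)
  case (Cons i js)
  have "kato_elem n i * (kato_prod n js * kato_elem n j) = kato_elem n i * kato_prod n js * kato_elem n j"
    using Cons.prems by (intro assoc_mult_mat[symmetric, of _ n n _ n _ n]) auto
  with Cons show ?case by simp
next
  case Nil
  then show ?case
    using left_mult_one_mat[OF kato_elem_carrier] right_mult_one_mat[OF kato_elem_carrier]
    by simp
qed

lemma kato_prod_replicate:
  "j < n \<Longrightarrow> kato_prod n (replicate k j) = kato_elem n j ^\<^sub>m k"
proof (induction k)
  case 0
  then show ?case using carrier_matD[OF kato_elem_carrier[of j n]] by simp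
next
  case (Suc k)
  have "kato_prod n (replicate k j @ [j]) = kato_prod n (replicate k j) * kato_elem n j"
    using Suc.prems by (intro kato_prod_snoc) auto
  then show ?case using Suc by (simp add: replicate_append_same)
qed

text \<open>Deleting a column only moves later columns to the left, so the column in position
  \<open>q\<close> comes from a position at least \<open>q\<close>, and its positive entry stays on
  or below the diagonal. The appended column is a sum of nonnegative columns and inherits the entry
  of the old last one.\<close>

lemma kato_prod_positive_below:
  assumes "set js \<subseteq> {..<n}" "q < n"
  shows "(\<forall>p<n. kato_prod n js $$ (p, q) \<ge> 0) \<and> (\<exists>p<n. q \<le> p \<and> kato_prod n js $$ (p, q) > 0)"
  using assms
proof (induction js arbitrary: q rule: rev_induct)
  case Nil
  then show ?case by (auto intro!: exI[of _ q])
next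
  case (snoc j js)
  let ?M = "kato_prod n js"
  have M: "?M \<in> carrier_mat n n" and j: "j < n" using snoc.prems by auto
  have ent: "kato_prod n (js @ [j]) $$ (p, q) =
      (if q = n - 1 then (\<Sum>r<n. ?M $$ (p, r)) else ?M $$ (p, if q < j then q else Suc q))" if "p < n" for p
    using mult_kato_elem_index[OF M j that snoc.prems(2)] kato_prod_snoc[of js n j] snoc.prems j by simp
  have IH: "(\<forall>p<n. ?M $$ (p, q) \<ge> 0) \<and> (\<exists>p<n. q \<le> p \<and> ?M $$ (p, q) > 0)" if "q < n" for q
    using snoc that by simp
  show ?case
  proof (cases "q = n - 1")
    case True
    have nn: "(\<Sum>r<n. ?M $$ (p, r)) \<ge> 0" if "p < n" for p
      using IH that by (intro sum_nonneg) auto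
    obtain p where p: "p < n" "q \<le> p" "?M $$ (p, q) > 0" using IH snoc.prems by blast
    have "(\<Sum>r<n. ?M $$ (p, r)) \<ge> ?M $$ (p, q)"
      using IH p snoc.prems by (intro member_le_sum) auto
    then show ?thesis using True p nn ent by (intro conjI allI impI exI[of _ p]) auto
  next
    case False
    let ?q = "if q < j then q else Suc q"
    have "?q < n" using False snoc.prems by auto
    from IH[OF this] obtain p where p: "p < n" "?q \<le> p" "?M $$ (p, ?q) > 0"
      and nn: "\<forall>p<n. ?M $$ (p, ?q) \<ge> 0" by blast
    have "q \<le> p" using p(2) by (simp split: if_splits)
    then show ?thesis using p nn False ent by (intro conjI allI impI exI[of _ p]) auto
  qed
qed

text \<open>If the last letter were at most \<open>i\<close>, column \<open>i\<close> would be
  column \<open>Suc i\<close> of the shorter product, which has a positive entry in a row beyond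
  \<open>i\<close>. Otherwise column \<open>i\<close> is unchanged and the induction continues.
  \<open>Suc i < n\<close> keeps the appended column apart from column \<open>i\<close>.\<close>

lemma kato_prod_fixed_column:
  assumes "set js \<subseteq> {..<n}" "Suc i < n"
    and "\<And>p. p < n \<Longrightarrow> kato_prod n js $$ (p, i) = (if p = i then 1 else 0)"
  shows "\<forall>j\<in>set js. i < j"
  using assms
proof (induction js rule: rev_induct)
  case (snoc j js)
  let ?M = "kato_prod n js"
  have M: "?M \<in> carrier_mat n n" and j: "j < n" using snoc.prems by auto
  have ent: "?M $$ (p, if i < j then i else Suc i) = (if p = i then 1 else 0)" if "p < n" for p
    using mult_kato_elem_index[OF M j that, of i] snoc.prems(3)[OF that] kato_prod_snoc[of js n j]
      snoc.prems(1,2) j by (cases "i = n - 1") (simp_all split del: if_split)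
  have "i < j"
  proof (rule ccontr)
    assume "\<not> i < j"
    then have "?M $$ (p, Suc i) = (if p = i then 1 else 0)" if "p < n" for p
      using ent that by simp
    with kato_prod_positive_below[of js n "Suc i"] snoc.prems show False by force
  qed
  with ent snoc show ?case by simp
qed simp

text \<open>Of the block decomposition only column \<open>l - 1\<close> enters: being a unit vector,
  it already bounds all letters from below by \<open>kato_prod_fixed_column\<close>.\<close>

lemma kato_type_word:
  assumes "A \<in> carrier_mat n n" "kato_matrix n A" "kato_word n A js" "kato_type n A = l" "l > 0"
  shows "l < n" "\<forall>j\<in>set js. l \<le> j \<and> j < n" "\<exists>j\<in>set js. j < n - 1" "js \<noteq> []"
proof -
  let ?P = "\<lambda>l. l \<le> n \<and> (\<exists>G B. G \<in> carrier_mat l (n - l) \<and> kato_matrix (n - l) B \<and>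
            A = four_block_mat (1\<^sub>m l) G (0\<^sub>m (n - l) l) B)"
  from assms(3) have js: "js \<noteq> []" "set js \<subseteq> {..<n}" and A: "A = kato_prod n js"
    unfolding kato_word_def kato_prod_def by auto
  show "js \<noteq> []" by fact
  \<comment> \<open>Block size 0 is always admissible, so the \<open>GREATEST\<close> is attained
    and \<open>l\<close> itself has the block form.\<close>
  have "A = four_block_mat (1\<^sub>m 0) (0\<^sub>m 0 n) (0\<^sub>m n 0) A"
    using assms(1) by (intro eq_matI) auto
  then have "?P 0" using assms(2) by (metis zero_carrier_mat diff_zero le0)
  then have "?P l" unfolding assms(4)[symmetric] kato_type_def
    by (rule GreatestI_nat[where b = n]) auto
  then obtain G B where GB: "l \<le> n" "G \<in> carrier_mat l (n - l)" "kato_matrix (n - l) B"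
    "A = four_block_mat (1\<^sub>m l) G (0\<^sub>m (n - l) l) B" by blast
  from GB(3) show "l < n" unfolding kato_matrix_def kato_word_def by fastforce
  have B: "B \<in> carrier_mat (n - l) (n - l)"
    using GB(3) unfolding kato_matrix_def kato_word_def kato_prod_def[symmetric] by auto
  have "A $$ (p, l - 1) = (if p = l - 1 then 1 else 0)" if "p < n" for p
    using \<open>l < n\<close> B GB that \<open>l > 0\<close> by (auto simp: four_block_mat_def Let_def)
  then have "\<forall>j\<in>set js. l - 1 < j"
    using js \<open>l < n\<close> \<open>l > 0\<close> A by (intro kato_prod_fixed_column[of js n]) auto
  then show "\<forall>j\<in>set js. l \<le> j \<and> j < n" using js by fastforce
  show "\<exists>j\<in>set js. j < n - 1"
  proof (rule ccontr)
    assume "\<not> ?thesis"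
    then have "\<forall>j\<in>set js. j = n - 1" using js(2) by fastforce
    then have "js = replicate (length js) (n - 1)" by (metis replicate_length_same)
    then have "A = kato_elem n (n - 1) ^\<^sub>m (length js)"
      using A kato_prod_replicate[of "n - 1" n "length js"] \<open>l < n\<close> by simp
    then show False using assms(2) js(1) unfolding kato_matrix_def
      by (metis One_nat_def Suc_leI length_greater_0_conv)
  qed
qed

section \<open>Standard charts in normalised homogeneous coordinates\<close>

definition chart_vec :: "nat \<Rightarrow> nat \<Rightarrow> cvec \<Rightarrow> cvec" where
  "chart_vec n j z = (\<lambda>p. if n \<le> p then 0 else if p < j then z p else if p = j then 1 else z (p - 1))"

lemma chart_vec_Cn [simp]: "chart_vec n j z \<in> Cn n"
  by (auto simp: chart_vec_def Cn_def)

lemma chart_vec_same [simp]: "j < n \<Longrightarrow> chart_vec n j z j = 1"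
  by (simp add: chart_vec_def)

text \<open>Row \<open>p\<close> has a 1 in the last column, which gives the common factor, and for
  \<open>p\<close> other than \<open>j\<close> one more 1 in column \<open>p\<close> or
  \<open>p - 1\<close>, which gives the coordinate that \<open>chart_vec\<close> places at
  \<open>p\<close>.\<close>

lemma mat_monomial_kato_elem:
  assumes j: "j < n"
  shows "mat_monomial n (kato_elem n j) z = (\<lambda>p. z (n - 1) * chart_vec n j z p)"
proof
  fix p
  show "mat_monomial n (kato_elem n j) z p = z (n - 1) * chart_vec n j z p"
  proof (cases "p < n")
    case True
    have "(\<Prod>q<n. z q powi (kato_elem n j $$ (p, q))) =
      (\<Prod>q<n. if q = n - 1 \<or> p = (if q < j then q else Suc q) then z q else 1)"
      using True j by (intro prod.cong) (auto simp: kato_elem_index)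
    also have "\<dots> = z (n - 1) * (\<Prod>q\<in>{..<n} - {n - 1}. if p = (if q < j then q else Suc q) then z q else 1)"
      using j by (subst prod.remove[of _ "n - 1"]) (auto intro!: prod.cong)
    also have "(\<Prod>q\<in>{..<n} - {n - 1}. if p = (if q < j then q else Suc q) then z q else 1) =
      chart_vec n j z p"
    proof -
      consider "p < j" | "p = j" | "p > j" by linarith
      then show ?thesis
      proof cases
        case 1
        have "(\<Prod>q\<in>{..<n} - {n - 1}. if p = (if q < j then q else Suc q) then z q else 1) =
          (\<Prod>q\<in>{..<n} - {n - 1}. if q = p then z q else 1)"
          using 1 by (intro prod.cong) auto
        then show ?thesis using 1 j by (auto simp: chart_vec_def)
      next
        case 2
        then have "(\<Prod>q\<in>{..<n} - {n - 1}. if p = (if q < j then q else Suc q) then z q else 1) = 1"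
          by (intro prod.neutral) auto
        then show ?thesis using 2 j by (simp add: chart_vec_def)
      next
        case 3
        have "(\<Prod>q\<in>{..<n} - {n - 1}. if p = (if q < j then q else Suc q) then z q else 1) =
          (\<Prod>q\<in>{..<n} - {n - 1}. if q = p - 1 then z q else 1)"
          using 3 by (intro prod.cong) auto
        then show ?thesis using 3 True by (auto simp: chart_vec_def)
      qed
    qed
    finally show ?thesis using True by (simp add: mat_monomial_def)
  qed (simp add: mat_monomial_def chart_vec_def)
qed

lemma std_chart_eq:
  "j < n \<Longrightarrow> std_chart n j z = ((\<lambda>p. z (n - 1) * chart_vec n j z p), line (chart_vec n j z))"
  by (simp add: std_chart_def mat_monomial_kato_elem chart_vec_def)

text \<open>Homogeneous coordinates \<open>v\<close> with \<open>v j \<noteq> 0\<close> and a vector \<open>c \<cdot> v\<close> on the line spanned by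
  \<open>v\<close> determine a point of the j-th standard chart.\<close>

definition chart_inv :: "nat \<Rightarrow> nat \<Rightarrow> complex \<Rightarrow> cvec \<Rightarrow> cvec" where
  "chart_inv n j c v = (\<lambda>q. if q < n - 1 then (if q < j then v q else v (Suc q)) / v j
     else if q = n - 1 then c * v j else 0)"

lemma chart_inv_Cn [simp]: "0 < n \<Longrightarrow> chart_inv n j c v \<in> Cn n"
  by (auto simp: chart_inv_def Cn_def)

lemma chart_vec_chart_inv:
  assumes "j < n" "v \<in> Cn n" "v j \<noteq> 0"
  shows "chart_vec n j (chart_inv n j c v) = (\<lambda>p. v p / v j)"
  using assms by (auto simp: chart_vec_def chart_inv_def fun_eq_iff Cn_def)

lemma line_scale: "c \<noteq> 0 \<Longrightarrow> line (\<lambda>p. v p * c) = line v"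
proof (intro equalityI subsetI)
  fix x assume "x \<in> line (\<lambda>p. v p * c)"
  then obtain d where "x = (\<lambda>i. d * (v i * c))" unfolding line_def by blast
  then have "x = (\<lambda>i. (d * c) * v i)" by (simp add: ac_simps)
  then show "x \<in> line v" unfolding line_def by blast
next
  fix x assume c: "c \<noteq> 0" and "x \<in> line v"
  then obtain d where "x = (\<lambda>i. d * v i)" unfolding line_def by blast
  then have "x = (\<lambda>i. (d / c) * (v i * c))" using c by simp
  then show "x \<in> line (\<lambda>p. v p * c)" unfolding line_def by blast
qed

lemma std_chart_chart_inv:
  assumes "j < n" "v \<in> Cn n" "v j \<noteq> 0"
  shows "std_chart n j (chart_inv n j c v) = ((\<lambda>p. c * v p), line v)"
  using assms line_scale[of "1 / v j" v]
  by (simp add: std_chart_eq chart_vec_chart_inv) (simp add: chart_inv_def)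

lemma chart_inv_chart_vec: "j < n \<Longrightarrow> z \<in> Cn n \<Longrightarrow> chart_inv n j (z (n - 1)) (chart_vec n j z) = z"
  by (auto simp: chart_inv_def chart_vec_def fun_eq_iff Cn_def)

lemma line_eqD:
  assumes "line v = line w"
  obtains c where "w = (\<lambda>p. c * v p)"
proof -
  have "w \<in> line w" unfolding line_def by (auto intro: exI[of _ 1])
  with assms show ?thesis using that unfolding line_def by auto
qed

lemma std_chart_inj: "j < n \<Longrightarrow> inj_on (std_chart n j) (Cn n)"
proof (rule inj_onI)
  fix z w assume j: "j < n" and zw: "z \<in> Cn n" "w \<in> Cn n" and eq: "std_chart n j z = std_chart n j w"
  then obtain c where c: "chart_vec n j w = (\<lambda>p. c * chart_vec n j z p)"
    using line_eqD[of "chart_vec n j z" "chart_vec n j w"] by (auto simp: std_chart_eq)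
  have "c = 1" using chart_vec_same[OF j, of w] chart_vec_same[OF j, of z] unfolding c by simp
  with c have v: "chart_vec n j w = chart_vec n j z" by simp
  have "w (n - 1) = z (n - 1)"
    using arg_cong[OF eq, of "\<lambda>x. fst x j"] j by (simp add: std_chart_eq)
  with v show "z = w" using chart_inv_chart_vec j zw by metis
qed

lemma chart_vec_nonzero: "j < n \<Longrightarrow> chart_vec n j z \<noteq> origin"
  using chart_vec_same[of j n z] by (metis zero_neq_one)

lemma std_chart_bl_Cn: "j < n \<Longrightarrow> std_chart n j z \<in> bl_Cn n"
  using chart_vec_Cn[of n j z]  chart_vec_nonzero[of j n z]
  by (auto simp: std_chart_eq bl_Cn_def CP_def Cn_def line_def)

lemma bl_Cn_covered:
  assumes "x \<in> bl_Cn n"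
  obtains j z where "j < n" "z \<in> Cn n" "x = std_chart n j z"
proof -
  obtain y v where x: "x = (y, line v)" "v \<in> Cn n" "v \<noteq> origin" "y \<in> line v"
    using assms unfolding bl_Cn_def CP_def by auto
  then obtain c where y: "y = (\<lambda>p. c * v p)" unfolding line_def by auto
  obtain j where j: "v j \<noteq> 0" using x by auto
  then have "j < n" using x unfolding Cn_def by force
  show ?thesis
  proof (rule that)
    show "j < n" by fact
    show "chart_inv n j c v \<in> Cn n" using \<open>j < n\<close> by simp
    show "x = std_chart n j (chart_inv n j c v)" using std_chart_chart_inv \<open>j < n\<close> x j y by simp
  qed
qed

lemma fst_std_chart_eq_origin: "j < n \<Longrightarrow> fst (std_chart n j z) = origin \<longleftrightarrow> z (n - 1) = 0"
  using chart_vec_same[of j n z] by (auto simp: std_chart_eq fun_eq_iff dest: spec[of _ j])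

lemma fst_std_chart_Cn [simp]: "j < n \<Longrightarrow> fst (std_chart n j z) \<in> Cn n"
  using chart_vec_Cn[of n j z] by (auto simp: std_chart_eq Cn_def)

text \<open>The right-hand side consists of equations between continuous functions of the
  coordinates. They pass to limits, which is how two standard charts are shown to be
  separated.\<close>

lemma std_chart_eq_iff:
  assumes "i < n" "j < n" "z \<in> Cn n" "w \<in> Cn n"
  shows "std_chart n i z = std_chart n j w \<longleftrightarrow>
    fst (std_chart n i z) = fst (std_chart n j w) \<and>
    (\<forall>p. chart_vec n i z p = chart_vec n i z j * chart_vec n j w p)"
    (is "?L \<longleftrightarrow> ?R")
proof
  assume ?L
  then obtain c where c: "chart_vec n i z = (\<lambda>p. c * chart_vec n j w p)"
    using line_eqD[of "chart_vec n j w" "chart_vec n i z"] assms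
    by (auto simp: std_chart_eq)
  have "c = chart_vec n i z j" unfolding c using assms by simp
  then have "\<forall>p. chart_vec n i z p = chart_vec n i z j * chart_vec n j w p"
    using c by (simp add: fun_eq_iff)
  then show ?R by (rule conjI[OF arg_cong[of _ _ fst, OF \<open>?L\<close>]])
next
  assume R: ?R
  then have "chart_vec n i z j \<noteq> 0" using chart_vec_same[OF \<open>i < n\<close>, of z] by (metis mult_zero_left zero_neq_one)
  moreover have "chart_vec n i z = (\<lambda>p. chart_vec n j w p * chart_vec n i z j)"
    using R by (metis mult.commute)
  ultimately have "line (chart_vec n i z) = line (chart_vec n j w)" using line_scale by metis
  with conjunct1[OF R] show ?L using assms by (simp add: std_chart_eq)
qed

section \<open>Complex differentiability in several variables\<close>

lemma tendsto_fun_iff: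
  "(f \<longlongrightarrow> l) F \<longleftrightarrow> (\<forall>i. ((\<lambda>w. f w i) \<longlongrightarrow> l i) F)" for f :: "'b \<Rightarrow> 'c \<Rightarrow> 'a :: topological_space"
  using limitin_componentwise[of "\<lambda>_. euclidean" UNIV f l F]
  by (simp add: euclidean_product_topology)

lemma tendsto_Cn:
  assumes "\<And>i. i < n \<Longrightarrow> ((\<lambda>w. h w i) \<longlongrightarrow> l i) F" "\<forall>\<^sub>F w in F. h w \<in> Cn n" "l \<in> Cn n"
  shows "(h \<longlongrightarrow> l) F"
  unfolding tendsto_fun_iff
proof
  fix i show "((\<lambda>w. h w i) \<longlongrightarrow> l i) F"
  proof (cases "i < n")
    case False
    then have "l i = 0" using assms(3) by (simp add: Cn_def)
    moreover have "\<forall>\<^sub>F w in F. h w i = 0" using assms(2) by eventually_elim (use False in \<open>simp add: Cn_def\<close>)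
    ultimately show ?thesis by (simp add: tendsto_eventually)
  qed (use assms in auto)
qed

lemma tendsto_coord: "((\<lambda>w. w i) \<longlongrightarrow> z i) (at z within S)" for z :: "'b \<Rightarrow> 'a :: topological_space"
  using tendsto_fun_iff[of "\<lambda>w. w" z] tendsto_ident_at by blast

lemma eventually_in_Cn: "\<forall>\<^sub>F w in at z within Cn n. w \<in> Cn n"
  by (simp add: eventually_at_filter)

lemma open_Cn_subset: "open_Cn n U \<Longrightarrow> U \<subseteq> Cn n"
  unfolding open_Cn_def using openin_imp_subset by blast

lemma open_Cn_eventually: "open_Cn n U \<Longrightarrow> z \<in> U \<Longrightarrow> \<forall>\<^sub>F w in at z within Cn n. w \<in> U"
  unfolding open_Cn_def openin_open eventually_at_topological by blast

text \<open>The hypothesis says that \<open>C\<close> is closed relative to \<open>U\<close>, in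
  terms of sequences so as to fit the condition \<open>separated\<close>. Sequences suffice because
  the ambient function space is first countable.\<close>

lemma open_Cn_diff:
  assumes U: "open_Cn n U"
    and C: "\<And>zs z. (\<And>m::nat. zs m \<in> U) \<Longrightarrow> (\<And>m. zs m \<in> C) \<Longrightarrow> zs \<longlonglongrightarrow> z \<Longrightarrow> z \<in> U \<Longrightarrow> z \<in> C"
  shows "open_Cn n (U - C)"
proof -
  have "closedin (top_of_set U) (U \<inter> C)"
    unfolding closedin_limpt islimpt_sequential
  proof (intro conjI allI impI, goal_cases)
    case (2 z)
    then obtain zs where "\<forall>m. zs m \<in> U \<inter> C - {z}" "zs \<longlonglongrightarrow> z" "z \<in> U" by blast
    then show "z \<in> U \<inter> C" using C[of zs z] by blast
  qed blast
  then have "openin (top_of_set U) (U - C)"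
    unfolding openin_closedin_eq by (auto simp: double_diff Int_commute Diff_Diff_Int)
  then show ?thesis using U openin_trans unfolding open_Cn_def by blast
qed

text \<open>Caratheodory's characterization: the difference quotients are packed into functions \<open>g i\<close>
  that are continuous at \<open>z\<close>, which turns the rules of calculus into algebraic identities.\<close>

lemma complex_differentiable_at_iff:
  assumes z: "z \<in> Cn n"
  shows "complex_differentiable_at n f z \<longleftrightarrow>
    (\<exists>g. (\<forall>i<n. (g i \<longlongrightarrow> g i z) (at z within Cn n)) \<and>
       (\<forall>\<^sub>F w in at z within Cn n. f w - f z = (\<Sum>i<n. g i w * (w i - z i))))"
    (is "?L \<longleftrightarrow> ?R")
proof
  let ?N = "\<lambda>w. \<Sum>i<n. cmod (w i - z i)"
  assume ?L
  then obtain c where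
    c: "((\<lambda>w. cmod (f w - f z - (\<Sum>i<n. c i * (w i - z i))) / ?N w) \<longlongrightarrow> 0) (at z within Cn n)"
    unfolding complex_differentiable_at_def by blast
  define R where "R w = f w - f z - (\<Sum>i<n. c i * (w i - z i))" for w
  \<comment> \<open>The remainder is distributed over the coordinates. Since
    \<open>cnj (sgn a) * a\<close> is the modulus of \<open>a\<close>, the sum of
    \<open>e i w * (w i - z i)\<close> is \<open>R w\<close>, while each \<open>e i w\<close> is
    bounded by the modulus of \<open>R w\<close> divided by \<open>?N w\<close>.\<close>
  define e where "e i w = R w * cnj (sgn (w i - z i)) / ?N w" for i w
  define g where "g i w = c i + e i w" for i w
  have "(e i \<longlongrightarrow> 0) (at z within Cn n)" for i
  proof (rule tendsto_0_le[OF c, of _ 1])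
    show "\<forall>\<^sub>F w in at z within Cn n. norm (e i w) \<le> norm (cmod (f w - f z - (\<Sum>i<n. c i * (w i - z i))) / ?N w) * 1"
    proof (intro always_eventually allI)
      fix w
      have "norm (e i w) = cmod (R w) * cmod (sgn (w i - z i)) / ?N w"
        by (simp add: e_def norm_mult norm_divide sum_nonneg flip: of_real_sum)
      also have "\<dots> \<le> cmod (R w) * 1 / ?N w"
        by (intro divide_right_mono mult_left_mono) (auto simp: norm_sgn sum_nonneg)
      finally show "norm (e i w) \<le> norm (cmod (f w - f z - (\<Sum>i<n. c i * (w i - z i))) / ?N w) * 1"
        by (simp add: R_def sum_nonneg)
    qed
  qed
  moreover have "e i z = 0" for i by (simp add: e_def)
  ultimately have "(g i \<longlongrightarrow> g i z) (at z within Cn n)" for i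
    using tendsto_add[OF tendsto_const[of "c i"], of "e i" "e i z"] unfolding g_def[abs_def] by simp
  moreover have "\<forall>\<^sub>F w in at z within Cn n. f w - f z = (\<Sum>i<n. g i w * (w i - z i))"
    unfolding eventually_at_filter
  proof (intro always_eventually allI impI)
    fix w assume w: "w \<noteq> z" "w \<in> Cn n"
    then obtain k where k: "w k \<noteq> z k" by auto
    then have "k < n" using w z unfolding Cn_def by force
    then have "?N w > 0" using k by (intro sum_pos2[of _ k]) auto
    have cs: "cnj (sgn a) * a = of_real (cmod a)" for a
      by (cases "a = 0")
        (auto simp: sgn_div_norm scaleR_conv_of_real divide_simps mult.commute
          complex_norm_square[symmetric] power2_eq_square[symmetric])
    have "(\<Sum>i<n. e i w * (w i - z i)) = (\<Sum>i<n. R w / ?N w * (cnj (sgn (w i - z i)) * (w i - z i)))"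
      by (simp add: e_def ac_simps)
    also have "\<dots> = R w / ?N w * ?N w"
      unfolding cs by (simp add: sum_distrib_left)
    also have "\<dots> = R w" using \<open>?N w > 0\<close> by (simp flip: of_real_sum)
    finally show "f w - f z = (\<Sum>i<n. g i w * (w i - z i))"
      by (simp add: g_def R_def distrib_right sum.distrib)
  qed
  ultimately show ?R by blast
next
  assume ?R
  then obtain g where g: "\<And>i. i < n \<Longrightarrow> (g i \<longlongrightarrow> g i z) (at z within Cn n)"
    "\<forall>\<^sub>F w in at z within Cn n. f w - f z = (\<Sum>i<n. g i w * (w i - z i))" by blast
  let ?N = "\<lambda>w. \<Sum>i<n. cmod (w i - z i)"
  have "((\<lambda>w. \<Sum>i<n. cmod (g i w - g i z)) \<longlongrightarrow> (\<Sum>i<n. cmod (g i z - g i z))) (at z within Cn n)"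
    using g(1) by (intro tendsto_intros) auto
  then have lim: "((\<lambda>w. \<Sum>i<n. cmod (g i w - g i z)) \<longlongrightarrow> 0) (at z within Cn n)" by simp
  have "((\<lambda>w. cmod (f w - f z - (\<Sum>i<n. g i z * (w i - z i))) / ?N w) \<longlongrightarrow> 0) (at z within Cn n)"
  proof (rule tendsto_0_le[OF lim, of _ 1])
    show "\<forall>\<^sub>F w in at z within Cn n. norm (cmod (f w - f z - (\<Sum>i<n. g i z * (w i - z i))) / ?N w)
        \<le> norm (\<Sum>i<n. cmod (g i w - g i z)) * 1"
      using g(2)
    proof eventually_elim
      case (elim w)
      have "f w - f z - (\<Sum>i<n. g i z * (w i - z i)) = (\<Sum>i<n. (g i w - g i z) * (w i - z i))"
        unfolding elim by (simp add: left_diff_distrib sum_subtractf)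
      also have "cmod \<dots> \<le> (\<Sum>i<n. cmod (g i w - g i z) * cmod (w i - z i))"
        by (intro order_trans[OF norm_sum]) (simp add: norm_mult)
      also have "\<dots> \<le> (\<Sum>i<n. cmod (g i w - g i z) * ?N w)"
        by (intro sum_mono mult_left_mono) (auto intro: member_le_sum)
      also have "\<dots> = (\<Sum>i<n. cmod (g i w - g i z)) * ?N w"
        by (simp add: sum_distrib_right)
      finally have le: "cmod (f w - f z - (\<Sum>i<n. g i z * (w i - z i))) \<le>
          (\<Sum>i<n. cmod (g i w - g i z)) * ?N w" .
      have "?N w \<ge> 0" by (intro sum_nonneg) simp
      then have "cmod (f w - f z - (\<Sum>i<n. g i z * (w i - z i))) / ?N w \<le> (\<Sum>i<n. cmod (g i w - g i z))"
      \<comment> \<open>For a vanishing denominator the quotient is 0 by convention.\<close>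
      proof (cases "?N w = 0")
        case False
        with \<open>?N w \<ge> 0\<close> have "?N w > 0" by linarith
        with le show ?thesis by (simp add: pos_divide_le_eq)
      qed (simp add: sum_nonneg)
      with \<open>?N w \<ge> 0\<close> show ?case by (simp add: sum_nonneg)
    qed
  qed
  then show ?L unfolding complex_differentiable_at_def by (rule exI[of _ "\<lambda>i. g i z"])
qed

section \<open>Rules of complex differentiation\<close>

lemma complex_differentiable_at_tendsto:
  assumes "complex_differentiable_at n f z" "z \<in> Cn n"
  shows "(f \<longlongrightarrow> f z) (at z within Cn n)"
proof -
  obtain g where g: "\<And>i. i < n \<Longrightarrow> (g i \<longlongrightarrow> g i z) (at z within Cn n)"
    "\<forall>\<^sub>F w in at z within Cn n. f w - f z = (\<Sum>i<n. g i w * (w i - z i))"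
    using assms complex_differentiable_at_iff by blast
  have "((\<lambda>w. f z + (\<Sum>i<n. g i w * (w i - z i))) \<longlongrightarrow> f z + (\<Sum>i<n. g i z * (z i - z i))) (at z within Cn n)"
    using g(1) by (intro tendsto_intros tendsto_coord) auto
  then have "((\<lambda>w. f z + (\<Sum>i<n. g i w * (w i - z i))) \<longlongrightarrow> f z) (at z within Cn n)" by simp
  moreover have "\<forall>\<^sub>F w in at z within Cn n. f z + (\<Sum>i<n. g i w * (w i - z i)) = f w"
    using g(2) by eventually_elim (simp add: algebra_simps)
  ultimately show ?thesis by (rule Lim_transform_eventually)
qed

lemma complex_differentiable_at_cong:
  assumes "complex_differentiable_at n f z" "\<forall>\<^sub>F w in at z within Cn n. f w = g w" "f z = g z"
  shows "complex_differentiable_at n g z"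
proof -
  obtain c where "((\<lambda>w. cmod (f w - f z - (\<Sum>i<n. c i * (w i - z i))) / (\<Sum>i<n. cmod (w i - z i))) \<longlongrightarrow> 0)
            (at z within Cn n)" using assms(1) unfolding complex_differentiable_at_def by blast
  then have "((\<lambda>w. cmod (g w - g z - (\<Sum>i<n. c i * (w i - z i))) / (\<Sum>i<n. cmod (w i - z i))) \<longlongrightarrow> 0)
            (at z within Cn n)"
    by (rule Lim_transform_eventually) (use assms(2) in \<open>eventually_elim, simp add: assms(3)\<close>)
  then show ?thesis unfolding complex_differentiable_at_def by blast
qed

lemma complex_differentiable_at_const: "z \<in> Cn n \<Longrightarrow> complex_differentiable_at n (\<lambda>_. c) z"
  by (subst complex_differentiable_at_iff) (auto intro!: exI[of _ "\<lambda>_ _. 0"])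

lemma complex_differentiable_at_coord:
  assumes "z \<in> Cn n"
  shows "complex_differentiable_at n (\<lambda>w. w i) z"
proof (cases "i < n")
  case True
  have "(\<Sum>k<n. (if k = i then 1 else 0) * (w k - z k)) = w i - z i" for w
    using True by (subst sum.remove[of _ i]) (auto intro!: sum.neutral)
  then show ?thesis using assms
    by (subst complex_differentiable_at_iff) (auto intro!: exI[of _ "\<lambda>k _. if k = i then 1 else 0"])
next
  case False
  have "\<forall>\<^sub>F w in at z within Cn n. 0 = w i"
    using eventually_in_Cn by eventually_elim (use False in \<open>simp add: Cn_def\<close>)
  then show ?thesis
    using complex_differentiable_at_cong[OF complex_differentiable_at_const[OF assms, of 0], of "\<lambda>w. w i"]
      False assms by (simp add: Cn_def)
qed

lemma complex_differentiable_at_mult: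
  assumes "complex_differentiable_at n f z" "complex_differentiable_at n g z" "z \<in> Cn n"
  shows "complex_differentiable_at n (\<lambda>w. f w * g w) z"
proof -
  obtain a where a: "\<And>i. i < n \<Longrightarrow> (a i \<longlongrightarrow> a i z) (at z within Cn n)"
    "\<forall>\<^sub>F w in at z within Cn n. f w - f z = (\<Sum>i<n. a i w * (w i - z i))"
    using assms complex_differentiable_at_iff by blast
  obtain b where b: "\<And>i. i < n \<Longrightarrow> (b i \<longlongrightarrow> b i z) (at z within Cn n)"
    "\<forall>\<^sub>F w in at z within Cn n. g w - g z = (\<Sum>i<n. b i w * (w i - z i))"
    using assms complex_differentiable_at_iff by blast
  have "\<forall>\<^sub>F w in at z within Cn n. f w * g w - f z * g z =
      (\<Sum>i<n. (a i w * g w + f z * b i w) * (w i - z i))"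
    using a(2) b(2)
  proof eventually_elim
    case (elim w)
    have "f w * g w - f z * g z = (f w - f z) * g w + f z * (g w - g z)" by (simp add: algebra_simps)
    also have "\<dots> = (\<Sum>i<n. a i w * (w i - z i) * g w) + (\<Sum>i<n. f z * (b i w * (w i - z i)))"
      unfolding elim by (simp add: sum_distrib_left sum_distrib_right)
    finally show ?case by (simp add: sum.distrib[symmetric] algebra_simps)
  qed
  moreover have "\<forall>i<n. ((\<lambda>w. a i w * g w + f z * b i w) \<longlongrightarrow> a i z * g z + f z * b i z) (at z within Cn n)"
    using a(1) b(1) complex_differentiable_at_tendsto[OF assms(2,3)] by (intro allI impI tendsto_intros) auto
  ultimately show ?thesis
    using assms(3) by (subst complex_differentiable_at_iff) (auto intro!: exI[of _ "\<lambda>i w. a i w * g w + f z * b i w"])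
qed

lemma complex_differentiable_at_inverse:
  assumes "complex_differentiable_at n f z" "f z \<noteq> 0" "z \<in> Cn n"
  shows "complex_differentiable_at n (\<lambda>w. inverse (f w)) z"
proof -
  obtain a where a: "\<And>i. i < n \<Longrightarrow> (a i \<longlongrightarrow> a i z) (at z within Cn n)"
    "\<forall>\<^sub>F w in at z within Cn n. f w - f z = (\<Sum>i<n. a i w * (w i - z i))"
    using assms complex_differentiable_at_iff by blast
  have f: "(f \<longlongrightarrow> f z) (at z within Cn n)" using complex_differentiable_at_tendsto assms by blast
  have "\<forall>\<^sub>F w in at z within Cn n. inverse (f w) - inverse (f z) =
      (\<Sum>i<n. - (inverse (f w) * inverse (f z) * a i w) * (w i - z i))"
    using a(2) tendsto_imp_eventually_ne[OF f assms(2)]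
  proof eventually_elim
    case (elim w)
    have "inverse (f w) - inverse (f z) = - (inverse (f w) * inverse (f z)) * (f w - f z)"
      using elim(2) assms(2) by (simp add: field_simps)
    then show ?case unfolding elim(1) by (simp add: sum_distrib_left mult.assoc)
  qed
  moreover have "\<forall>i<n. ((\<lambda>w. - (inverse (f w) * inverse (f z) * a i w)) \<longlongrightarrow>
      - (inverse (f z) * inverse (f z) * a i z)) (at z within Cn n)"
    using a(1) f assms(2) by (intro allI impI tendsto_intros) auto
  ultimately show ?thesis
    using assms(3) by (subst complex_differentiable_at_iff)
      (auto intro!: exI[of _ "\<lambda>i w. - (inverse (f w) * inverse (f z) * a i w)"])
qed

lemma complex_differentiable_at_divide:
  assumes "complex_differentiable_at n f z" "complex_differentiable_at n g z" "g z \<noteq> 0" "z \<in> Cn n"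
  shows "complex_differentiable_at n (\<lambda>w. f w / g w) z"
  using assms complex_differentiable_at_mult[OF assms(1) complex_differentiable_at_inverse[OF assms(2,3,4)]]
  by (simp add: divide_inverse)

text \<open>The filter at \<open>h z\<close> is punctured, but \<open>h\<close> may return to the
  value \<open>h z\<close> near \<open>z\<close>; hence the separate assumption
  \<open>P (h z)\<close>.\<close>

lemma eventually_compose_within:
  assumes "\<forall>\<^sub>F y in at (h z) within S. P y" "P (h z)" "(h \<longlongrightarrow> h z) F" "\<forall>\<^sub>F w in F. h w \<in> S"
  shows "\<forall>\<^sub>F w in F. P (h w)"
proof -
  have "\<forall>\<^sub>F y in nhds (h z). y \<in> S \<longrightarrow> P y"
    using assms(1) unfolding eventually_at_filter by eventually_elim (use assms(2) in auto)
  then have "\<forall>\<^sub>F w in F. h w \<in> S \<longrightarrow> P (h w)" using assms(3) unfolding filterlim_iff by blast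
  with assms(4) show ?thesis by eventually_elim simp
qed

text \<open>Differentiability is only defined within \<open>Cn n\<close>, so a map that is to be
  composed must also keep points near \<open>z\<close> in \<open>Cn n\<close>.\<close>

definition complex_differentiable_map_at :: "nat \<Rightarrow> (cvec \<Rightarrow> cvec) \<Rightarrow> cvec \<Rightarrow> bool" where
  "complex_differentiable_map_at n h z \<longleftrightarrow>
     (\<forall>i<n. complex_differentiable_at n (\<lambda>w. h w i) z) \<and> (\<forall>\<^sub>F w in at z within Cn n. h w \<in> Cn n) \<and>
     z \<in> Cn n \<and> h z \<in> Cn n"

lemma complex_differentiable_map_at_tendsto:
  "complex_differentiable_map_at n h z \<Longrightarrow> (h \<longlongrightarrow> h z) (at z within Cn n)"
  unfolding complex_differentiable_map_at_def
  by (intro tendsto_Cn[where n = n]) (auto intro: complex_differentiable_at_tendsto)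

lemma complex_differentiable_map_at_eventually:
  assumes "complex_differentiable_map_at n h z" "\<forall>\<^sub>F y in at (h z) within Cn n. P y" "P (h z)"
  shows "\<forall>\<^sub>F w in at z within Cn n. P (h w)"
  using eventually_compose_within[OF assms(2,3) complex_differentiable_map_at_tendsto[OF assms(1)]]
    assms(1) unfolding complex_differentiable_map_at_def by blast

lemma complex_differentiable_at_compose:
  assumes f: "complex_differentiable_at n f (h z)" and h: "complex_differentiable_map_at n h z"
  shows "complex_differentiable_at n (\<lambda>w. f (h w)) z"
proof -
  have z: "z \<in> Cn n" "h z \<in> Cn n" and hC: "\<forall>\<^sub>F w in at z within Cn n. h w \<in> Cn n"
    using h unfolding complex_differentiable_map_at_def by blast+
  obtain a where a: "\<And>i. i < n \<Longrightarrow> (a i \<longlongrightarrow> a i (h z)) (at (h z) within Cn n)"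
    "\<forall>\<^sub>F y in at (h z) within Cn n. f y - f (h z) = (\<Sum>i<n. a i y * (y i - h z i))"
    using f z complex_differentiable_at_iff by blast
  have "\<forall>i\<in>{..<n}. \<exists>b. (\<forall>k<n. (b k \<longlongrightarrow> b k z) (at z within Cn n)) \<and>
      (\<forall>\<^sub>F w in at z within Cn n. h w i - h z i = (\<Sum>k<n. b k w * (w k - z k)))"
  proof
    fix i assume "i \<in> {..<n}"
    then have "complex_differentiable_at n (\<lambda>w. h w i) z"
      using h unfolding complex_differentiable_map_at_def by blast
    then show "\<exists>b. (\<forall>k<n. (b k \<longlongrightarrow> b k z) (at z within Cn n)) \<and>
      (\<forall>\<^sub>F w in at z within Cn n. h w i - h z i = (\<Sum>k<n. b k w * (w k - z k)))"
      by (subst (asm) complex_differentiable_at_iff[OF z(1)])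
  qed
  from bchoice[OF this] obtain b where b: "\<And>i k. i < n \<Longrightarrow> k < n \<Longrightarrow> (b i k \<longlongrightarrow> b i k z) (at z within Cn n)"
    "\<And>i. i < n \<Longrightarrow> \<forall>\<^sub>F w in at z within Cn n. h w i - h z i = (\<Sum>k<n. b i k w * (w k - z k))"
    by blast
  have ah: "((\<lambda>w. a i (h w)) \<longlongrightarrow> a i (h z)) (at z within Cn n)" if "i < n" for i
    using continuous_within_tendsto_compose[of "h z" "Cn n" "a i" h "at z within Cn n"]
      a(1)[OF that] hC complex_differentiable_map_at_tendsto[OF h] by (simp add: continuous_within)
  have ev1: "\<forall>\<^sub>F w in at z within Cn n. f (h w) - f (h z) = (\<Sum>i<n. a i (h w) * (h w i - h z i))"
    by (rule complex_differentiable_map_at_eventually[OF h a(2)]) simp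
  have ev2: "\<forall>\<^sub>F w in at z within Cn n. \<forall>i\<in>{..<n}. h w i - h z i = (\<Sum>k<n. b i k w * (w k - z k))"
    using b(2) by (intro eventually_ball_finite) auto
  have "\<forall>\<^sub>F w in at z within Cn n. f (h w) - f (h z) =
      (\<Sum>k<n. (\<Sum>i<n. a i (h w) * b i k w) * (w k - z k))"
    using ev1 ev2
  proof eventually_elim
    case (elim w)
    have "f (h w) - f (h z) = (\<Sum>i<n. a i (h w) * (\<Sum>k<n. b i k w * (w k - z k)))"
      unfolding elim(1) using elim(2) by (intro sum.cong) auto
    also have "\<dots> = (\<Sum>i<n. \<Sum>k<n. a i (h w) * b i k w * (w k - z k))"
      by (simp add: sum_distrib_left mult.assoc)
    also have "\<dots> = (\<Sum>k<n. \<Sum>i<n. a i (h w) * b i k w * (w k - z k))" by (rule sum.swap)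
    finally show ?case by (simp add: sum_distrib_right)
  qed
  moreover have "\<forall>k<n. ((\<lambda>w. \<Sum>i<n. a i (h w) * b i k w) \<longlongrightarrow> (\<Sum>i<n. a i (h z) * b i k z)) (at z within Cn n)"
    using ah b(1) by (intro allI impI tendsto_intros) auto
  ultimately show ?thesis
    using z by (subst complex_differentiable_at_iff) (auto intro!: exI[of _ "\<lambda>k w. \<Sum>i<n. a i (h w) * b i k w"])
qed

lemma complex_differentiable_map_at_compose:
  assumes "complex_differentiable_map_at n f (h z)" "complex_differentiable_map_at n h z"
  shows "complex_differentiable_map_at n (\<lambda>w. f (h w)) z"
  unfolding complex_differentiable_map_at_def
proof (intro conjI allI impI)
  fix i assume "i < n"
  then show "complex_differentiable_at n (\<lambda>w. f (h w) i) z"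
    using assms(1) complex_differentiable_at_compose[OF _ assms(2), of "\<lambda>y. f y i"]
    unfolding complex_differentiable_map_at_def by blast
next
  show "\<forall>\<^sub>F w in at z within Cn n. f (h w) \<in> Cn n"
    by (rule complex_differentiable_map_at_eventually[OF assms(2)])
      (use assms(1) in \<open>auto simp: complex_differentiable_map_at_def\<close>)
qed (use assms in \<open>auto simp: complex_differentiable_map_at_def\<close>)

lemma complex_differentiable_map_at_id: "z \<in> Cn n \<Longrightarrow> complex_differentiable_map_at n (\<lambda>w. w) z"
  unfolding complex_differentiable_map_at_def
  using complex_differentiable_at_coord eventually_in_Cn by blast

lemma complex_differentiable_at_chart_vec:
  "z \<in> Cn n \<Longrightarrow> complex_differentiable_at n (\<lambda>w. chart_vec n j w p) z"
  unfolding chart_vec_def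
  by (cases "n \<le> p"; cases "p < j"; cases "p = j")
    (simp_all add: complex_differentiable_at_coord complex_differentiable_at_const)

lemma complex_differentiable_map_at_std_chart:
  assumes "j < n" "z \<in> Cn n"
  shows "complex_differentiable_map_at n (\<lambda>w. fst (std_chart n j w)) z"
  unfolding complex_differentiable_map_at_def using assms
  by (auto simp: std_chart_eq intro!: complex_differentiable_at_mult
      complex_differentiable_at_coord complex_differentiable_at_chart_vec
      fst_std_chart_Cn[unfolded std_chart_eq fst_conv])
    (use fst_std_chart_Cn[of j n] in \<open>simp_all add: std_chart_eq\<close>)

lemma complex_differentiable_map_at_chart_inv:
  assumes "j < n" "z \<in> Cn n" "\<And>q. complex_differentiable_at n (\<lambda>w. v w q) z"
    "complex_differentiable_at n c z" "v z j \<noteq> 0"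
  shows "complex_differentiable_map_at n (\<lambda>w. chart_inv n j (c w) (v w)) z"
  unfolding complex_differentiable_map_at_def
proof (intro conjI allI impI)
  fix i assume "i < n"
  then consider "i < n - 1" "i < j" | "i < n - 1" "\<not> i < j" | "\<not> i < n - 1" "i = n - 1" by linarith
  then show "complex_differentiable_at n (\<lambda>w. chart_inv n j (c w) (v w) i) z"
    unfolding chart_inv_def using assms
    by cases (simp_all add: complex_differentiable_at_divide complex_differentiable_at_mult)
qed (use assms in simp_all)

section \<open>Holomorphic atlases\<close>

text \<open>A germ at \<open>z\<close> of a coordinate change from the inverse chart \<open>\<psi>\<close> to the inverse chart
  \<open>\<phi>\<close> with domain \<open>V\<close>.\<close>

definition transition :: "nat \<Rightarrow> (cvec \<Rightarrow> 'a) \<Rightarrow> cvec \<Rightarrow> cvec set \<Rightarrow> (cvec \<Rightarrow> 'a) \<Rightarrow> cvec \<Rightarrow> bool" where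
  "transition n \<psi> z V \<phi> w \<longleftrightarrow> (\<exists>h. complex_differentiable_map_at n h z \<and> h z = w \<and>
     (\<forall>\<^sub>F x in at z within Cn n. h x \<in> V \<and> \<phi> (h x) = \<psi> x))"

text \<open>The germs are known on punctured neighbourhoods only. The last two hypotheses supply the
  value at \<open>w\<close>, which the first germ may take at points other than
  \<open>z\<close>.\<close>

lemma transition_comp:
  assumes "transition n \<psi> z V \<phi> w" "transition n \<phi> w W \<rho> y" "y \<in> W" "\<rho> y = \<phi> w"
  shows "transition n \<psi> z W \<rho> y"
proof -
  obtain h where h: "complex_differentiable_map_at n h z" "h z = w"
    "\<forall>\<^sub>F x in at z within Cn n. h x \<in> V \<and> \<phi> (h x) = \<psi> x"
    using assms(1) unfolding transition_def by blast
  obtain g where g: "complex_differentiable_map_at n g w" "g w = y"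
    "\<forall>\<^sub>F x in at w within Cn n. g x \<in> W \<and> \<rho> (g x) = \<phi> x"
    using assms(2) unfolding transition_def by blast
  have "\<forall>\<^sub>F x in at z within Cn n. g (h x) \<in> W \<and> \<rho> (g (h x)) = \<phi> (h x)"
    by (rule complex_differentiable_map_at_eventually[OF h(1)]) (use g h(2) assms(3,4) in auto)
  then have "\<forall>\<^sub>F x in at z within Cn n. g (h x) \<in> W \<and> \<rho> (g (h x)) = \<psi> x"
    using h(3) by eventually_elim simp
  then show ?thesis unfolding transition_def
    using complex_differentiable_map_at_compose[of n g h z] g h by (intro exI[of _ "\<lambda>x. g (h x)"]) auto
qed

lemma transition_same:
  assumes "z \<in> Cn n" "\<forall>\<^sub>F x in at z within Cn n. x \<in> V \<and> \<phi> x = \<psi> x"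
  shows "transition n \<psi> z V \<phi> z"
  unfolding transition_def using assms complex_differentiable_map_at_id by blast

lemma transition_shrink:
  assumes "transition n \<psi> z V \<phi> w" "open_Cn n V'" "w \<in> V'"
  shows "transition n \<psi> z V' \<phi> w"
proof -
  obtain h where h: "complex_differentiable_map_at n h z" "h z = w"
    "\<forall>\<^sub>F x in at z within Cn n. h x \<in> V \<and> \<phi> (h x) = \<psi> x"
    using assms(1) unfolding transition_def by blast
  have "\<forall>\<^sub>F x in at z within Cn n. h x \<in> V'"
    by (rule complex_differentiable_map_at_eventually[OF h(1)])
      (use open_Cn_eventually[OF assms(2,3)] h(2) assms(3) in auto)
  with h show ?thesis unfolding transition_def
    by (intro exI[of _ h]) (auto elim: eventually_elim2)
qed

text \<open>\<open>holomorphic_map\<close> is phrased with \<open>inv_into\<close>; injectivity of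
  the target chart identifies it near \<open>z\<close> with the germ.\<close>

lemma transition_inv_into:
  assumes "transition n \<psi> z V \<phi> w" "inj_on \<phi> V" "w \<in> V" "\<phi> w = \<psi> z" "i < n"
  shows "complex_differentiable_at n (\<lambda>x. inv_into V \<phi> (\<psi> x) i) z"
proof -
  obtain h where h: "complex_differentiable_map_at n h z" "h z = w"
    "\<forall>\<^sub>F x in at z within Cn n. h x \<in> V \<and> \<phi> (h x) = \<psi> x"
    using assms(1) unfolding transition_def by blast
  have inv: "h x i = inv_into V \<phi> (\<psi> x) i" if "h x \<in> V \<and> \<phi> (h x) = \<psi> x" for x
    using that assms(2) inv_into_f_f[of \<phi> V "h x"] by simp
  show ?thesis
  proof (rule complex_differentiable_at_cong)
    show "complex_differentiable_at n (\<lambda>x. h x i) z"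
      using h(1) assms(5) unfolding complex_differentiable_map_at_def by blast
    show "\<forall>\<^sub>F x in at z within Cn n. h x i = inv_into V \<phi> (\<psi> x) i"
      using h(3) by eventually_elim (rule inv)
    show "h z i = inv_into V \<phi> (\<psi> z) i" using assms h(2) by (intro inv) auto
  qed
qed

text \<open>The Hausdorff condition for the images of two inverse charts, in sequential form.\<close>

definition separated :: "cvec set \<Rightarrow> (cvec \<Rightarrow> 'a) \<Rightarrow> cvec set \<Rightarrow> (cvec \<Rightarrow> 'a) \<Rightarrow> bool" where
  "separated U \<psi> V \<phi> \<longleftrightarrow> (\<forall>zs ws z w. (\<forall>m::nat. zs m \<in> U \<and> ws m \<in> V \<and> \<psi> (zs m) = \<phi> (ws m)) \<longrightarrow>
     zs \<longlonglongrightarrow> z \<longrightarrow> ws \<longlonglongrightarrow> w \<longrightarrow> z \<in> U \<longrightarrow> w \<in> V \<longrightarrow> \<psi> z = \<phi> w)"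

lemma separatedI:
  assumes "\<And>zs ws z w. (\<And>m::nat. zs m \<in> U) \<Longrightarrow> (\<And>m. ws m \<in> V) \<Longrightarrow> (\<And>m. \<psi> (zs m) = \<phi> (ws m)) \<Longrightarrow>
     zs \<longlonglongrightarrow> z \<Longrightarrow> ws \<longlonglongrightarrow> w \<Longrightarrow> z \<in> U \<Longrightarrow> w \<in> V \<Longrightarrow> \<psi> z = \<phi> w"
  shows "separated U \<psi> V \<phi>"
  unfolding separated_def using assms by blast

lemma separatedD:
  assumes "separated U \<psi> V \<phi>" "\<And>m::nat. zs m \<in> U" "\<And>m. ws m \<in> V" "\<And>m. \<psi> (zs m) = \<phi> (ws m)"
    "zs \<longlonglongrightarrow> z" "ws \<longlonglongrightarrow> w" "z \<in> U" "w \<in> V"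
  shows "\<psi> z = \<phi> w"
  using assms unfolding separated_def by blast

lemma separated_sym: "separated U \<psi> V \<phi> \<Longrightarrow> separated V \<phi> U \<psi>"
  unfolding separated_def by metis

lemma separated_subset: "separated U \<psi> V \<phi> \<Longrightarrow> U' \<subseteq> U \<Longrightarrow> V' \<subseteq> V \<Longrightarrow> separated U' \<psi> V' \<phi>"
  unfolding separated_def by blast

text \<open>Separation shows that a blow-up centre, and later the image of the closed domain, are
  closed, so that removing them leaves open chart domains. Openness of overlaps is contained in
  \<open>transition\<close>, whose germ takes values in \<open>V\<close> near
  \<open>z\<close>.\<close>

definition complex_atlas :: "nat \<Rightarrow> 'a cmfd \<Rightarrow> bool" where
  "complex_atlas n M \<longleftrightarrow>
     (\<forall>U \<psi>. (U, \<psi>) \<in> charts M \<longrightarrow> open_Cn n U \<and> inj_on \<psi> U \<and> \<psi> ` U \<subseteq> pts M) \<and>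
     (\<forall>x\<in>pts M. \<exists>U \<psi> z. (U, \<psi>) \<in> charts M \<and> z \<in> U \<and> x = \<psi> z) \<and>
     (\<forall>U \<psi> V \<phi>. (U, \<psi>) \<in> charts M \<longrightarrow> (V, \<phi>) \<in> charts M \<longrightarrow> separated U \<psi> V \<phi> \<and>
        (\<forall>z\<in>U. \<forall>w\<in>V. \<psi> z = \<phi> w \<longrightarrow> transition n \<psi> z V \<phi> w))"

lemma complex_atlasI:
  assumes "\<And>U \<psi>. (U, \<psi>) \<in> charts M \<Longrightarrow> open_Cn n U"
    "\<And>U \<psi>. (U, \<psi>) \<in> charts M \<Longrightarrow> inj_on \<psi> U"
    "\<And>U \<psi> z. (U, \<psi>) \<in> charts M \<Longrightarrow> z \<in> U \<Longrightarrow> \<psi> z \<in> pts M"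
    "\<And>x. x \<in> pts M \<Longrightarrow> \<exists>U \<psi> z. (U, \<psi>) \<in> charts M \<and> z \<in> U \<and> x = \<psi> z"
    "\<And>U \<psi> V \<phi>. (U, \<psi>) \<in> charts M \<Longrightarrow> (V, \<phi>) \<in> charts M \<Longrightarrow> separated U \<psi> V \<phi>"
    "\<And>U \<psi> V \<phi> z w. (U, \<psi>) \<in> charts M \<Longrightarrow> (V, \<phi>) \<in> charts M \<Longrightarrow> z \<in> U \<Longrightarrow> w \<in> V \<Longrightarrow>
       \<psi> z = \<phi> w \<Longrightarrow> transition n \<psi> z V \<phi> w"
  shows "complex_atlas n M"
  unfolding complex_atlas_def
  by (intro conjI allI impI ballI image_subsetI; (rule assms; assumption)?)

lemma complex_atlasD:
  assumes "complex_atlas n M" "(U, \<psi>) \<in> charts M"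
  shows "open_Cn n U" "inj_on \<psi> U" "z \<in> U \<Longrightarrow> \<psi> z \<in> pts M"
    "(V, \<phi>) \<in> charts M \<Longrightarrow> separated U \<psi> V \<phi>"
    "(V, \<phi>) \<in> charts M \<Longrightarrow> z \<in> U \<Longrightarrow> w \<in> V \<Longrightarrow> \<psi> z = \<phi> w \<Longrightarrow> transition n \<psi> z V \<phi> w"
  using assms unfolding complex_atlas_def by blast+

lemma complex_atlas_covered:
  assumes "complex_atlas n M" "x \<in> pts M"
  obtains U \<psi> z where "(U, \<psi>) \<in> charts M" "z \<in> U" "x = \<psi> z"
proof -
  have "\<forall>x\<in>pts M. \<exists>U \<psi> z. (U, \<psi>) \<in> charts M \<and> z \<in> U \<and> x = \<psi> z"
    using assms(1) unfolding complex_atlas_def by (elim conjE)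
  then show ?thesis using assms(2) that by meson
qed

section \<open>The atlas of a blow-up\<close>

lemma line_Cn_eq:
  assumes "(y, L) \<in> bl_Cn n" "y \<noteq> origin"
  shows "L = line y"
proof -
  obtain v c where v: "L = line v" "y = (\<lambda>p. c * v p)"
    using assms unfolding bl_Cn_def CP_def line_def by auto
  then have "c \<noteq> 0" using assms(2) by auto
  then show ?thesis using v line_scale[of c v] by (simp add: mult.commute)
qed

lemma blow_iota_eqD:
  assumes "inj_on s (Cn n)" "\<And>L. Exc p L \<notin> s ` Cn n" "x \<in> bl_Cn n" "x' \<in> bl_Cn n"
    "blow_iota s p x = blow_iota s p x'"
  shows "x = x'"
proof -
  obtain y L y' L' where x: "x = (y, L)" "x' = (y', L')" by fastforce
  have y: "y \<in> Cn n" "y' \<in> Cn n" using assms(3,4) x unfolding bl_Cn_def by auto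
  show ?thesis
  proof (cases "y = origin \<or> y' = origin")
    case True
    then show ?thesis using assms y x by (auto simp: blow_iota_def split: if_splits) (metis image_eqI)+
  next
    case False
    then have "y = y'" using assms(1,5) y x by (auto simp: blow_iota_def inj_on_def)
    then show ?thesis using line_Cn_eq assms(3,4) x False by metis
  qed
qed

lemma blow_iota_std_chart:
  "j < n \<Longrightarrow> blow_iota s p (std_chart n j z) =
     (if z (n - 1) = 0 then Exc p (line (chart_vec n j z)) else s (fst (std_chart n j z)))"
  using fst_std_chart_eq_origin[of j n z] by (simp add: blow_iota_def std_chart_eq)

lemma transition_std_chart_down:
  assumes "j < n" "z \<in> Cn n" "z (n - 1) \<noteq> 0"
  shows "transition n (blow_iota s p \<circ> std_chart n j) z (Cn n) s (fst (std_chart n j z))"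
proof -
  have "\<forall>\<^sub>F w in at z within Cn n. w (n - 1) \<noteq> 0"
    using tendsto_imp_eventually_ne[OF tendsto_coord[where z = z and i = "n - 1"] assms(3)] by simp
  then have "\<forall>\<^sub>F w in at z within Cn n. fst (std_chart n j w) \<in> Cn n \<and>
      s (fst (std_chart n j w)) = (blow_iota s p \<circ> std_chart n j) w"
    by eventually_elim (use assms(1) in \<open>simp add: blow_iota_std_chart\<close>)
  with complex_differentiable_map_at_std_chart[OF assms(1,2)] show ?thesis
    unfolding transition_def by blast
qed

text \<open>A nonzero vector \<open>y\<close> serves at once as a point and as homogeneous
  coordinates of its own line; hence the scalar 1 in \<open>chart_inv\<close>.\<close>

lemma transition_std_chart_up:
  assumes "j < n" "y \<in> Cn n" "y j \<noteq> 0"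
  shows "transition n s y (Cn n) (blow_iota s p \<circ> std_chart n j) (chart_inv n j 1 y)"
proof -
  have "\<forall>\<^sub>F w in at y within Cn n. w \<in> Cn n \<and> w j \<noteq> 0"
    using tendsto_imp_eventually_ne[OF tendsto_coord[where z = y and i = j] assms(3)] eventually_in_Cn by eventually_elim simp
  then have "\<forall>\<^sub>F w in at y within Cn n. chart_inv n j 1 w \<in> Cn n \<and>
      (blow_iota s p \<circ> std_chart n j) (chart_inv n j 1 w) = s w"
  proof eventually_elim
    case (elim w)
    then have "w \<noteq> origin" by auto
    with elim show ?case using assms(1) by (simp add: blow_iota_def std_chart_chart_inv)
  qed
  moreover have "complex_differentiable_map_at n (\<lambda>w. chart_inv n j 1 w) y"
    using assms by (intro complex_differentiable_map_at_chart_inv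
        complex_differentiable_at_coord complex_differentiable_at_const)
  ultimately show ?thesis unfolding transition_def by blast
qed

text \<open>Old charts only lose the centre, so the work concerns the new charts. Off the
  exceptional divisor they factor through \<open>s\<close>, where the atlas of \<open>M\<close>
  applies. On the divisor only new charts meet, and their coordinate change is explicit.\<close>

lemma blow_up_complex_atlas:
  assumes M: "complex_atlas n M" and s: "(Cn n, s) \<in> charts M"
    and new: "\<And>L. Exc p L \<notin> pts M" and n: "0 < n"
  shows "complex_atlas n (blow_up n s p M)"
proof -
  define e where "e j = blow_iota s p \<circ> std_chart n j" for j
  have s_inj: "inj_on s (Cn n)" and s_pts: "\<And>z. z \<in> Cn n \<Longrightarrow> s z \<in> pts M"
    using complex_atlasD[OF M s] by blast+
  have origin_Cn: "origin \<in> Cn n" by (simp add: Cn_def)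
  have e_eq: "e j z = (if z (n - 1) = 0 then Exc p (line (chart_vec n j z)) else s (fst (std_chart n j z)))"
    if "j < n" for j z
    using blow_iota_std_chart[OF that] by (simp add: e_def)
  have iota_inj: "x = x'" if "x \<in> bl_Cn n" "x' \<in> bl_Cn n" "blow_iota s p x = blow_iota s p x'" for x x'
    by (rule blow_iota_eqD[OF s_inj _ that]) (metis imageE new s_pts)
  have e_std: "std_chart n i z = std_chart n j w"
    if "i < n" "j < n" "z \<in> Cn n" "w \<in> Cn n" "e i z = e j w" for i j z w
  proof (rule iota_inj)
    show "blow_iota s p (std_chart n i z) = blow_iota s p (std_chart n j w)"
      using that(5) unfolding e_def comp_def .
  qed (use that std_chart_bl_Cn in auto)
  have e_inj: "inj_on (e j) (Cn n)" if "j < n" for j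
    by (rule inj_onI, rule inj_onD[OF std_chart_inj[OF that]], rule e_std[OF that that])
  have ch: "(U, \<psi>) \<in> charts (blow_up n s p M) \<longleftrightarrow>
      (\<exists>U0. (U0, \<psi>) \<in> charts M \<and> U = {z \<in> U0. \<psi> z \<noteq> s origin}) \<or> (\<exists>j<n. U = Cn n \<and> \<psi> = e j)" for U \<psi>
  proof -
    have "charts (blow_up n s p M) = {({z \<in> U. \<psi> z \<noteq> s origin}, \<psi>) | U \<psi>. (U, \<psi>) \<in> charts M}
        \<union> {(Cn n, e j) | j. j < n}"
      by (simp add: blow_up_def e_def)
    then show ?thesis by blast
  qed
  \<comment> \<open>Separation from the chart \<open>s\<close>, applied to the constant sequence
    \<open>origin\<close>, shows that the centre is closed.\<close>
  have old_open: "open_Cn n {z \<in> U. \<psi> z \<noteq> s origin}" if U: "(U, \<psi>) \<in> charts M" for U \<psi>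
  proof -
    have "open_Cn n (U - {z. \<psi> z = s origin})"
    proof (rule open_Cn_diff)
      show "open_Cn n U" using complex_atlasD[OF M U] by blast
      fix zs :: "nat \<Rightarrow> cvec" and z assume "\<And>m. zs m \<in> U" "\<And>m. zs m \<in> {z. \<psi> z = s origin}" "zs \<longlonglongrightarrow> z" "z \<in> U"
      then show "z \<in> {z. \<psi> z = s origin}"
        using separatedD[OF complex_atlasD(4)[OF M U s], of zs "\<lambda>_. origin" z origin] origin_Cn by auto
    qed
    moreover have "U - {z. \<psi> z = s origin} = {z \<in> U. \<psi> z \<noteq> s origin}" by blast
    ultimately show ?thesis by simp
  qed
  \<comment> \<open>By \<open>new\<close>, no old chart reaches the exceptional divisor, so an
    overlap forces the last coordinate to be nonzero.\<close>
  have old_new_eq: "w (n - 1) \<noteq> 0 \<and> \<psi> z = s (fst (std_chart n j w))"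
    if "(U, \<psi>) \<in> charts M" "z \<in> U" "j < n" "\<psi> z = e j w" for U \<psi> z j w
    using complex_atlasD(3)[OF M that(1,2)] new that(4) e_eq[OF that(3), of w] by (auto split: if_splits)
  show ?thesis
  proof (rule complex_atlasI)
    fix U \<psi> assume "(U, \<psi>) \<in> charts (blow_up n s p M)"
    then consider U0 where "(U0, \<psi>) \<in> charts M" "U = {z \<in> U0. \<psi> z \<noteq> s origin}"
      | j where "j < n" "U = Cn n" "\<psi> = e j" unfolding ch by blast
    note cases = this
    show "open_Cn n U"
    proof (cases rule: cases)
      case 1
      then show ?thesis using old_open by simp
    qed (simp add: open_Cn_def)
    show "inj_on \<psi> U"
    proof (cases rule: cases)
      case 1
      then show ?thesis by (intro inj_on_subset[OF complex_atlasD(2)[OF M 1(1)]]) blast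
    next
      case 2
      then show ?thesis using e_inj by simp
    qed
    fix z assume z: "z \<in> U"
    show "\<psi> z \<in> pts (blow_up n s p M)"
    proof (cases rule: cases)
      case 1
      then show ?thesis using z complex_atlasD(3)[OF M 1(1), of z] by (simp add: blow_up_def)
    next
      case 2
      then show ?thesis using std_chart_bl_Cn[of j n z] by (simp add: blow_up_def e_def)
    qed
  next
    fix x assume "x \<in> pts (blow_up n s p M)"
    then consider "x \<in> pts M" "x \<noteq> s origin" | y where "y \<in> bl_Cn n" "x = blow_iota s p y"
      by (auto simp: blow_up_def)
    then show "\<exists>U \<psi> z. (U, \<psi>) \<in> charts (blow_up n s p M) \<and> z \<in> U \<and> x = \<psi> z"
    proof cases
      case 1
      obtain U \<psi> z where "(U, \<psi>) \<in> charts M" "z \<in> U" "x = \<psi> z"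
        using complex_atlas_covered[OF M 1(1)] .
      then show ?thesis using 1(2) unfolding ch by blast
    next
      case 2
      then obtain j z where "j < n" "z \<in> Cn n" "y = std_chart n j z" using bl_Cn_covered by blast
      then have "x = e j z" using 2 by (simp add: e_def)
      then show ?thesis using \<open>j < n\<close> \<open>z \<in> Cn n\<close> unfolding ch by blast
    qed
  next
    fix U \<psi> V \<phi> assume U: "(U, \<psi>) \<in> charts (blow_up n s p M)" and V: "(V, \<phi>) \<in> charts (blow_up n s p M)"
    have sep_old_new: "separated {z \<in> U. \<psi> z \<noteq> s origin} \<psi> (Cn n) (e j)" if "(U, \<psi>) \<in> charts M" "j < n" for U \<psi> j
    proof (rule separatedI)
      fix zs ws z w
      assume zs: "\<And>m::nat. zs m \<in> {z \<in> U. \<psi> z \<noteq> s origin}" and ws: "\<And>m. ws m \<in> Cn n"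
        and eq: "\<And>m. \<psi> (zs m) = e j (ws m)" and lim: "zs \<longlonglongrightarrow> z" "ws \<longlonglongrightarrow> w"
        and z: "z \<in> {z \<in> U. \<psi> z \<noteq> s origin}" and w: "w \<in> Cn n"
      have eq': "\<psi> (zs m) = s (fst (std_chart n j (ws m)))" for m
        using old_new_eq[OF that(1) _ that(2) eq] zs by blast
      have "(\<lambda>m. fst (std_chart n j (ws m))) \<longlonglongrightarrow> fst (std_chart n j w)"
        using continuous_within_tendsto_compose[of w "Cn n" "\<lambda>w. fst (std_chart n j w)" ws sequentially]
          complex_differentiable_map_at_tendsto[OF complex_differentiable_map_at_std_chart[OF that(2) w]] ws lim(2)
        by (simp add: continuous_within)
      then have "\<psi> z = s (fst (std_chart n j w))"
        using separatedD[OF complex_atlasD(4)[OF M that(1) s], of zs "\<lambda>m. fst (std_chart n j (ws m))"]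
          zs eq' lim(1) z that(2) by simp
      \<comment> \<open>If the limit were on the exceptional divisor, \<open>\<psi> z\<close> would
        be the removed centre.\<close>
      moreover have "w (n - 1) \<noteq> 0"
        using calculation z fst_std_chart_eq_origin[OF that(2), of w] by auto
      ultimately show "\<psi> z = e j w" using e_eq that(2) by simp
    qed
    have sep_new_new: "separated (Cn n) (e i) (Cn n) (e j)" if "i < n" "j < n" for i j
    proof (rule separatedI)
      fix zs ws z w
      assume zs: "\<And>m::nat. zs m \<in> Cn n" and ws: "\<And>m. ws m \<in> Cn n"
        and eq: "\<And>m. e i (zs m) = e j (ws m)" and lim: "zs \<longlonglongrightarrow> z" "ws \<longlonglongrightarrow> w"
        and z: "z \<in> Cn n" and w: "w \<in> Cn n"
      have eq': "std_chart n i (zs m) = std_chart n j (ws m)" for m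
        using e_std[OF that zs ws eq] .
      have cv: "(\<lambda>m. chart_vec n k (vs m) q) \<longlonglongrightarrow> chart_vec n k v q"
        if "k < n" "\<And>m. vs m \<in> Cn n" "vs \<longlonglongrightarrow> v" "v \<in> Cn n" for k vs v q
        using continuous_within_tendsto_compose[of v "Cn n" "\<lambda>w. chart_vec n k w q" vs sequentially]
          complex_differentiable_at_tendsto[OF complex_differentiable_at_chart_vec] that
        by (simp add: continuous_within)
      have lc: "(\<lambda>m. vs m q) \<longlonglongrightarrow> v q" if "vs \<longlonglongrightarrow> v" for vs :: "nat \<Rightarrow> cvec" and v q
        using that unfolding tendsto_fun_iff by blast
      note cz = cv[OF that(1) zs lim(1) z] and cw = cv[OF that(2) ws lim(2) w]
      have prod_eq: "z (n - 1) * chart_vec n i z q = w (n - 1) * chart_vec n j w q" for q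
      proof (rule LIMSEQ_unique)
        show "(\<lambda>m. zs m (n - 1) * chart_vec n i (zs m) q) \<longlonglongrightarrow> z (n - 1) * chart_vec n i z q"
          by (intro tendsto_intros lc[OF lim(1)] cz)
        have "zs m (n - 1) * chart_vec n i (zs m) q = ws m (n - 1) * chart_vec n j (ws m) q" for m
          using arg_cong[OF eq', of "\<lambda>x. fst x q"] that by (simp add: std_chart_eq)
        then show "(\<lambda>m. zs m (n - 1) * chart_vec n i (zs m) q) \<longlonglongrightarrow> w (n - 1) * chart_vec n j w q"
          by (simp add: tendsto_mult lc[OF lim(2)] cw)
      qed
      have "chart_vec n i z q = chart_vec n i z j * chart_vec n j w q" for q
      proof (rule LIMSEQ_unique)
        have "chart_vec n i (zs m) q = chart_vec n i (zs m) j * chart_vec n j (ws m) q" for m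
          using eq'[unfolded std_chart_eq_iff[OF that zs ws]] by blast
        moreover have "(\<lambda>m. chart_vec n i (zs m) j * chart_vec n j (ws m) q) \<longlonglongrightarrow> chart_vec n i z j * chart_vec n j w q"
          by (intro tendsto_intros cz cw)
        ultimately show "(\<lambda>m. chart_vec n i (zs m) q) \<longlonglongrightarrow> chart_vec n i z j * chart_vec n j w q"
          by presburger
      qed (rule cz)
      then have "\<forall>q. chart_vec n i z q = chart_vec n i z j * chart_vec n j w q" ..
      moreover have "fst (std_chart n i z) = fst (std_chart n j w)"
        using prod_eq that by (simp add: std_chart_eq)
      ultimately have "std_chart n i z = std_chart n j w"
        using std_chart_eq_iff[OF that z w] by blast
      then show "e i z = e j w" by (simp add: e_def)
    qed
    from U V show "separated U \<psi> V \<phi>"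
      unfolding ch
    proof (elim disjE exE conjE; clarify)
      fix U0 V0 assume "(U0, \<psi>) \<in> charts M" "(V0, \<phi>) \<in> charts M"
      then show "separated {z \<in> U0. \<psi> z \<noteq> s origin} \<psi> {z \<in> V0. \<phi> z \<noteq> s origin} \<phi>"
        by (intro separated_subset[OF complex_atlasD(4)[OF M]]) auto
    qed (rule sep_old_new sep_new_new separated_sym[OF sep_old_new]; assumption)+
    fix z w assume z: "z \<in> U" and w: "w \<in> V" and eq: "\<psi> z = \<phi> w"
    \<comment> \<open>Germs in both directions between \<open>e j\<close> and \<open>s\<close>, so
      that an old and a new chart can be compared through \<open>s\<close>.\<close>
    have down: "e j y = s (fst (std_chart n j y)) \<and> fst (std_chart n j y) \<in> Cn n \<and>
        transition n (e j) y (Cn n) s (fst (std_chart n j y)) \<and>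
        transition n s (fst (std_chart n j y)) (Cn n) (e j) y" if "j < n" "y \<in> Cn n" "y (n - 1) \<noteq> 0" for j y
    proof -
      let ?x = "fst (std_chart n j y)"
      have "?x j = y (n - 1)" using that(1) by (simp add: std_chart_eq)
      then have x: "?x \<in> Cn n" "?x j \<noteq> 0" using that(1,3) by simp_all
      have bl: "(?x, snd (std_chart n j y)) \<in> bl_Cn n" using std_chart_bl_Cn[OF that(1), of y] by simp
      have "?x \<noteq> origin" using fst_std_chart_eq_origin[OF that(1)] that(3) by blast
      then have "std_chart n j y = (?x, line ?x)" using line_Cn_eq[OF bl] by (metis prod.collapse)
      also have "\<dots> = std_chart n j (chart_inv n j 1 ?x)"
        using std_chart_chart_inv[OF that(1) x, of 1] by simp
      finally have "chart_inv n j 1 ?x = y"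
        using inj_onD[OF std_chart_inj[OF that(1)]] that(2) n by simp
      then show ?thesis
        using transition_std_chart_down[OF that, of s p] transition_std_chart_up[OF that(1) x, of s p]
          e_eq[OF that(1), of y] that(3) x(1) unfolding e_def[symmetric] by simp
    qed
    consider (old) U0 V0 where "(U0, \<psi>) \<in> charts M" "U = {z \<in> U0. \<psi> z \<noteq> s origin}"
        "(V0, \<phi>) \<in> charts M" "V = {z \<in> V0. \<phi> z \<noteq> s origin}"
      | (old_new) U0 j where "(U0, \<psi>) \<in> charts M" "U = {z \<in> U0. \<psi> z \<noteq> s origin}"
        "j < n" "V = Cn n" "\<phi> = e j"
      | (new_old) i V0 where "i < n" "U = Cn n" "\<psi> = e i"
        "(V0, \<phi>) \<in> charts M" "V = {z \<in> V0. \<phi> z \<noteq> s origin}"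
      | (new) i j where "i < n" "U = Cn n" "\<psi> = e i" "j < n" "V = Cn n" "\<phi> = e j"
      using U V unfolding ch by blast
    then show "transition n \<psi> z V \<phi> w"
    proof cases
      case old
      then have "transition n \<psi> z V0 \<phi> w" using complex_atlasD(5)[OF M old(1,3)] z w eq by blast
      then show ?thesis using transition_shrink old_open[OF old(3)] w old(4) by blast
    next
      case old_new
      have z': "z \<in> U0" "\<psi> z = e j w" "w \<in> Cn n" using z w eq old_new(2,4,5) by auto
      have w': "w (n - 1) \<noteq> 0" "\<psi> z = s (fst (std_chart n j w))"
        using old_new_eq[OF old_new(1) z'(1) old_new(3) z'(2)] by auto
      note d = down[OF old_new(3) z'(3) w'(1)]
      have x: "fst (std_chart n j w) \<in> Cn n" using d by blast
      have "transition n \<psi> z (Cn n) s (fst (std_chart n j w))"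
        by (rule complex_atlasD(5)[OF M old_new(1) s z'(1) x w'(2)])
      then have "transition n \<psi> z (Cn n) (e j) w"
        by (rule transition_comp) (use d z'(3) in auto)
      then show ?thesis unfolding old_new(4,5) .
    next
      case new_old
      have w': "w \<in> V0" "\<phi> w = e i z" "z \<in> Cn n" using z w eq new_old(2,3,5) by auto
      have z': "z (n - 1) \<noteq> 0" "\<phi> w = s (fst (std_chart n i z))"
        using old_new_eq[OF new_old(4) w'(1) new_old(1) w'(2)] by auto
      note d = down[OF new_old(1) w'(3) z'(1)]
      have x: "fst (std_chart n i z) \<in> Cn n" using d by blast
      have "transition n s (fst (std_chart n i z)) V0 \<phi> w"
        by (rule complex_atlasD(5)[OF M s new_old(4) x w'(1) z'(2)[symmetric]])
      then have "transition n s (fst (std_chart n i z)) V \<phi> w"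
        using transition_shrink[OF _ old_open[OF new_old(4)]] w unfolding new_old(5) by blast
      with d have "transition n (e i) z (Cn n) s (fst (std_chart n i z))"
          "transition n s (fst (std_chart n i z)) V \<phi> w" by blast+
      then have "transition n (e i) z V \<phi> w"
        by (rule transition_comp) (use w z'(2) in auto)
      then show ?thesis unfolding new_old(3) .
    next
      case new
      have zw: "z \<in> Cn n" "w \<in> Cn n" using z w new by auto
      have std: "std_chart n i z = std_chart n j w" using e_std[OF new(1,4) zw] eq new(3,6) by simp
      \<comment> \<open>In chart \<open>i\<close>, the point \<open>x\<close> has the line of
        \<open>chart_vec n i x\<close> and as base point the multiple of that vector by
        \<open>x (n - 1)\<close>. Reading this pair in chart \<open>j\<close> is the coordinate
        change.\<close>
      let ?h = "\<lambda>x. chart_inv n j (x (n - 1)) (chart_vec n i x)"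
      have hstd: "std_chart n j (?h x) = std_chart n i x" if "chart_vec n i x j \<noteq> 0" for x
        using std_chart_chart_inv[OF new(4) chart_vec_Cn that] by (simp only: std_chart_eq[OF new(1)])
      have nz: "chart_vec n i z j \<noteq> 0"
      proof
        assume "chart_vec n i z j = 0"
        moreover have "chart_vec n i z i = chart_vec n i z j * chart_vec n j w i"
          using std[unfolded std_chart_eq_iff[OF new(1,4) zw]] by blast
        ultimately have "chart_vec n i z i = 0" by simp
        then show False using new(1) by simp
      qed
      have "?h z = w"
        using inj_onD[OF std_chart_inj[OF new(4)], of "?h z" w] hstd[OF nz] std n zw(2) by simp
      moreover have "complex_differentiable_map_at n ?h z"
        using new(4) zw(1) nz by (intro complex_differentiable_map_at_chart_inv
            complex_differentiable_at_coord complex_differentiable_at_chart_vec)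
      moreover have "\<forall>\<^sub>F x in at z within Cn n. chart_vec n i x j \<noteq> 0"
        using complex_differentiable_at_tendsto[OF complex_differentiable_at_chart_vec[OF zw(1)] zw(1)] nz
          tendsto_imp_eventually_ne by blast
      then have "\<forall>\<^sub>F x in at z within Cn n. ?h x \<in> V \<and> e j (?h x) = e i x"
        by eventually_elim (use hstd n new(5) in \<open>simp add: e_def\<close>)
      ultimately show ?thesis unfolding transition_def new(3,6) by blast
    qed
  qed
qed

section \<open>The tower of blow-ups\<close>

definition kato_form :: "nat \<Rightarrow> cvec \<Rightarrow> real" where
  "kato_form n z = (\<Sum>j<n - 1. (cmod (z j))\<^sup>2) + 2 * (cmod (z (n - 1)))\<^sup>2"

lemma kato_D_eq: "kato_D n = {z \<in> Cn n. kato_form n z < 1}"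
  by (simp add: kato_D_def kato_form_def)

lemma kato_form_nonneg: "kato_form n z \<ge> 0"
  by (simp add: kato_form_def sum_nonneg)

lemma kato_form_origin [simp]: "kato_form n origin = 0"
  by (simp add: kato_form_def)

lemma continuous_on_coord [continuous_intros]: "continuous_on S (\<lambda>z. z i)" for S :: "('b \<Rightarrow> 'a :: topological_space) set"
  by (rule continuous_on_product_then_coordinatewise[OF continuous_on_id])

lemma continuous_on_kato_form: "continuous_on S (kato_form n)"
  unfolding kato_form_def[abs_def] by (intro continuous_intros)

lemma closed_Cn: "closed (Cn n)"
proof -
  have "Cn n = (\<Inter>i\<in>{n..}. {z. z i = 0})" by (auto simp: Cn_def)
  then show ?thesis by (auto intro!: closed_INT closed_Collect_eq continuous_intros)
qed

lemma origin_Cn [simp]: "origin \<in> Cn n"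
  by (simp add: Cn_def)

lemma kato_form_scale: "kato_form n (\<lambda>i. of_real c * z i) = c\<^sup>2 * kato_form n z"
  by (simp add: kato_form_def norm_mult power_mult_distrib sum_distrib_left distrib_left)

lemma tendsto_scale:
  fixes z :: cvec
  assumes "c \<longlonglongrightarrow> 1"
  shows "(\<lambda>m::nat. (\<lambda>i. complex_of_real (c m) * z i)) \<longlonglongrightarrow> z"
  unfolding tendsto_fun_iff
proof
  fix i
  have "(\<lambda>m. complex_of_real (c m) * z i) \<longlonglongrightarrow> complex_of_real 1 * z i"
    using assms by (intro tendsto_intros)
  then show "(\<lambda>m. complex_of_real (c m) * z i) \<longlonglongrightarrow> z i" by simp
qed

text \<open>The form is homogeneous of degree 2, so a point where it is at most 1 is the limit of
  its multiples by factors increasing to 1, and these lie in the open domain.\<close>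

lemma closure_kato_D: "closure (kato_D n) = {z \<in> Cn n. kato_form n z \<le> 1}"
proof (intro equalityI)
  have "closed {z. kato_form n z \<le> 1}"
    by (intro closed_Collect_le continuous_on_kato_form continuous_intros)
  moreover have "{z \<in> Cn n. kato_form n z \<le> 1} = Cn n \<inter> {z. kato_form n z \<le> 1}" by blast
  ultimately have "closed {z \<in> Cn n. kato_form n z \<le> 1}" by (metis closed_Int closed_Cn)
  then show "closure (kato_D n) \<subseteq> {z \<in> Cn n. kato_form n z \<le> 1}"
    by (intro closure_minimal) (auto simp: kato_D_eq)
next
  show "{z \<in> Cn n. kato_form n z \<le> 1} \<subseteq> closure (kato_D n)"
  proof
    fix z assume z: "z \<in> {z \<in> Cn n. kato_form n z \<le> 1}"
    let ?c = "\<lambda>m. 1 + - inverse (real (Suc m))"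
    have c: "0 \<le> ?c m" "?c m < 1" for m by (auto simp: divide_simps)
    have "(?c m)\<^sup>2 < 1" for m
      by (rule abs_square_less_1[THEN iffD2]) (use c[of m] in linarith)
    then have "(?c m)\<^sup>2 * kato_form n z < 1" for m
      using z kato_form_nonneg[of n z] by (metis (no_types, lifting) mem_Collect_eq mult_left_le
          order_le_less_trans zero_le_power2)
    then have "(\<lambda>i. complex_of_real (?c m) * z i) \<in> kato_D n" for m
      unfolding kato_D_eq mem_Collect_eq kato_form_scale using z by (simp add: Cn_def)
    moreover have "?c \<longlonglongrightarrow> 1" by (rule LIMSEQ_inverse_real_of_nat_add_minus)
    ultimately show "z \<in> closure (kato_D n)"
      unfolding closure_sequential using tendsto_scale[of ?c z]
      by (intro exI[of _ "\<lambda>m i. complex_of_real (?c m) * z i"]) blast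
  qed
qed

lemma kato_D_subset_closure: "z \<in> kato_D n \<Longrightarrow> z \<in> closure (kato_D n)"
  using closure_subset by blast

text \<open>The ambient space has infinitely many coordinates, so compactness comes from Tychonoff:
  the set is closed in a product of closed unit discs.\<close>

lemma compact_closure_kato_D: "compact (closure (kato_D n))"
proof -
  have "compactin (product_topology (\<lambda>_. euclidean) UNIV) (\<Pi>\<^sub>E i\<in>UNIV. cball 0 1 :: complex set)"
    by (subst compactin_PiE) auto
  then have comp: "compact (\<Pi>\<^sub>E i\<in>(UNIV :: nat set). cball 0 1 :: complex set)"
    by (simp add: euclidean_product_topology)
  have "closure (kato_D n) \<subseteq> (\<Pi>\<^sub>E i\<in>UNIV. cball 0 1)"
  proof
    fix z assume z: "z \<in> closure (kato_D n)"
    have "cmod (z i) \<le> 1" for i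
    proof (cases "i < n")
      case True
      have "(cmod (z i))\<^sup>2 \<le> kato_form n z"
      proof (cases "i = n - 1")
        case False
        then have "(cmod (z i))\<^sup>2 \<le> (\<Sum>j<n - 1. (cmod (z j))\<^sup>2)"
          using True by (intro member_le_sum) auto
        then show ?thesis unfolding kato_form_def by (simp add: add_increasing2)
      qed (simp add: kato_form_def sum_nonneg)
      then have "(cmod (z i))\<^sup>2 \<le> 1" using z by (simp add: closure_kato_D)
      then show ?thesis by (simp add: power_le_one_iff abs_square_le_1)
    next
      case False
      then show ?thesis using z by (simp add: closure_kato_D Cn_def)
    qed
    then show "z \<in> (\<Pi>\<^sub>E i\<in>UNIV. cball 0 1)" by (simp add: PiE_iff)
  qed
  then show ?thesis using comp closed_closure compact_Int_closed by (metis inf.absorb_iff2)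
qed

text \<open>The entries of \<open>chart_vec\<close> are 1 and the coordinates of \<open>z\<close>
  except the last, in some order. Their squared moduli give the first two summands, and the double
  weight of the last entry gives the third.\<close>

lemma kato_form_std_chart:
  assumes "j < n"
  shows "kato_form n (fst (std_chart n j z)) =
    (cmod (z (n - 1)))\<^sup>2 * (1 + (\<Sum>q<n - 1. (cmod (z q))\<^sup>2) + (cmod (chart_vec n j z (n - 1)))\<^sup>2)"
proof -
  let ?v = "chart_vec n j z" and ?f = "\<lambda>q. (cmod (z q))\<^sup>2"
  have "(\<Sum>p<n. (cmod (?v p))\<^sup>2) = (\<Sum>p\<in>{..<j}. (cmod (?v p))\<^sup>2) + (\<Sum>p\<in>{j..<n}. (cmod (?v p))\<^sup>2)"
    using assms by (simp add: ivl_disj_un sum.union_disjoint[symmetric] ivl_disj_int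
        flip: sum.lessThan_Suc atLeast0LessThan)
  also have "(\<Sum>p\<in>{..<j}. (cmod (?v p))\<^sup>2) = (\<Sum>p\<in>{..<j}. ?f p)"
    using assms by (intro sum.cong) (auto simp: chart_vec_def)
  also have "(\<Sum>p\<in>{j..<n}. (cmod (?v p))\<^sup>2) = 1 + (\<Sum>p\<in>{Suc j..<Suc (n - 1)}. (cmod (?v p))\<^sup>2)"
    using assms by (subst sum.atLeast_Suc_lessThan) auto
  also have "(\<Sum>p\<in>{Suc j..<Suc (n - 1)}. (cmod (?v p))\<^sup>2) = (\<Sum>p\<in>{j..<n - 1}. ?f p)"
    unfolding sum.shift_bounds_Suc_ivl using assms by (intro sum.cong) (auto simp: chart_vec_def)
  also have "(\<Sum>p\<in>{..<j}. ?f p) + (1 + (\<Sum>p\<in>{j..<n - 1}. ?f p)) = 1 + (\<Sum>q<n - 1. ?f q)"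
    using assms sum.atLeastLessThan_concat[of 0 j "n - 1" ?f] by (simp add: atLeast0LessThan)
  finally have v: "(\<Sum>p<n. (cmod (?v p))\<^sup>2) = 1 + (\<Sum>q<n - 1. ?f q)" .
  have "(\<Sum>p<n. (cmod (?v p))\<^sup>2) = (\<Sum>p<n - 1. (cmod (?v p))\<^sup>2) + (cmod (?v (n - 1)))\<^sup>2"
    using assms sum.lessThan_Suc[of "\<lambda>p. (cmod (?v p))\<^sup>2" "n - 1"] by simp
  with v have v': "(\<Sum>p<n - 1. (cmod (?v p))\<^sup>2) + 2 * (cmod (?v (n - 1)))\<^sup>2 =
      1 + (\<Sum>q<n - 1. ?f q) + (cmod (?v (n - 1)))\<^sup>2" by simp
  have "kato_form n (fst (std_chart n j z)) =
      (cmod (z (n - 1)))\<^sup>2 * ((\<Sum>p<n - 1. (cmod (?v p))\<^sup>2) + 2 * (cmod (?v (n - 1)))\<^sup>2)"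
    using assms by (simp add: std_chart_eq kato_form_def norm_mult power_mult_distrib sum_distrib_left distrib_left)
  then show ?thesis unfolding v' .
qed

text \<open>With \<open>a\<close>, \<open>b\<close>, \<open>c\<close> as in the proof,
  \<open>a + 2 * b\<close> is at most 1 and the new value is \<open>b * (1 + a + c)\<close>. For
  \<open>j < n - 1\<close> the last entry of \<open>chart_vec\<close> is \<open>z (n - 2)\<close>,
  so \<open>c\<close> is at most \<open>a\<close> and the value is at most 9/16. For
  \<open>j = n - 1\<close> that entry is 1, and the value 1 is reached only for
  \<open>b = 1 / 2\<close>, which forces \<open>a = 0\<close>.\<close>

lemma kato_form_std_chart_le:
  assumes j: "j < n" and z: "kato_form n z \<le> 1"
  shows "kato_form n (fst (std_chart n j z)) \<le> 1"
    and "j < n - 1 \<or> kato_form n z < 1 \<Longrightarrow> kato_form n (fst (std_chart n j z)) < 1"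
proof -
  define a where "a = (\<Sum>q<n - 1. (cmod (z q))\<^sup>2)"
  define b where "b = (cmod (z (n - 1)))\<^sup>2"
  define c where "c = (cmod (chart_vec n j z (n - 1)))\<^sup>2"
  have eq: "kato_form n (fst (std_chart n j z)) = b * (1 + a + c)" "kato_form n z = a + 2 * b"
    using kato_form_std_chart[OF j, of z] by (simp_all add: a_def b_def c_def kato_form_def)
  have nn: "a \<ge> 0" "b \<ge> 0" by (simp_all add: a_def b_def sum_nonneg)
  have ab: "a \<le> 1 - 2 * b" using z eq(2) by simp
  have c1: "c \<le> a" if "j < n - 1"
  proof -
    have "c = (cmod (z (n - 2)))\<^sup>2" using that by (simp add: c_def chart_vec_def numeral_2_eq_2)
    also have "\<dots> \<le> a" unfolding a_def using that by (intro member_le_sum) auto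
    finally show ?thesis .
  qed
  have c2: "c = 1" if "\<not> j < n - 1" using that j by (simp add: c_def chart_vec_def)
  have lt: "b * (1 + a + c) < 1" if "j < n - 1"
  proof -
    have "b * (1 + a + c) \<le> b * (3 - 4 * b)"
      using c1[OF that] ab nn by (intro mult_left_mono) auto
    also have "b * (3 - 4 * b) = 9 / 16 - (2 * b - 3 / 4)\<^sup>2" by (simp add: power2_eq_square algebra_simps)
    also have "\<dots> < 1" using zero_le_power2[of "2 * b - 3 / 4"] by linarith
    finally show ?thesis .
  qed
  have le: "b * (1 + a + c) \<le> 1 - (1 - b) * (1 - 2 * b)" if "\<not> j < n - 1"
  proof -
    have "b * (1 + a + c) \<le> b * (3 - 2 * b)"
      using c2[OF that] ab nn by (intro mult_left_mono) auto
    also have "\<dots> = 1 - (1 - b) * (1 - 2 * b)" by (simp add: algebra_simps)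
    finally show ?thesis .
  qed
  have b: "b \<le> 1 / 2" using ab nn by simp
  show "kato_form n (fst (std_chart n j z)) \<le> 1"
  proof (cases "j < n - 1")
    case False
    have "(1 - b) * (1 - 2 * b) \<ge> 0" using b by (intro mult_nonneg_nonneg) auto
    then show ?thesis using le[OF False] eq(1) by linarith
  qed (use lt eq in auto)
  show "kato_form n (fst (std_chart n j z)) < 1" if "j < n - 1 \<or> kato_form n z < 1"
  proof (cases "j < n - 1")
    case False
    then have "b < 1 / 2" using that eq(2) nn by simp
    then have "(1 - b) * (1 - 2 * b) > 0" by (intro mult_pos_pos) auto
    then show ?thesis using le[OF False] eq(1) by linarith
  qed (use lt eq in auto)
qed

lemma continuous_on_std_chart: "j < n \<Longrightarrow> continuous_on (Cn n) (\<lambda>z. fst (std_chart n j z))"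
  unfolding continuous_on_def
  using complex_differentiable_map_at_tendsto complex_differentiable_map_at_std_chart by blast

lemma complex_atlas_Cn: "complex_atlas n \<lparr>pts = Base ` Cn n, charts = {(Cn n, Base)}\<rparr>"
proof (rule complex_atlasI; simp)
  show "open_Cn n (Cn n)" by (simp add: open_Cn_def)
  show "inj_on Base (Cn n)" by (simp add: inj_on_def)
  show "\<exists>z. z \<in> Cn n \<and> x = Base z" if "x \<in> Base ` Cn n" for x using that by blast
  show "separated (Cn n) Base (Cn n) Base"
    by (rule separatedI) (metis LIMSEQ_unique bpt.inject(1) ext)
  show "transition n Base z (Cn n) Base z" if "z \<in> Cn n" for z
    using that eventually_in_Cn by (intro transition_same) auto
qed

section \<open>Embeddings and projections of the tower for a fixed word\<close>

lemma blow_down_Base [simp]: "blow_down s p (Base z) = Base z"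
  by (simp add: blow_down_def)

lemma kato_pi_Base [simp]: "kato_pi n js p (Base z) = z"
  by (induction p) simp_all

text \<open>The consequences of the type on which everything below is built. The contracting letter
  makes the gluing possible; the lower bound \<open>l\<close> on the letters makes the embeddings
  commute with rotations of the first \<open>l\<close> coordinates.\<close>

locale kato_data =
  fixes n l :: nat and js :: "nat list"
  assumes type_less: "l < n"
    and js_range: "\<And>j. j \<in> set js \<Longrightarrow> l \<le> j \<and> j < n"
    and js_contracting: "\<exists>j\<in>set js. j < n - 1"
begin

abbreviation "emb \<equiv> kato_sigma n js"
abbreviation "tower \<equiv> kato_tower n js"
abbreviation "prj \<equiv> kato_pi n js"
abbreviation "depth \<equiv> length js"

lemma js_nth: "p < depth \<Longrightarrow> l \<le> js ! p \<and> js ! p < n"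
  using js_range by simp

lemma k_pos: "0 < depth"
  using js_contracting by auto

lemma n_pos: "0 < n"
  using type_less by simp

text \<open>The bound on labels makes \<open>Exc (Suc p)\<close> fresh, and the chart
  \<open>emb p\<close> provides the embedding along which the next blow-up is glued. Both are
  hypotheses of \<open>blow_up_complex_atlas\<close>.\<close>

lemma tower_atlas:
  "p \<le> depth \<Longrightarrow> complex_atlas n (tower p) \<and> (Cn n, emb p) \<in> charts (tower p) \<and>
     (\<forall>q L. Exc q L \<in> pts (tower p) \<longrightarrow> q \<le> p) \<and> (\<forall>z. Base z \<in> pts (tower p) \<longrightarrow> z \<in> Cn n)"
proof (induction p)
  case 0
  then show ?case using complex_atlas_Cn by auto
next
  case (Suc p)
  then have IH: "complex_atlas n (tower p)" "(Cn n, emb p) \<in> charts (tower p)"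
    "\<And>q L. Exc q L \<in> pts (tower p) \<Longrightarrow> q \<le> p" "\<And>z. Base z \<in> pts (tower p) \<Longrightarrow> z \<in> Cn n" by auto
  have pts: "x \<in> pts (tower p) \<or> (\<exists>L. x = Exc (Suc p) L)" if "x \<in> pts (tower (Suc p))" for x
    using that complex_atlasD(3)[OF IH(1,2)]
    by (auto simp: blow_up_def blow_iota_def bl_Cn_def)
  have "complex_atlas n (tower (Suc p))"
    using blow_up_complex_atlas[OF IH(1,2) _ n_pos, of "Suc p"] IH(3)[of "Suc p"] by auto
  moreover have "(Cn n, emb (Suc p)) \<in> charts (tower (Suc p))"
    using js_nth[of p] Suc.prems by (auto simp: blow_up_def)
  moreover have "q \<le> Suc p" if "Exc q L \<in> pts (tower (Suc p))" for q L
    using pts[OF that] IH(3)[of q L] by auto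
  moreover have "z \<in> Cn n" if "Base z \<in> pts (tower (Suc p))" for z
    using pts[OF that] IH(4)[of z] by auto
  ultimately show ?case by blast
qed

lemmas tower_complex_atlas = tower_atlas[THEN conjunct1]
lemmas sigma_chart = tower_atlas[THEN conjunct2, THEN conjunct1]
lemmas tower_Exc = tower_atlas[THEN conjunct2, THEN conjunct2, THEN conjunct1, rule_format]
lemmas tower_Base = tower_atlas[THEN conjunct2, THEN conjunct2, THEN conjunct2, rule_format]

lemma sigma_pts: "p \<le> depth \<Longrightarrow> z \<in> Cn n \<Longrightarrow> emb p z \<in> pts (tower p)"
  using complex_atlasD(3)[OF tower_complex_atlas sigma_chart] by blast

lemma sigma_inj: "p \<le> depth \<Longrightarrow> inj_on (emb p) (Cn n)"
  using complex_atlasD(2)[OF tower_complex_atlas sigma_chart] by blast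

lemma sigma_Suc_origin: "p < depth \<Longrightarrow> \<exists>L. emb (Suc p) origin = Exc (Suc p) L"
  using js_nth[of p] by (simp add: blow_iota_std_chart)

text \<open>Only the first centre is a \<open>Base\<close> point. Later centres lie on exceptional
  divisors by \<open>sigma_Suc_origin\<close>, so this chart survives unchanged to the top of the
  tower.\<close>

lemma Base_chart: "0 < p \<Longrightarrow> p \<le> depth \<Longrightarrow> (Cn n - {origin}, Base) \<in> charts (tower p)"
proof (induction p)
  case (Suc p)
  show ?case
  proof (cases p)
    case 0
    have "Cn n - {origin} = {z \<in> Cn n. Base z \<noteq> Base origin}" by auto
    then show ?thesis using 0 by (auto simp: blow_up_def)
  next
    case (Suc q)
    then have "(Cn n - {origin}, Base) \<in> charts (tower p)" using Suc.IH Suc.prems by simp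
    moreover obtain L where "emb p origin = Exc p L"
      using sigma_Suc_origin[of q] Suc Suc.prems by auto
    then have "Cn n - {origin} = {z \<in> Cn n - {origin}. Base z \<noteq> emb p origin}" by auto
    ultimately show ?thesis unfolding kato_tower.simps blow_up_def by auto
  qed
qed simp

lemma blow_down_old: "p < depth \<Longrightarrow> x \<in> pts (tower p) \<Longrightarrow> blow_down s (Suc p) x = x"
  using tower_Exc[of p] by (fastforce simp: blow_down_def)

text \<open>The compatibility of blow-down and embedding, read in a standard chart. Iterated along
  the word, it turns \<open>prj p\<close> after \<open>emb p\<close> into a composition of
  elementary monomial maps.\<close>

lemma proj_chart:
  assumes "p < depth" "j < n"
  shows "prj (Suc p) (blow_iota (emb p) (Suc p) (std_chart n j z)) =
    prj p (emb p (fst (std_chart n j z)))"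
proof (cases "z (n - 1) = 0")
  case True
  then show ?thesis using assms fst_std_chart_eq_origin[of j n z]
    by (simp add: blow_iota_std_chart blow_down_def)
next
  case False
  have "emb p (fst (std_chart n j z)) \<in> pts (tower p)" using sigma_pts assms by simp
  then show ?thesis using False assms blow_down_old by (simp add: blow_iota_std_chart)
qed

lemma proj_sigma_Suc:
  "p < depth \<Longrightarrow> prj (Suc p) (emb (Suc p) z) = prj p (emb p (fst (std_chart n (js ! p) z)))"
  using proj_chart[of p "js ! p" z] js_nth[of p] by simp

lemma proj_sigma_origin: "p \<le> depth \<Longrightarrow> prj p (emb p origin) = origin"
proof (induction p)
  case (Suc p)
  then show ?case using proj_sigma_Suc[of p origin] js_nth[of p]
    by (simp add: std_chart_eq del: kato_sigma.simps kato_pi.simps)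
qed simp

text \<open>Every centre lies over the origin, hence so does every exceptional divisor.\<close>

lemma proj_Exc: "p \<le> depth \<Longrightarrow> Exc q L \<in> pts (tower p) \<Longrightarrow> prj p (Exc q L) = origin"
proof (induction p)
  case (Suc p)
  show ?case
  proof (cases "q = Suc p")
    case True
    then show ?thesis using proj_sigma_origin[of p] Suc.prems by (simp add: blow_down_def)
  next
    case False
    then have "Exc q L \<in> pts (tower p)"
      using Suc.prems sigma_pts[of p] by (auto simp: blow_up_def blow_iota_def bl_Cn_def)
    then show ?thesis using Suc False by (simp add: blow_down_def)
  qed
qed auto

lemma tower_cases:
  assumes "p \<le> depth" "x \<in> pts (tower p)"
  obtains z where "x = Base z" "z \<in> Cn n" "prj p x = z" | q L where "x = Exc q L" "prj p x = origin"
  using assms tower_Base[of p] proj_Exc[of p] by (cases x) auto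

lemma proj_Cn: "p \<le> depth \<Longrightarrow> x \<in> pts (tower p) \<Longrightarrow> prj p x \<in> Cn n"
  by (rule tower_cases[of p x]) auto

lemma continuous_on_proj_sigma: "p \<le> depth \<Longrightarrow> continuous_on (Cn n) (\<lambda>z. prj p (emb p z))"
proof (induction p)
  case (Suc p)
  have "continuous_on (Cn n) (\<lambda>z. prj p (emb p (fst (std_chart n (js ! p) z))))"
    by (rule continuous_on_compose2[of "Cn n" "\<lambda>z. prj p (emb p z)"])
      (use Suc js_nth[of p] continuous_on_std_chart fst_std_chart_Cn in auto)
  then show ?case using proj_sigma_Suc[of p] Suc.prems by (simp del: kato_sigma.simps kato_pi.simps)
qed simp

lemma continuous_on_proj_chart:
  "p \<le> depth \<Longrightarrow> (U, \<psi>) \<in> charts (tower p) \<Longrightarrow> continuous_on U (\<lambda>z. prj p (\<psi> z))"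
proof (induction p arbitrary: U \<psi>)
  case (Suc p)
  then consider U0 where "(U0, \<psi>) \<in> charts (tower p)" "U = {z \<in> U0. \<psi> z \<noteq> emb p origin}"
    | j where "j < n" "U = Cn n" "\<psi> = blow_iota (emb p) (Suc p) \<circ> std_chart n j"
    by (auto simp: blow_up_def)
  then show ?case
  proof cases
    case 1
    then have "continuous_on U (\<lambda>z. prj p (\<psi> z))"
      using Suc by (auto intro: continuous_on_subset)
    moreover have eq: "prj p (\<psi> z) = prj (Suc p) (\<psi> z)" if "z \<in> U" for z
      using complex_atlasD(3)[OF tower_complex_atlas 1(1), of z] that 1(2) Suc.prems(1)
      by (simp add: blow_down_old)
    ultimately show ?thesis by (rule continuous_on_eq)
  next
    case 2
    have "continuous_on (Cn n) (\<lambda>z. prj p (emb p (fst (std_chart n j z))))"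
      by (rule continuous_on_compose2[of "Cn n" "\<lambda>z. prj p (emb p z)"])
        (use continuous_on_proj_sigma Suc.prems 2 continuous_on_std_chart fst_std_chart_Cn in auto)
    then show ?thesis using proj_chart[of p j] Suc.prems(1) 2 by (simp del: kato_pi.simps)
  qed
qed simp

text \<open>Each letter preserves both the weak and the strict inequality, so strictness present at
  the start or gained at a contracting letter is kept. Since \<open>emb\<close> applies the last
  letter first, the induction varies \<open>z\<close>.\<close>

lemma kato_form_proj_sigma:
  assumes "p \<le> depth" "z \<in> Cn n" "kato_form n z \<le> 1"
  shows "kato_form n (prj p (emb p z)) \<le> 1"
    and "kato_form n z < 1 \<or> (\<exists>i<p. js ! i < n - 1) \<Longrightarrow> kato_form n (prj p (emb p z)) < 1"
proof -
  have "kato_form n (prj p (emb p z)) \<le> 1 \<and>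
      (kato_form n z < 1 \<or> (\<exists>i<p. js ! i < n - 1) \<longrightarrow> kato_form n (prj p (emb p z)) < 1)"
    using assms
  proof (induction p arbitrary: z)
    case (Suc p)
    let ?y = "fst (std_chart n (js ! p) z)"
    have j: "js ! p < n" using js_nth[of p] Suc.prems by simp
    have "kato_form n ?y \<le> 1" "js ! p < n - 1 \<or> kato_form n z < 1 \<Longrightarrow> kato_form n ?y < 1"
      using kato_form_std_chart_le[OF j Suc.prems(3)] by auto
    moreover note Suc.IH[of ?y]
    moreover have "?y \<in> Cn n" using j by simp
    ultimately have "kato_form n (prj p (emb p ?y)) \<le> 1 \<and>
        (kato_form n z < 1 \<or> (\<exists>i<Suc p. js ! i < n - 1) \<longrightarrow> kato_form n (prj p (emb p ?y)) < 1)"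
      using Suc.prems(1) by (auto simp: less_Suc_eq)
    then show ?case unfolding proj_sigma_Suc[OF Suc_le_lessD[OF Suc.prems(1)]] .
  qed simp
  then show "kato_form n (prj p (emb p z)) \<le> 1"
    and "kato_form n z < 1 \<or> (\<exists>i<p. js ! i < n - 1) \<Longrightarrow> kato_form n (prj p (emb p z)) < 1" by auto
qed

text \<open>The maximum over the compact closed domain is attained, which turns the strict
  inequality at each point into a uniform gap.\<close>

lemma kato_form_bound:
  obtains m where "0 \<le> m" "m < 1"
    "\<And>z. z \<in> closure (kato_D n) \<Longrightarrow> kato_form n (prj depth (emb depth z)) \<le> m"
proof -
  have "continuous_on (closure (kato_D n)) (\<lambda>z. kato_form n (prj depth (emb depth z)))"
    by (rule continuous_on_compose2[OF continuous_on_kato_form[of UNIV]])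
      (use continuous_on_proj_sigma[of depth] in \<open>auto simp: closure_kato_D intro: continuous_on_subset\<close>)
  moreover have "origin \<in> closure (kato_D n)" by (simp add: closure_kato_D)
  ultimately obtain y where y: "y \<in> closure (kato_D n)"
    "\<And>z. z \<in> closure (kato_D n) \<Longrightarrow> kato_form n (prj depth (emb depth z)) \<le> kato_form n (prj depth (emb depth y))"
    using continuous_attains_sup[OF compact_closure_kato_D] by (metis empty_iff)
  have "\<exists>i<depth. js ! i < n - 1" using js_contracting by (auto simp: in_set_conv_nth)
  then have "kato_form n (prj depth (emb depth y)) < 1"
    using kato_form_proj_sigma(2)[of depth y] y(1) by (simp add: closure_kato_D)
  then show ?thesis using that y(2) kato_form_nonneg by blast
qed

lemma proj_sigma_kato_D:
  assumes "z \<in> closure (kato_D n)"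
  shows "prj depth (emb depth z) \<in> kato_D n"
proof -
  obtain m where "m < 1" "\<And>z. z \<in> closure (kato_D n) \<Longrightarrow> kato_form n (prj depth (emb depth z)) \<le> m"
    using kato_form_bound by blast
  moreover have "prj depth (emb depth z) \<in> Cn n"
    using assms proj_Cn sigma_pts by (simp add: closure_kato_D)
  ultimately show ?thesis using assms by (force simp: kato_D_eq)
qed

end

section \<open>The complex structure of the Kato manifold\<close>

lemma open_Cn_Int: "open_Cn n U \<Longrightarrow> open_Cn n V \<Longrightarrow> open_Cn n (U \<inter> V)"
  unfolding open_Cn_def by (rule openin_Int)

lemma open_Cn_minus_closed: "open_Cn n U \<Longrightarrow> closed C \<Longrightarrow> open_Cn n (U - C)"
  unfolding open_Cn_def openin_open by (metis Diff_eq Int_assoc open_Compl open_Int)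

lemma open_Cn_preimage_less:
  assumes "open_Cn n U" "continuous_on U f"
  shows "open_Cn n {z \<in> U. f z < (c::real)}"
proof -
  have "openin (top_of_set U) (U \<inter> f -` {..<c})"
    using assms(2) by (rule continuous_openin_preimage_gen) simp
  moreover have "U \<inter> f -` {..<c} = {z \<in> U. f z < c}" by auto
  ultimately show ?thesis using assms(1) openin_trans unfolding open_Cn_def by metis
qed

lemma open_Cn_UNIV [simp]: "open_Cn n (Cn n)"
  by (simp add: open_Cn_def)

lemma open_Cn_kato_D: "open_Cn n (kato_D n)"
  unfolding kato_D_eq by (rule open_Cn_preimage_less) (simp_all add: continuous_on_kato_form)

lemma kato_boundaryD:
  assumes "y \<in> closure (kato_D n)" "y \<notin> kato_D n"
  shows "y \<in> Cn n" "kato_form n y = 1" "y \<noteq> origin"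
proof -
  from assms(1) have "y \<in> Cn n" "kato_form n y \<le> 1" by (simp_all add: closure_kato_D)
  with assms(2) show "y \<in> Cn n" "kato_form n y = 1" by (auto simp: kato_D_eq)
  then show "y \<noteq> origin" by auto
qed

text \<open>With the next lemma: a boundary point is approached from both sides. This contradicts a
  germ that would send a whole neighbourhood to one side, as in \<open>collar_inside\<close> and
  \<open>collar_outside\<close>.\<close>

lemma not_eventually_not_kato_D:
  assumes "w \<in> closure (kato_D n)" "w \<notin> kato_D n"
  shows "\<not> (\<forall>\<^sub>F x in at w within Cn n. x \<notin> kato_D n)"
proof
  assume "\<forall>\<^sub>F x in at w within Cn n. x \<notin> kato_D n"
  then have "\<forall>\<^sub>F x in at w. x \<notin> kato_D n"
    unfolding eventually_at_filter by eventually_elim (auto simp: kato_D_eq)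
  moreover have "w islimpt kato_D n" using assms by (simp add: closure_def)
  ultimately show False by (simp add: islimpt_iff_eventually)
qed

text \<open>Multiples of a boundary point by factors decreasing to 1 have form greater than
  1.\<close>

lemma not_eventually_closure_kato_D:
  assumes "y \<in> closure (kato_D n)" "y \<notin> kato_D n"
  shows "\<not> (\<forall>\<^sub>F x in at y within Cn n. x \<in> closure (kato_D n))"
proof
  assume ev: "\<forall>\<^sub>F x in at y within Cn n. x \<in> closure (kato_D n)"
  note y = kato_boundaryD[OF assms]
  let ?c = "\<lambda>m. 1 + inverse (real (Suc m))"
  let ?x = "\<lambda>m i. complex_of_real (?c m) * y i"
  have "?c \<longlonglongrightarrow> 1" by (rule LIMSEQ_inverse_real_of_nat_add)
  then have lim: "?x \<longlonglongrightarrow> y" by (rule tendsto_scale)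
  have "\<forall>\<^sub>F x in nhds y. x \<in> Cn n \<longrightarrow> x \<in> closure (kato_D n)"
    using ev unfolding eventually_at_filter by eventually_elim (use assms(1) in auto)
  then have "\<forall>\<^sub>F m in sequentially. ?x m \<in> Cn n \<longrightarrow> ?x m \<in> closure (kato_D n)"
    using lim unfolding filterlim_iff by blast
  then obtain m where m: "?x m \<in> Cn n \<longrightarrow> ?x m \<in> closure (kato_D n)"
    by (auto simp: eventually_sequentially)
  have "?x m \<in> Cn n" using y(1) by (simp add: Cn_def)
  then have "(?c m)\<^sup>2 * kato_form n y \<le> 1"
    using m unfolding closure_kato_D mem_Collect_eq kato_form_scale by blast
  moreover have "(?c m)\<^sup>2 > 1" by (rule one_less_power) simp_all
  ultimately show False unfolding y(2) by linarith
qed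

lemma transition_image:
  "transition n \<psi> z V \<phi> w \<Longrightarrow> transition n (\<lambda>x. f (\<psi> x)) z V (\<lambda>x. f (\<phi> x)) w"
  unfolding transition_def by (elim exE conjE, rule exI, intro conjI, assumption+)
    (auto elim: eventually_mono)

section \<open>The completed domain and its gluing classes\<close>

context kato_data
begin

abbreviation "S \<equiv> emb depth"
abbreviation "P \<equiv> prj depth"
abbreviation "D \<equiv> kato_D n"
abbreviation "W \<equiv> kato_W n js"
abbreviation "Wi \<equiv> kato_W_interior n js"
abbreviation "cls \<equiv> kato_class n js"
abbreviation "collar \<equiv> kato_collar n js"
abbreviation "M \<equiv> kato_manifold n js"

lemma W_iff: "x \<in> W \<longleftrightarrow> x \<in> pts (tower depth) \<and> P x \<in> closure D \<and> x \<notin> S ` D"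
  by (auto simp: kato_W_def Let_def)

lemma Wi_iff: "x \<in> Wi \<longleftrightarrow> x \<in> pts (tower depth) \<and> P x \<in> D \<and> x \<notin> S ` closure D"
  by (auto simp: kato_W_interior_def Let_def)

lemma outer_iff: "x \<in> kato_outer n js \<longleftrightarrow> x \<in> pts (tower depth) \<and> P x \<in> closure D \<and> P x \<notin> D"
  by (auto simp: kato_outer_def)

lemma cls_iff: "y \<in> cls x \<longleftrightarrow> x \<in> W \<and> y \<in> W \<and>
    (x = y \<or> x \<in> kato_outer n js \<and> y = S (P x) \<or> y \<in> kato_outer n js \<and> x = S (P y))"
  by (auto simp: kato_class_def kato_glue_def Let_def)

lemma closure_D_Cn: "z \<in> closure D \<Longrightarrow> z \<in> Cn n"
  by (simp add: closure_kato_D)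

lemma D_closure: "z \<in> D \<Longrightarrow> z \<in> closure D"
  by (rule kato_D_subset_closure)

lemma Wi_W: "x \<in> Wi \<Longrightarrow> x \<in> W"
  using D_closure by (auto simp: W_iff Wi_iff)

lemma S_inj: "z \<in> Cn n \<Longrightarrow> w \<in> Cn n \<Longrightarrow> S z = S w \<Longrightarrow> z = w"
  using sigma_inj[of depth] by (auto dest: inj_onD)

lemma P_S_D: "z \<in> closure D \<Longrightarrow> P (S z) \<in> D"
  by (rule proj_sigma_kato_D)

lemma Base_pts: "z \<in> Cn n \<Longrightarrow> z \<noteq> origin \<Longrightarrow> Base z \<in> pts (tower depth)"
  using complex_atlasD(3)[OF tower_complex_atlas Base_chart, of depth z] k_pos by auto

lemma Base_origin_pts: "0 < p \<Longrightarrow> p \<le> depth \<Longrightarrow> Base origin \<notin> pts (tower p)"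
proof (induction p)
  case (Suc p)
  show ?case
  proof
    assume "Base origin \<in> pts (tower (Suc p))"
    then consider "Base origin \<in> pts (tower p)" "Base origin \<noteq> emb p origin"
      | y where "y \<in> Cn n" "y \<noteq> origin" "emb p y = Base origin"
      by (auto simp: blow_up_def blow_iota_def bl_Cn_def split: if_splits)
    then show False
      by cases (use Suc sigma_pts[of p] in \<open>cases p; force\<close>)+
  qed
qed simp

text \<open>Exceptional points lie over the origin, which is interior to the domain.\<close>

lemma outer_Base: "x \<in> kato_outer n js \<Longrightarrow> x = Base (P x)"
  unfolding outer_iff by (elim conjE, erule tower_cases[rotated]) (auto simp: kato_D_eq)

lemma Base_outer:
  assumes "y \<in> closure D" "y \<notin> D"
  shows "Base y \<in> kato_outer n js" "Base y \<in> W"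
proof -
  have "y \<noteq> origin" using kato_boundaryD[OF assms] by blast
  then have pts: "Base y \<in> pts (tower depth)" using Base_pts closure_D_Cn assms(1) by blast
  then show "Base y \<in> kato_outer n js" using assms by (simp add: outer_iff)
  have "Base y \<noteq> S w" if "w \<in> D" for w
    using P_S_D[OF D_closure[OF that]] assms(2) kato_pi_Base[of n js depth y] by metis
  then show "Base y \<in> W" using pts assms by (auto simp: W_iff)
qed

lemma S_boundary:
  assumes "y \<in> closure D" "y \<notin> D"
  shows "S y \<in> W" "S y \<notin> kato_outer n js"
proof -
  have "S y \<notin> S ` D" using S_inj assms closure_D_Cn D_closure by (metis imageE)
  then show "S y \<in> W"
    using sigma_pts[of depth y] P_S_D[OF assms(1)] D_closure closure_D_Cn[OF assms(1)] by (simp add: W_iff)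
  show "S y \<notin> kato_outer n js" using P_S_D[OF assms(1)] by (simp add: outer_iff)
qed

lemma cls_Wi: "x \<in> Wi \<Longrightarrow> cls x = {x}"
  using Wi_W by (auto simp: cls_iff Wi_iff outer_iff)

text \<open>Images of the closed domain under \<open>S\<close> lie over \<open>D\<close> and so are
  never outer boundary points. Hence gluing steps cannot be chained, and a class has no members
  beyond one outer point and its image.\<close>

lemma cls_boundary:
  assumes y: "y \<in> closure D" "y \<notin> D"
  shows "cls (Base y) = {Base y, S y}" "cls (S y) = {Base y, S y}"
proof -
  have 2: "Base y \<noteq> S (P z)" if "z \<in> kato_outer n js" for z
    using P_S_D[of "P z"] that y(2) kato_pi_Base[of n js depth y] by (metis outer_iff)
  show "cls (Base y) = {Base y, S y}"
  proof (rule Set.set_eqI)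
    fix x show "x \<in> cls (Base y) \<longleftrightarrow> x \<in> {Base y, S y}"
      unfolding cls_iff kato_pi_Base using Base_outer[OF y] S_boundary(1)[OF y] 2[of x] by blast
  qed
  have 3: "z = Base y" if "z \<in> kato_outer n js" "S y = S (P z)" for z
    using S_inj[of y "P z"] that outer_Base[OF that(1)] closure_D_Cn y(1) by (simp add: outer_iff)
  show "cls (S y) = {Base y, S y}"
  proof (rule Set.set_eqI)
    fix x show "x \<in> cls (S y) \<longleftrightarrow> x \<in> {Base y, S y}"
    proof (cases "x = Base y")
      case True
      show ?thesis
        unfolding cls_iff True kato_pi_Base using Base_outer[OF y] S_boundary(1)[OF y] by blast
    next
      case False
      then have "\<not> (x \<in> kato_outer n js \<and> S y = S (P x))" using 3[of x] by blast
      then show ?thesis unfolding cls_iff using False S_boundary[OF y] by blast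
    qed
  qed
qed

text \<open>The removed image of the closed domain is closed: preimages under \<open>S\<close> have
  a convergent subsequence by compactness, and separation from the chart \<open>S\<close> identifies
  the limits.\<close>

lemma open_Wi:
  assumes U: "(U, \<psi>) \<in> charts (tower depth)"
  shows "open_Cn n {z \<in> U. \<psi> z \<in> Wi}"
proof -
  note atlas = complex_atlasD[OF tower_complex_atlas[OF order_refl]]
  let ?V = "{z \<in> U. kato_form n (P (\<psi> z)) < 1}"
  have "continuous_on U (\<lambda>z. kato_form n (P (\<psi> z)))"
    by (rule continuous_on_compose2[OF continuous_on_kato_form[of UNIV]])
      (use continuous_on_proj_chart[OF order_refl U] in auto)
  then have V: "open_Cn n ?V"
    by (rule open_Cn_preimage_less[OF atlas(1)[OF U]])
  have "open_Cn n (?V - {z. \<psi> z \<in> S ` closure D})"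
  proof (rule open_Cn_diff[OF V])
    fix zs z assume zs: "\<And>m::nat. zs m \<in> ?V" "\<And>m. zs m \<in> {z. \<psi> z \<in> S ` closure D}"
      and lim: "zs \<longlonglongrightarrow> z" and z: "z \<in> ?V"
    have "\<forall>m. \<exists>w. w \<in> closure D \<and> \<psi> (zs m) = S w" using zs(2) by blast
    then obtain ws where ws: "\<And>m. ws m \<in> closure D" "\<And>m. \<psi> (zs m) = S (ws m)" by metis
    obtain w r where w: "w \<in> closure D" "strict_mono r" "(ws \<circ> r) \<longlonglongrightarrow> w"
      using compact_imp_seq_compact[OF compact_closure_kato_D] ws(1) unfolding seq_compact_def by metis
    have "\<psi> z = S w"
    proof (rule separatedD[OF atlas(4)[OF U sigma_chart[OF order_refl]]])
      show "(zs \<circ> r) \<longlonglongrightarrow> z" using LIMSEQ_subseq_LIMSEQ[OF lim w(2)] .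
      show "(ws \<circ> r) \<longlonglongrightarrow> w" by fact
    qed (use zs ws z w closure_D_Cn in auto)
    then show "z \<in> {z. \<psi> z \<in> S ` closure D}" using w(1) by blast
  qed
  moreover have "?V - {z. \<psi> z \<in> S ` closure D} = {z \<in> U. \<psi> z \<in> Wi}"
    using atlas(3)[OF U] proj_Cn[OF order_refl] by (auto simp: Wi_iff kato_D_eq)
  ultimately show ?thesis by simp
qed

text \<open>By openness, the part of a collar chart away from the boundary of \<open>D\<close> cannot touch the
  boundary of \<open>W\<close>.\<close>

lemma collar_inside:
  assumes N: "open_Cn n N" "collar ` N \<subseteq> W" and z: "z \<in> N" "z \<in> D"
  shows "Base z \<in> Wi"
proof -
  have col: "collar x = Base x" if "x \<in> D" for x using that D_closure by (simp add: kato_collar_def)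
  have W: "Base x \<in> W" if "x \<in> N" "x \<in> D" for x using N(2) that col by (metis image_subset_iff)
  have pts: "Base z \<in> pts (tower depth)" using W[OF z] by (simp add: W_iff)
  then have z0: "z \<in> Cn n - {origin}"
    using Base_origin_pts[of depth] k_pos tower_Base[of depth z] by auto
  have "Base z \<notin> S ` closure D"
  proof
    assume "Base z \<in> S ` closure D"
    then obtain w where w: "w \<in> closure D" "S w = Base z" by auto
    then have "w \<notin> D" using W[OF z] by (metis W_iff image_eqI)
    \<comment> \<open>Near \<open>w\<close>, the germ writes each \<open>S x\<close> as
      \<open>Base (h x)\<close> with \<open>h x\<close> in \<open>N\<close> and in \<open>D\<close>,
      hence as a point of \<open>W\<close>. So no such \<open>x\<close> is in \<open>D\<close>,
      although \<open>w\<close> is a boundary point.\<close>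
    have "transition n S w (Cn n - {origin}) Base z"
      by (rule complex_atlasD(5)[OF tower_complex_atlas[OF order_refl] sigma_chart[OF order_refl]
            Base_chart[OF k_pos order_refl] closure_D_Cn[OF w(1)] z0 w(2)])
    then have "transition n S w (N \<inter> D) Base z"
      by (rule transition_shrink) (use N(1) open_Cn_kato_D z in \<open>auto intro: open_Cn_Int\<close>)
    then obtain h where "\<forall>\<^sub>F x in at w within Cn n. h x \<in> N \<inter> D \<and> Base (h x) = S x"
      unfolding transition_def by blast
    then have "\<forall>\<^sub>F x in at w within Cn n. x \<notin> D"
      by eventually_elim (use W W_iff in fastforce)
    then show False using not_eventually_not_kato_D w(1) \<open>w \<notin> D\<close> by blast
  qed
  with pts z(2) show ?thesis by (simp add: Wi_iff)
qed

lemma collar_outside: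
  assumes N: "open_Cn n N" "collar ` N \<subseteq> W" and z: "z \<in> N" "z \<notin> closure D"
  shows "S z \<in> Wi"
proof -
  have W: "S x \<in> W" if "x \<in> N" "x \<notin> closure D" for x
    using N(2) that unfolding kato_collar_def by (metis (mono_tags, lifting) image_subset_iff)
  have zC: "z \<in> Cn n" using open_Cn_subset N(1) z(1) by blast
  have pts: "S z \<in> pts (tower depth)" "P (S z) \<in> closure D" using W[OF z] by (simp_all add: W_iff)
  have "S z \<notin> S ` closure D" using S_inj[OF zC] z(2) closure_D_Cn by blast
  moreover have "P (S z) \<in> D"
  proof (rule ccontr)
    define y where "y = P (S z)"
    assume "P (S z) \<notin> D"
    then have y: "y \<in> closure D" "y \<notin> D" and "S z \<in> kato_outer n js"
      using pts by (simp_all add: y_def outer_iff)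
    then have eq: "Base y = S z" using outer_Base unfolding y_def by metis
    have y0: "y \<in> Cn n - {origin}" using kato_boundaryD[OF y] by blast
    \<comment> \<open>The mirror image: near \<open>y\<close>, each \<open>Base x\<close> is
      \<open>S (h x)\<close> with \<open>h x\<close> in the outer half of \<open>N\<close>, hence in
      \<open>W\<close>. So every such \<open>x\<close> lies in the closed domain, although
      \<open>y\<close> is a boundary point.\<close>
    have "transition n Base y (Cn n) S z"
      by (rule complex_atlasD(5)[OF tower_complex_atlas[OF order_refl] Base_chart[OF k_pos order_refl]
            sigma_chart[OF order_refl] y0 zC eq])
    then have "transition n Base y (N - closure D) S z"
      by (rule transition_shrink) (use N(1) z in \<open>auto intro: open_Cn_minus_closed\<close>)
    then obtain h where "\<forall>\<^sub>F x in at y within Cn n. h x \<in> N - closure D \<and> S (h x) = Base x"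
      unfolding transition_def by blast
    then have "\<forall>\<^sub>F x in at y within Cn n. x \<in> closure D"
    proof eventually_elim
      case (elim x)
      then have "Base x \<in> W" using W[of "h x"] by auto
      then show ?case by (simp add: W_iff)
    qed
    then show False using not_eventually_closure_kato_D y by blast
  qed
  ultimately show ?thesis using pts(1) by (simp add: Wi_iff)
qed

section \<open>Charts and coordinate changes of the quotient\<close>

lemma M_charts:
  "(U, \<Psi>) \<in> charts M \<longleftrightarrow>
     (\<exists>V \<psi>. (V, \<psi>) \<in> charts (tower depth) \<and> U = {z \<in> V. \<psi> z \<in> Wi} \<and> \<Psi> = cls \<circ> \<psi>) \<or>
     open_Cn n U \<and> collar ` U \<subseteq> W \<and> inj_on (cls \<circ> collar) U \<and> \<Psi> = cls \<circ> collar"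
proof -
  have "charts M = {({z \<in> U. \<psi> z \<in> Wi}, cls \<circ> \<psi>) | U \<psi>. (U, \<psi>) \<in> charts (tower depth)} \<union>
       {(N, cls \<circ> collar) | N. open_Cn n N \<and> collar ` N \<subseteq> W \<and> inj_on (cls \<circ> collar) N}"
    by (simp add: kato_manifold_def)
  then show ?thesis by blast
qed

lemma M_pts: "x \<in> pts M \<longleftrightarrow> (\<exists>y\<in>W. x = cls y)"
  by (auto simp: kato_manifold_def quotient_def kato_class_def)

lemma M_open: "(U, \<Psi>) \<in> charts M \<Longrightarrow> open_Cn n U"
  unfolding M_charts using open_Wi by blast

lemma M_inj:
  assumes "(U, \<Psi>) \<in> charts M"
  shows "inj_on \<Psi> U"
  using assms unfolding M_charts
proof (elim disjE exE conjE)
  fix V \<psi> assume V: "(V, \<psi>) \<in> charts (tower depth)" "U = {z \<in> V. \<psi> z \<in> Wi}" "\<Psi> = cls \<circ> \<psi>"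
  show ?thesis
  proof (rule inj_onI)
    fix z w assume zw: "z \<in> U" "w \<in> U" "\<Psi> z = \<Psi> w"
    then have "\<psi> z = \<psi> w" using cls_Wi V by auto
    then show "z = w"
      using inj_onD[OF complex_atlasD(2)[OF tower_complex_atlas[OF order_refl] V(1)]] zw V(2) by simp
  qed
qed auto

lemma M_chart_pts:
  assumes "(U, \<Psi>) \<in> charts M" "z \<in> U"
  shows "\<Psi> z \<in> pts M"
  using assms Wi_W unfolding M_charts M_pts by (elim disjE exE conjE) auto

text \<open>Off the boundary of \<open>D\<close> a collar chart coincides locally with the tower
  chart \<open>Base\<close> or \<open>S\<close>. Thus collar charts only have to be treated
  separately at boundary points.\<close>

lemma M_chart_germ:
  assumes U: "(U, \<Psi>) \<in> charts M" and z: "z \<in> U"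
  shows "(\<exists>V \<psi>. (V, \<psi>) \<in> charts (tower depth) \<and> z \<in> V \<and> \<psi> z \<in> Wi \<and> \<Psi> z = cls (\<psi> z) \<and>
      (\<forall>\<^sub>F x in at z within Cn n. x \<in> V \<and> x \<in> U \<and> \<Psi> x = cls (\<psi> x))) \<or>
    \<Psi> = cls \<circ> collar \<and> z \<in> closure D \<and> z \<notin> D"
  using U[unfolded M_charts]
proof (elim disjE exE conjE)
  fix V \<psi> assume V: "(V, \<psi>) \<in> charts (tower depth)" "U = {z \<in> V. \<psi> z \<in> Wi}" "\<Psi> = cls \<circ> \<psi>"
  have "\<forall>\<^sub>F x in at z within Cn n. x \<in> V \<and> x \<in> U \<and> \<Psi> x = cls (\<psi> x)"
    using open_Cn_eventually[OF M_open[OF U] z] by eventually_elim (use V in auto)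
  moreover have "z \<in> V \<and> \<psi> z \<in> Wi \<and> \<Psi> z = cls (\<psi> z)" using V z by auto
  ultimately show ?thesis using V(1) by blast
next
  assume N: "open_Cn n U" "collar ` U \<subseteq> W" and \<Psi>: "\<Psi> = cls \<circ> collar"
  consider "z \<in> D" | "z \<notin> closure D" | "z \<in> closure D" "z \<notin> D" by blast
  then show ?thesis
  proof cases
    case 1
    have Wi: "Base z \<in> Wi" by (rule collar_inside[OF N z 1])
    then have z0: "z \<in> Cn n - {origin}"
      using Base_origin_pts[of depth] k_pos tower_Base[of depth z] by (auto simp: Wi_iff)
    have col: "collar x = Base x" if "x \<in> D" for x using that D_closure by (simp add: kato_collar_def)
    have "open_Cn n (Cn n - {origin})"
      using complex_atlasD(1)[OF tower_complex_atlas[OF order_refl] Base_chart[OF k_pos order_refl]] .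
    then have "open_Cn n ((Cn n - {origin}) \<inter> (U \<inter> D))"
      using N(1) open_Cn_kato_D by (intro open_Cn_Int)
    then have "\<forall>\<^sub>F x in at z within Cn n. x \<in> (Cn n - {origin}) \<inter> (U \<inter> D)"
      by (rule open_Cn_eventually) (use z0 z 1 in auto)
    then have "\<forall>\<^sub>F x in at z within Cn n. x \<in> Cn n - {origin} \<and> x \<in> U \<and> \<Psi> x = cls (Base x)"
      by eventually_elim (use col \<Psi> in auto)
    moreover have "\<Psi> z = cls (Base z)" using col[OF 1] \<Psi> by simp
    ultimately show ?thesis using Wi z0 Base_chart[OF k_pos order_refl] by blast
  next
    case 2
    have Wi: "S z \<in> Wi" by (rule collar_outside[OF N z 2])
    have z0: "z \<in> Cn n" using open_Cn_subset N(1) z by blast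
    have "\<forall>\<^sub>F x in at z within Cn n. x \<in> U - closure D"
      by (rule open_Cn_eventually) (use N(1) z 2 in \<open>auto intro: open_Cn_minus_closed\<close>)
    then have "\<forall>\<^sub>F x in at z within Cn n. x \<in> Cn n \<and> x \<in> U \<and> \<Psi> x = cls (S x)"
      by eventually_elim (use \<Psi> open_Cn_subset[OF N(1)] in \<open>auto simp: kato_collar_def\<close>)
    moreover have "\<Psi> z = cls (S z)" using 2 \<Psi> by (simp add: kato_collar_def)
    ultimately show ?thesis using Wi z0 sigma_chart[OF order_refl] by blast
  next
    case 3
    then show ?thesis using \<Psi> by blast
  qed
qed

lemma cls_Wi_boundary:
  assumes "x \<in> Wi" "y \<in> closure D" "y \<notin> D"
  shows "cls x \<noteq> cls (Base y)"
  using cls_Wi[OF assms(1)] cls_boundary(1)[OF assms(2,3)] assms by (auto simp: Wi_iff)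

lemma cls_boundary_eq:
  assumes "z \<in> closure D" "z \<notin> D" "w \<in> closure D" "w \<notin> D" "cls (Base z) = cls (Base w)"
  shows "z = w"
proof -
  have "Base z \<noteq> S w" using P_S_D[OF assms(3)] assms(2) kato_pi_Base[of n js depth z] by metis
  then show ?thesis
    using cls_boundary(1)[OF assms(1,2)] cls_boundary(1)[OF assms(3,4)] assms(5) by auto
qed

text \<open>Two tower charts inherit the germ of the tower because interior classes are singletons.
  An interior class is never a boundary class. Two collar charts restrict the same map, so at a
  boundary point the germ is the identity.\<close>

lemma M_transition:
  assumes U: "(U, \<Psi>) \<in> charts M" and V: "(V, \<Phi>) \<in> charts M"
    and z: "z \<in> U" and w: "w \<in> V" and eq: "\<Psi> z = \<Phi> w"
  shows "transition n \<Psi> z V \<Phi> w"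
proof -
  have bdry: "\<Xi> y = cls (Base y)" if "\<Xi> = cls \<circ> collar" "y \<in> closure D" for \<Xi> :: "cvec \<Rightarrow> bpt set" and y
    using that by (simp add: kato_collar_def)
  have zC: "z \<in> Cn n" and wC: "w \<in> Cn n" using open_Cn_subset M_open U V z w by blast+
  from M_chart_germ[OF U z] show ?thesis
  proof (elim disjE exE conjE)
    fix U' \<psi>
    assume 1: "(U', \<psi>) \<in> charts (tower depth)" "z \<in> U'" "\<psi> z \<in> Wi" "\<Psi> z = cls (\<psi> z)"
      "\<forall>\<^sub>F x in at z within Cn n. x \<in> U' \<and> x \<in> U \<and> \<Psi> x = cls (\<psi> x)"
    from M_chart_germ[OF V w] show ?thesis
    proof (elim disjE exE conjE)
      fix V' \<phi>
      assume 2: "(V', \<phi>) \<in> charts (tower depth)" "w \<in> V'" "\<phi> w \<in> Wi" "\<Phi> w = cls (\<phi> w)"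
        "\<forall>\<^sub>F x in at w within Cn n. x \<in> V' \<and> x \<in> V \<and> \<Phi> x = cls (\<phi> x)"
      have "\<psi> z = \<phi> w" using eq cls_Wi 1(3,4) 2(3,4) by auto
      then have "transition n \<psi> z V' \<phi> w"
        by (rule complex_atlasD(5)[OF tower_complex_atlas[OF order_refl] 1(1) 2(1) 1(2) 2(2)])
      then have t2: "transition n (\<lambda>x. cls (\<psi> x)) z V' (\<lambda>x. cls (\<phi> x)) w" by (rule transition_image)
      have t1: "transition n \<Psi> z U' (\<lambda>x. cls (\<psi> x)) z"
        by (rule transition_same[OF zC]) (use 1(5) in \<open>auto elim: eventually_mono\<close>)
      have t3: "transition n (\<lambda>x. cls (\<phi> x)) w V \<Phi> w"
        by (rule transition_same[OF wC]) (use 2(5) in \<open>auto elim: eventually_mono\<close>)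
      have "transition n \<Psi> z V' (\<lambda>x. cls (\<phi> x)) w"
        by (rule transition_comp[OF t1 t2 2(2)]) (use \<open>\<psi> z = \<phi> w\<close> in simp)
      then show ?thesis by (rule transition_comp[OF _ t3 w]) (use 2(4) in simp)
    next
      assume "\<Phi> = cls \<circ> collar" "w \<in> closure D" "w \<notin> D"
      then show ?thesis using cls_Wi_boundary[OF 1(3)] bdry 1(4) eq by metis
    qed
  next
    assume 1: "\<Psi> = cls \<circ> collar" "z \<in> closure D" "z \<notin> D"
    from M_chart_germ[OF V w] show ?thesis
    proof (elim disjE exE conjE)
      fix V' \<phi>
      assume "\<phi> w \<in> Wi" "\<Phi> w = cls (\<phi> w)"
      then show ?thesis using cls_Wi_boundary[OF _ 1(2,3)] bdry[OF 1(1,2)] eq by metis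
    next
      assume 2: "\<Phi> = cls \<circ> collar" "w \<in> closure D" "w \<notin> D"
      then have "z = w" using cls_boundary_eq[OF 1(2,3) 2(2,3)] bdry 1 eq by metis
      moreover have "\<forall>\<^sub>F x in at z within Cn n. x \<in> V \<and> \<Phi> x = \<Psi> x"
        using open_Cn_eventually[OF M_open[OF V] w] \<open>z = w\<close> 1(1) 2(1) by simp
      ultimately show ?thesis using transition_same[OF zC] by blast
    qed
  qed
qed

text \<open>The quadratic form is at most some \<open>m0 < m < 1\<close> on the image of the closed domain under
  \<open>P \<circ> S\<close>.  Requiring the form to exceed \<open>m\<close> at \<open>z\<close> and to stay below \<open>m\<close> at \<open>P (S z)\<close> makes the
  two sides of the collar disjoint.\<close>

lemma boundary_chart:
  obtains N where "(N, cls \<circ> collar) \<in> charts M" "\<And>y. y \<in> closure D \<Longrightarrow> y \<notin> D \<Longrightarrow> y \<in> N"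
proof -
  obtain m0 where m0: "0 \<le> m0" "m0 < 1" "\<And>z. z \<in> closure D \<Longrightarrow> kato_form n (P (S z)) \<le> m0"
    using kato_form_bound by blast
  \<comment> \<open>A value strictly between \<open>m0\<close> and 1: at a boundary point the form
    is 1, and it is at most \<open>m0\<close> after \<open>S\<close> and \<open>P\<close>, so both
    strict inequalities that define \<open>N\<close> hold there.\<close>
  define m where "m = (m0 + 1) / 2"
  have m: "0 < m" "m < 1" "m0 < m" using m0(1,2) by (simp_all add: m_def)
  define N where "N = {z \<in> Cn n. - kato_form n z < - m} \<inter> {z \<in> Cn n. kato_form n (P (S z)) < m}"
  have "continuous_on (Cn n) (\<lambda>z. kato_form n (P (S z)))"
    by (rule continuous_on_compose2[OF continuous_on_kato_form[of UNIV]])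
      (use continuous_on_proj_sigma[of depth] in auto)
  then have N_open: "open_Cn n N" unfolding N_def
    by (intro open_Cn_Int open_Cn_preimage_less continuous_on_minus continuous_on_kato_form open_Cn_UNIV)
  have N: "z \<in> Cn n" "kato_form n z > m" "kato_form n (P (S z)) < m" if "z \<in> N" for z
    using that by (auto simp: N_def)
  have N_W: "collar ` N \<subseteq> W"
  proof (rule image_subsetI)
    fix z assume z: "z \<in> N"
    show "collar z \<in> W"
    proof (cases "z \<in> closure D")
      case True
      have "z \<noteq> origin" using N(2)[OF z] m by auto
      then have "Base z \<in> pts (tower depth)" using Base_pts N(1)[OF z] by blast
      moreover have "Base z \<noteq> S v" if "v \<in> D" for v
        using m0(3)[OF D_closure[OF that]] N(2)[OF z] m(3) kato_pi_Base[of n js depth z] by (metis less_le_not_le order_less_trans)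
      ultimately show ?thesis using True by (auto simp: kato_collar_def W_iff)
    next
      case False
      have "P (S z) \<in> D" using N[OF z] m(2) proj_Cn[of depth] sigma_pts[of depth] by (simp add: kato_D_eq)
      moreover have "S z \<notin> S ` D" using S_inj[OF N(1)[OF z]] False D_closure closure_D_Cn by blast
      ultimately show ?thesis using False D_closure sigma_pts[of depth] N(1)[OF z]
        by (simp add: kato_collar_def W_iff)
    qed
  qed
  have Wi: "collar z \<in> Wi" if "z \<in> N" "z \<in> D \<or> z \<notin> closure D" for z
    using that collar_inside[OF N_open N_W] collar_outside[OF N_open N_W] D_closure
    by (auto simp: kato_collar_def)
  have "inj_on (cls \<circ> collar) N"
  proof (rule inj_onI)
    fix z w assume z: "z \<in> N" and w: "w \<in> N" and eq: "(cls \<circ> collar) z = (cls \<circ> collar) w"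
    have bdry: "cls (collar y) = cls (Base y)" if "y \<in> closure D" for y
      using that by (simp add: kato_collar_def)
    have mixed: "Base y \<noteq> S v" if "y \<in> N" "v \<in> N" for y v
      using N(2)[OF that(1)] N(3)[OF that(2)] kato_pi_Base[of n js depth y] by (metis order_less_asym)
    show "z = w"
    proof (cases "z \<in> closure D \<and> z \<notin> D \<or> w \<in> closure D \<and> w \<notin> D")
      case True
      then show ?thesis
        using cls_boundary_eq[of z w] cls_Wi_boundary[OF Wi[OF z], of w] cls_Wi_boundary[OF Wi[OF w], of z]
          bdry eq by (metis comp_apply)
    next
      case False
      then have "collar z = collar w" using eq cls_Wi[OF Wi[OF z]] cls_Wi[OF Wi[OF w]] by auto
      then show ?thesis
        using mixed[OF z w] mixed[OF w z] S_inj[OF N(1)[OF z] N(1)[OF w]]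
        by (auto simp: kato_collar_def split: if_splits)
    qed
  qed
  then have "(N, cls \<circ> collar) \<in> charts M" using N_open N_W by (simp add: M_charts)
  moreover have "y \<in> N" if "y \<in> closure D" "y \<notin> D" for y
    using kato_boundaryD[OF that] m m0(3)[OF that(1)] by (auto simp: N_def)
  ultimately show ?thesis using that by blast
qed

text \<open>A point of the inner boundary has the same class as its partner on the outer boundary,
  where \<open>boundary_chart\<close> applies.\<close>

lemma M_covered:
  assumes "x \<in> pts M"
  obtains U \<Psi> z where "(U, \<Psi>) \<in> charts M" "z \<in> U" "x = \<Psi> z"
proof -
  note chart = that
  obtain y where y: "y \<in> W" "x = cls y" using assms M_pts by blast
  have bdry: thesis if "w \<in> closure D" "w \<notin> D" "x = cls (Base w)" for w
  proof -
    obtain N where "(N, cls \<circ> collar) \<in> charts M" "w \<in> N" using boundary_chart \<open>w \<in> closure D\<close> \<open>w \<notin> D\<close> by blast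
    moreover have "x = (cls \<circ> collar) w" using that by (simp add: kato_collar_def)
    ultimately show thesis by (rule chart)
  qed
  consider "y \<in> Wi" | "P y \<in> closure D" "P y \<notin> D" | w where "w \<in> closure D" "y = S w"
    using y(1) by (auto simp: W_iff Wi_iff)
  then show thesis
  proof cases
    case 1
    obtain V \<psi> z where V: "(V, \<psi>) \<in> charts (tower depth)" "z \<in> V" "y = \<psi> z"
      using complex_atlas_covered[OF tower_complex_atlas[OF order_refl], of y] 1 by (auto simp: Wi_iff)
    then have "({z \<in> V. \<psi> z \<in> Wi}, cls \<circ> \<psi>) \<in> charts M" unfolding M_charts by blast
    then show thesis by (rule chart[of _ _ z]) (use V 1 y in auto)
  next
    case 2
    then have "y = Base (P y)" using outer_Base y(1) by (simp add: outer_iff W_iff)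
    then show thesis using bdry 2 y(2) by metis
  next
    case 3
    then have "w \<notin> D" using y(1) by (auto simp: W_iff)
    then show thesis using bdry[OF 3(1)] cls_boundary[OF 3(1)] 3(2) y(2) by simp
  qed
qed

end

section \<open>The torus action\<close>

definition cscale :: "cvec \<Rightarrow> cvec \<Rightarrow> cvec" where
  "cscale u v = (\<lambda>i. u i * v i)"

text \<open>A torus element padded with 1, so that it acts on all coordinates by
  \<open>cscale\<close> and leaves those of index at least \<open>l\<close> alone.\<close>

definition unitary :: "nat \<Rightarrow> cvec \<Rightarrow> bool" where
  "unitary l u \<longleftrightarrow> (\<forall>i. cmod (u i) = 1) \<and> (\<forall>i\<ge>l. u i = 1)"

primrec scale_bpt :: "cvec \<Rightarrow> bpt \<Rightarrow> bpt" where
  "scale_bpt u (Base z) = Base (cscale u z)"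
| "scale_bpt u (Exc p L) = Exc p (cscale u ` L)"

lemma scale_scale: "cscale u (cscale v z) = cscale (cscale u v) z"
  by (simp add: cscale_def mult.assoc)

lemma scale_one [simp]: "cscale (\<lambda>_. 1) z = z"
  by (simp add: cscale_def)

lemma scale_origin [simp]: "cscale u origin = origin"
  by (simp add: cscale_def)

lemma scale_Cn [simp]: "z \<in> Cn n \<Longrightarrow> cscale u z \<in> Cn n"
  by (simp add: cscale_def Cn_def)

lemma scale_bpt_scale_bpt: "scale_bpt u (scale_bpt v x) = scale_bpt (cscale u v) x"
  by (cases x) (simp_all add: scale_scale image_image)

lemma scale_bpt_one [simp]: "scale_bpt (\<lambda>_. 1) x = x"
  by (cases x) simp_all

lemma unitary_cnj: "unitary l u \<Longrightarrow> unitary l (\<lambda>i. cnj (u i))"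
  by (simp add: unitary_def)

lemma cmod_1_cnj: "cmod a = 1 \<Longrightarrow> cnj a * a = 1" "cmod a = 1 \<Longrightarrow> a * cnj a = 1"
  by (simp_all add: complex_norm_square[symmetric] mult.commute[of "cnj a"])

lemma scale_cnj_unitary:
  assumes "unitary l u"
  shows "cscale (\<lambda>i. cnj (u i)) u = (\<lambda>_. 1)" "cscale u (\<lambda>i. cnj (u i)) = (\<lambda>_. 1)"
  using assms by (simp_all add: cscale_def unitary_def cmod_1_cnj)

lemma scale_bpt_cnj:
  assumes "unitary l u"
  shows "scale_bpt (\<lambda>i. cnj (u i)) (scale_bpt u x) = x" "scale_bpt u (scale_bpt (\<lambda>i. cnj (u i)) x) = x"
  by (simp_all add: scale_bpt_scale_bpt scale_cnj_unitary[OF assms])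

lemma inj_scale_bpt: "unitary l u \<Longrightarrow> inj (scale_bpt u)"
  by (rule inj_on_inverseI) (rule scale_bpt_cnj)

lemma line_scale_image: "line (cscale u v) = cscale u ` line v"
proof -
  have "(\<lambda>i. c * cscale u v i) = cscale u (\<lambda>i. c * v i)" for c
    by (simp add: cscale_def ac_simps)
  then show ?thesis unfolding line_def by auto
qed

lemma kato_form_scale_unitary: "(\<And>i. cmod (u i) = 1) \<Longrightarrow> kato_form n (cscale u z) = kato_form n z"
  by (simp add: kato_form_def cscale_def norm_mult)

lemma complex_differentiable_map_at_scale: "z \<in> Cn n \<Longrightarrow> complex_differentiable_map_at n (cscale u) z"
  unfolding complex_differentiable_map_at_def
proof (intro conjI allI impI)
  show "\<forall>\<^sub>F w in at z within Cn n. cscale u w \<in> Cn n"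
    using eventually_in_Cn by eventually_elim simp
qed (auto simp: cscale_def scale_Cn[unfolded cscale_def] intro!: complex_differentiable_at_mult complex_differentiable_at_const
    complex_differentiable_at_coord)

lemma continuous_on_scale: "continuous_on S (cscale u)"
  unfolding cscale_def[abs_def] by (intro continuous_on_coordinatewise_then_product continuous_intros)

text \<open>Below \<open>j\<close> the entries keep their index. Beyond \<open>j\<close> they are
  shifted by one, but all weights involved there are 1 because \<open>j\<close> is at least
  \<open>l\<close>.\<close>

lemma chart_vec_scale:
  assumes "unitary l u" "l \<le> j" "j < n"
  shows "chart_vec n j (cscale u z) = cscale u (chart_vec n j z)"
  using assms by (auto simp: chart_vec_def cscale_def unitary_def fun_eq_iff)

text \<open>In the j-th standard chart the action is diagonal as well; division by \<open>u j\<close> is written as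
  multiplication with its conjugate, which is continuous everywhere.\<close>

definition chart_weights :: "nat \<Rightarrow> nat \<Rightarrow> cvec \<Rightarrow> cvec" where
  "chart_weights n j u = (\<lambda>q. if q < n - 1 then (if q < j then u q else u (Suc q)) * cnj (u j)
     else if q = n - 1 then u j else 1)"

lemma chart_vec_chart_weights:
  assumes "unitary l u" "j < n"
  shows "chart_vec n j (cscale (chart_weights n j u) z) = (\<lambda>p. cscale u (chart_vec n j z) p * cnj (u j))"
proof
  fix p
  have "u j * cnj (u j) = 1" using assms by (simp add: unitary_def cmod_1_cnj)
  then show "chart_vec n j (cscale (chart_weights n j u) z) p = cscale u (chart_vec n j z) p * cnj (u j)"
    using assms by (cases "p < j"; cases "p = j") (auto simp: chart_vec_def chart_weights_def cscale_def)
qed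

text \<open>The line ignores the common factor \<open>cnj (u j)\<close>, and in the base point it is
  cancelled by the weight \<open>u j\<close> of the last coordinate. Here \<open>j\<close> may be
  below \<open>l\<close>, as for charts of the atlas that are not letters of the word.\<close>

lemma blow_iota_chart_weights:
  assumes u: "unitary l u" and j: "j < n" and s: "\<And>z. s (cscale u z) = scale_bpt u (s z)"
  shows "blow_iota s p (std_chart n j (cscale (chart_weights n j u) z)) =
    scale_bpt u (blow_iota s p (std_chart n j z))"
proof -
  let ?d = "chart_weights n j u"
  have uj: "u j * cnj (u j) = 1" using u by (simp add: unitary_def cmod_1_cnj)
  then have "u j \<noteq> 0" by auto
  have last: "cscale ?d z (n - 1) = u j * z (n - 1)" by (simp add: cscale_def chart_weights_def)
  have "line (\<lambda>p. cscale u (chart_vec n j z) p * cnj (u j)) = line (cscale u (chart_vec n j z))"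
    using \<open>u j \<noteq> 0\<close> by (intro line_scale) simp
  then have line: "line (chart_vec n j (cscale ?d z)) = cscale u ` line (chart_vec n j z)"
    by (simp add: chart_vec_chart_weights[OF u j] line_scale_image)
  have eq: "u j * z (n - 1) * (cscale u (chart_vec n j z) p * cnj (u j)) =
      u p * (z (n - 1) * chart_vec n j z p) * (u j * cnj (u j))" for p
    by (simp add: cscale_def ac_simps)
  have fst: "fst (std_chart n j (cscale ?d z)) = cscale u (fst (std_chart n j z))"
    by (simp only: std_chart_eq[OF j] fst_conv last chart_vec_chart_weights[OF u j] eq uj)
      (simp add: cscale_def)
  show ?thesis
    using j line fst last \<open>u j \<noteq> 0\<close> s by (simp add: blow_iota_std_chart)
qed

lemma continuous_on_chart_weights: "continuous_on UNIV (\<lambda>u. chart_weights n j u i)"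
  unfolding chart_weights_def
  by (cases "i < n - 1"; cases "i < j"; cases "i = n - 1") (simp_all add: continuous_intros)

lemma cmod_chart_weights: "unitary l u \<Longrightarrow> cmod (chart_weights n j u i) = 1"
  by (simp add: chart_weights_def unitary_def norm_mult)

section \<open>Equivariance of the tower, the gluing and the charts\<close>

context kato_data
begin

text \<open>The last coordinate is invariant because \<open>l < n\<close>, and
  \<open>chart_vec_scale\<close> applies to every letter of the word. At \<open>origin\<close> this
  says that the centres are fixed points.\<close>

lemma emb_scale: "unitary l u \<Longrightarrow> p \<le> depth \<Longrightarrow> emb p (cscale u z) = scale_bpt u (emb p z)"
proof (induction p arbitrary: z)
  case (Suc p)
  let ?j = "js ! p"
  have j: "l \<le> ?j" "?j < n" using js_nth[of p] Suc.prems by auto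
  have v: "chart_vec n ?j (cscale u z) = cscale u (chart_vec n ?j z)"
    by (rule chart_vec_scale[OF Suc.prems(1) j])
  have last: "cscale u z (n - 1) = z (n - 1)"
    using Suc.prems(1) type_less by (simp add: cscale_def unitary_def)
  have "fst (std_chart n ?j (cscale u z)) = cscale u (fst (std_chart n ?j z))"
    by (simp only: std_chart_eq[OF j(2)] fst_conv v last) (simp add: cscale_def fun_eq_iff)
  then show ?case using j Suc v last by (simp add: blow_iota_std_chart line_scale_image)
qed simp

text \<open>One family \<open>d\<close> of weights serves all \<open>u\<close>; its continuity in
  \<open>u\<close> later yields joint continuity of the action. Old chart domains stay invariant
  because the removed centre is fixed.\<close>

lemma tower_chart_scale:
  "p \<le> depth \<Longrightarrow> (U, \<psi>) \<in> charts (tower p) \<Longrightarrow>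
   \<exists>d. (\<forall>i. continuous_on UNIV (\<lambda>u. d u i)) \<and> (\<forall>u. unitary l u \<longrightarrow> (\<forall>i. cmod (d u i) = 1) \<and>
     (\<forall>z\<in>U. cscale (d u) z \<in> U \<and> \<psi> (cscale (d u) z) = scale_bpt u (\<psi> z)))"
proof (induction p arbitrary: U \<psi>)
  case 0
  then have "U = Cn n" "\<psi> = Base" by simp_all
  then show ?case
    by (intro exI[of _ "\<lambda>u. u"]) (auto simp: unitary_def intro: continuous_on_coord)
next
  case (Suc p)
  then consider U0 where "(U0, \<psi>) \<in> charts (tower p)" "U = {z \<in> U0. \<psi> z \<noteq> emb p origin}"
    | j where "j < n" "U = Cn n" "\<psi> = blow_iota (emb p) (Suc p) \<circ> std_chart n j"
    by (auto simp: blow_up_def)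
  then show ?case
  proof cases
    case 1
    obtain d where d: "\<forall>i. continuous_on UNIV (\<lambda>u. d u i)"
      "\<forall>u. unitary l u \<longrightarrow> (\<forall>i. cmod (d u i) = 1) \<and>
        (\<forall>z\<in>U0. cscale (d u) z \<in> U0 \<and> \<psi> (cscale (d u) z) = scale_bpt u (\<psi> z))"
      using Suc.IH[OF _ 1(1)] Suc.prems(1) by (elim exE conjE meta_impE) auto
    have "scale_bpt u (\<psi> z) \<noteq> emb p origin" if "unitary l u" "\<psi> z \<noteq> emb p origin" for u z
    proof -
      have "emb p origin = scale_bpt u (emb p origin)"
        using emb_scale[OF that(1), of p origin] Suc.prems(1) by simp
      then show ?thesis using injD[OF inj_scale_bpt[OF that(1)], of "\<psi> z" "emb p origin"] that(2) by metis
    qed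
    then have "cscale (d u) z \<in> U \<and> \<psi> (cscale (d u) z) = scale_bpt u (\<psi> z)" if "unitary l u" "z \<in> U" for u z
      using d(2) that unfolding 1(2) by simp
    with d show ?thesis by blast
  next
    case 2
    have "cscale (chart_weights n j u) z \<in> U \<and> \<psi> (cscale (chart_weights n j u) z) = scale_bpt u (\<psi> z)"
      if "unitary l u" "z \<in> U" for u z
      using blow_iota_chart_weights[OF that(1) 2(1), of "emb p"] emb_scale[OF that(1), of p]
        Suc.prems(1) that(2) 2(2,3) by simp
    then show ?thesis using continuous_on_chart_weights cmod_chart_weights by blast
  qed
qed

lemma tower_pts_scale:
  assumes "unitary l u" "x \<in> pts (tower depth)"
  shows "scale_bpt u x \<in> pts (tower depth)"
proof -
  obtain U \<psi> z where U: "(U, \<psi>) \<in> charts (tower depth)" "z \<in> U" "x = \<psi> z"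
    using complex_atlas_covered[OF tower_complex_atlas[OF order_refl] assms(2)] .
  then obtain d where "cscale (d u) z \<in> U" "\<psi> (cscale (d u) z) = scale_bpt u (\<psi> z)"
    using tower_chart_scale[OF order_refl U(1)] assms(1) by blast
  then show ?thesis
    using complex_atlasD(3)[OF tower_complex_atlas[OF order_refl] U(1)] U(3) by metis
qed

lemma P_scale:
  assumes "unitary l u" "x \<in> pts (tower depth)"
  shows "P (scale_bpt u x) = cscale u (P x)"
proof (cases x)
  case (Exc q L)
  have "scale_bpt u x \<in> pts (tower depth)" by (rule tower_pts_scale[OF assms])
  then show ?thesis using Exc assms(2) proj_Exc[of depth] by simp
qed simp

lemma S_scale: "unitary l u \<Longrightarrow> S (cscale u z) = scale_bpt u (S z)"
  by (rule emb_scale) simp_all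

lemma D_scale: "unitary l u \<Longrightarrow> z \<in> D \<Longrightarrow> cscale u z \<in> D"
  by (simp add: kato_D_eq kato_form_scale_unitary unitary_def)

lemma closure_D_scale: "unitary l u \<Longrightarrow> z \<in> closure D \<Longrightarrow> cscale u z \<in> closure D"
  by (simp add: closure_kato_D kato_form_scale_unitary unitary_def)

lemma scale_cnj: "unitary l u \<Longrightarrow> cscale (\<lambda>i. cnj (u i)) (cscale u z) = z" "unitary l u \<Longrightarrow> cscale u (cscale (\<lambda>i. cnj (u i)) z) = z"
  by (simp_all add: scale_scale scale_cnj_unitary)

lemma S_image_scale:
  assumes u: "unitary l u" and A: "\<And>u z. unitary l u \<Longrightarrow> z \<in> A \<Longrightarrow> cscale u z \<in> A"
    and "x \<notin> S ` A"
  shows "scale_bpt u x \<notin> S ` A"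
proof
  assume "scale_bpt u x \<in> S ` A"
  then obtain w where w: "w \<in> A" "scale_bpt u x = S w" by blast
  then have "x = S (cscale (\<lambda>i. cnj (u i)) w)"
    using S_scale[OF unitary_cnj[OF u], of w] scale_bpt_cnj(1)[OF u, of x] by simp
  then show False using A[OF unitary_cnj[OF u] w(1)] assms(3) by blast
qed

lemma W_scale: "unitary l u \<Longrightarrow> x \<in> W \<Longrightarrow> scale_bpt u x \<in> W"
  using S_image_scale[of u D x] D_scale by (simp add: W_iff tower_pts_scale P_scale closure_D_scale)

lemma Wi_scale: "unitary l u \<Longrightarrow> x \<in> Wi \<Longrightarrow> scale_bpt u x \<in> Wi"
  using S_image_scale[of u "closure D" x] closure_D_scale
  by (simp add: Wi_iff tower_pts_scale P_scale D_scale)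

lemma outer_scale:
  assumes u: "unitary l u" and "x \<in> kato_outer n js"
  shows "scale_bpt u x \<in> kato_outer n js"
proof -
  have "cscale u (P x) \<notin> D"
    using assms(2) D_scale[OF unitary_cnj[OF u], of "cscale u (P x)"] scale_cnj(1)[OF u] by (auto simp: outer_iff)
  then show ?thesis
    using assms by (simp add: outer_iff tower_pts_scale P_scale closure_D_scale)
qed

lemma cls_scale_mem:
  assumes u: "unitary l u" and y: "y \<in> cls x"
  shows "scale_bpt u y \<in> cls (scale_bpt u x)"
proof -
  have xy: "x \<in> W" "y \<in> W" using y by (simp_all add: cls_iff)
  have eq: "S (P (scale_bpt u z)) = scale_bpt u (S (P z))" if "z \<in> W" for z
    using that P_scale[OF u] S_scale[OF u] by (simp add: W_iff)
  show ?thesis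
    using y W_scale[OF u] outer_scale[OF u] eq[OF xy(1)] eq[OF xy(2)] unfolding cls_iff by metis
qed

lemma cls_scale:
  assumes u: "unitary l u"
  shows "cls (scale_bpt u x) = scale_bpt u ` cls x"
proof (intro equalityI subsetI)
  fix y assume "y \<in> cls (scale_bpt u x)"
  then have "scale_bpt (\<lambda>i. cnj (u i)) y \<in> cls x"
    using cls_scale_mem[OF unitary_cnj[OF u]] scale_bpt_cnj[OF u] by metis
  then show "y \<in> scale_bpt u ` cls x" using scale_bpt_cnj(2)[OF u] by (metis image_eqI)
qed (use cls_scale_mem[OF u] in blast)

lemma collar_scale:
  assumes u: "unitary l u"
  shows "collar (cscale u z) = scale_bpt u (collar z)"
proof -
  have "cscale u z \<in> closure D \<longleftrightarrow> z \<in> closure D"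
    using closure_D_scale[OF u] closure_D_scale[OF unitary_cnj[OF u]] scale_cnj(1)[OF u] by metis
  then show ?thesis using S_scale[OF u] by (simp add: kato_collar_def)
qed

lemma M_pts_scale: "unitary l u \<Longrightarrow> c \<in> pts M \<Longrightarrow> scale_bpt u ` c \<in> pts M"
  unfolding M_pts using cls_scale W_scale by metis

lemma open_Cn_scale_image:
  assumes "unitary l u" "open_Cn n N"
  shows "open_Cn n (cscale u ` N)"
proof -
  have "openin (top_of_set (Cn n)) (Cn n \<inter> cscale (\<lambda>i. cnj (u i)) -` N)"
    using assms(2) unfolding open_Cn_def
    by (intro continuous_openin_preimage[where T = "Cn n"] continuous_on_scale) auto
  moreover have "Cn n \<inter> cscale (\<lambda>i. cnj (u i)) -` N = cscale u ` N"
  proof (intro equalityI subsetI)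
    fix w assume "w \<in> Cn n \<inter> cscale (\<lambda>i. cnj (u i)) -` N"
    then show "w \<in> cscale u ` N" using scale_cnj(2)[OF assms(1), of w] by (metis IntD2 image_eqI vimage_eq)
  next
    fix w assume "w \<in> cscale u ` N"
    then show "w \<in> Cn n \<inter> cscale (\<lambda>i. cnj (u i)) -` N"
      using scale_cnj(1)[OF assms(1)] open_Cn_subset[OF assms(2)] by auto
  qed
  ultimately show ?thesis by (simp add: open_Cn_def)
qed

text \<open>A tower chart has an invariant domain. A collar domain moves to its image under the
  rotation, which is again admissible for the same map \<open>cls \<circ> collar\<close>; hence
  \<open>V\<close> is chosen after \<open>u\<close>.\<close>

lemma M_chart_scale:
  assumes U: "(U, \<Psi>) \<in> charts M"
  shows "\<exists>d. (\<forall>i. continuous_on UNIV (\<lambda>u. d u i)) \<and> (\<forall>u. unitary l u \<longrightarrow>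
     (\<exists>V. (V, \<Psi>) \<in> charts M \<and> (\<forall>z\<in>U. cscale (d u) z \<in> V \<and> \<Psi> (cscale (d u) z) = scale_bpt u ` \<Psi> z)))"
  using U[unfolded M_charts]
proof (elim disjE exE conjE)
  fix V \<psi> assume V: "(V, \<psi>) \<in> charts (tower depth)" "U = {z \<in> V. \<psi> z \<in> Wi}" "\<Psi> = cls \<circ> \<psi>"
  obtain d where d: "\<forall>i. continuous_on UNIV (\<lambda>u. d u i)"
    "\<forall>u. unitary l u \<longrightarrow> (\<forall>i. cmod (d u i) = 1) \<and>
      (\<forall>z\<in>V. cscale (d u) z \<in> V \<and> \<psi> (cscale (d u) z) = scale_bpt u (\<psi> z))"
    using tower_chart_scale[OF order_refl V(1)] by (elim exE conjE)
  have "cscale (d u) z \<in> U \<and> \<Psi> (cscale (d u) z) = scale_bpt u ` \<Psi> z" if "unitary l u" "z \<in> U" for u z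
    using d(2) that Wi_scale[OF that(1)] cls_scale[OF that(1)] unfolding V(2,3) by simp
  with d(1) U show ?thesis by blast
next
  assume N: "open_Cn n U" "collar ` U \<subseteq> W" "inj_on (cls \<circ> collar) U" and \<Psi>: "\<Psi> = cls \<circ> collar"
  have act: "\<Psi> (cscale u z) = scale_bpt u ` \<Psi> z" if "unitary l u" for u z
    using that by (simp add: \<Psi> collar_scale cls_scale)
  have "(cscale u ` U, \<Psi>) \<in> charts M" if u: "unitary l u" for u
  proof -
    have "inj_on (cls \<circ> collar) (cscale u ` U)"
    proof (rule inj_onI)
      fix z w assume "z \<in> cscale u ` U" "w \<in> cscale u ` U" and eq: "(cls \<circ> collar) z = (cls \<circ> collar) w"
      then obtain z' w' where zw: "z = cscale u z'" "w = cscale u w'" "z' \<in> U" "w' \<in> U" by blast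
      then have "scale_bpt u ` \<Psi> z' = scale_bpt u ` \<Psi> w'" using eq act[OF u] by (simp add: \<Psi>)
      then have "\<Psi> z' = \<Psi> w'" by (simp add: inj_image_eq_iff[OF inj_scale_bpt[OF u]])
      then show "z = w" using inj_onD[OF N(3)] zw \<Psi> by blast
    qed
    moreover have "collar ` cscale u ` U \<subseteq> W"
      using N(2) W_scale[OF u] collar_scale[OF u] by auto
    ultimately show ?thesis unfolding M_charts using open_Cn_scale_image[OF u N(1)] \<Psi> by blast
  qed
  then have "\<exists>V. (V, \<Psi>) \<in> charts M \<and> (\<forall>z\<in>U. cscale u z \<in> V \<and> \<Psi> (cscale u z) = scale_bpt u ` \<Psi> z)"
    if "unitary l u" for u
    using act that by blast
  then show ?thesis by (intro exI[of _ "\<lambda>u. u"]) (auto intro: continuous_on_coord)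
qed

text \<open>In charts \<open>f\<close> is the linear map \<open>cscale (d u)\<close> followed by a
  coordinate change. Fixing \<open>f\<close> on \<open>pts M\<close> only lets the lemma cover an
  \<open>inv_into\<close> as well.\<close>

lemma holomorphic_map_scale:
  assumes u: "unitary l u" and f: "\<And>c. c \<in> pts M \<Longrightarrow> f c = scale_bpt u ` c"
    and cont: "continuous_map (mfd_top n M) (mfd_top n M) f"
  shows "holomorphic_map n M M f"
  unfolding holomorphic_map_def
proof (intro conjI cont ballI, clarify)
  fix U \<Psi> V \<Phi> z w i
  assume U: "(U, \<Psi>) \<in> charts M" and V: "(V, \<Phi>) \<in> charts M" and z: "z \<in> U"
    and w: "w \<in> V" "f (\<Psi> z) = \<Phi> w" and i: "i < n"
  obtain d V' where V': "(V', \<Psi>) \<in> charts M"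
    "\<forall>z\<in>U. cscale (d u) z \<in> V' \<and> \<Psi> (cscale (d u) z) = scale_bpt u ` \<Psi> z"
    using M_chart_scale[OF U] u by (elim exE conjE) blast
  then have V'': "cscale (d u) z \<in> V' \<and> \<Psi> (cscale (d u) z) = f (\<Psi> z)" if "z \<in> U" for z
    using f M_chart_pts[OF U] that by simp
  have zC: "z \<in> Cn n" using open_Cn_subset M_open U z by blast
  have "\<forall>\<^sub>F x in at z within Cn n. cscale (d u) x \<in> V' \<and> \<Psi> (cscale (d u) x) = f (\<Psi> x)"
    using open_Cn_eventually[OF M_open[OF U] z] by eventually_elim (rule V'')
  then have t1: "transition n (\<lambda>x. f (\<Psi> x)) z V' \<Psi> (cscale (d u) z)"
    unfolding transition_def using complex_differentiable_map_at_scale[OF zC, of "d u"] by blast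
  have t2: "transition n \<Psi> (cscale (d u) z) V \<Phi> w"
    by (rule M_transition[OF V'(1) V _ w(1)]) (use V''[OF z] w(2) in auto)
  have "transition n (\<lambda>x. f (\<Psi> x)) z V \<Phi> w"
    by (rule transition_comp[OF t1 t2 w(1)]) (use V''[OF z] w(2) in simp)
  then show "complex_differentiable_at n (\<lambda>x. inv_into V \<Phi> (f (\<Psi> x)) i) z"
    by (rule transition_inv_into[where \<psi> = "\<lambda>x. f (\<Psi> x)" and z = z,
          OF _ M_inj[OF V] w(1) w(2)[symmetric] i])
qed

lemma faithful_point:
  assumes "0 < l"
  obtains c where "c \<noteq> 0" "Base (\<lambda>i. if i < l then c else 0) \<in> Wi"
proof -
  obtain m where m: "0 \<le> m" "m < 1" "\<And>z. z \<in> closure D \<Longrightarrow> kato_form n (P (S z)) \<le> m"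
    using kato_form_bound by blast
  define r where "r = (m + 1) / 2"
  have r: "0 < r" "r < 1" "m < r" using m(1,2) by (simp_all add: r_def)
  \<comment> \<open>The first \<open>l\<close> coordinates have index below \<open>n - 1\<close> and
    so weight 1; each contributes \<open>r / l\<close>, which makes the form equal to
    \<open>r\<close>. As \<open>r\<close> exceeds \<open>m\<close>, the point is not in the image of
    the closed domain, and as \<open>r < 1\<close> it lies over \<open>D\<close>.\<close>
  define c where "c = complex_of_real (sqrt (r / l))"
  have c: "c \<noteq> 0" "(cmod c)\<^sup>2 = r / l" using r(1) assms by (simp_all add: c_def)
  let ?y = "\<lambda>i. if i < l then c else 0"
  have "kato_form n ?y = (\<Sum>j<n - 1. if j < l then (cmod c)\<^sup>2 else 0)"
    using type_less by (simp add: kato_form_def if_distrib[of "\<lambda>x. (cmod x)\<^sup>2"] cong: if_cong)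
  also have "\<dots> = (\<Sum>j\<in>{..<l}. (cmod c)\<^sup>2)"
    by (rule sum.mono_neutral_cong_right) (use type_less in auto)
  finally have form: "kato_form n ?y = r" using c(2) assms by simp
  have y: "?y \<in> Cn n" "?y \<noteq> origin" using type_less form r(1) by (auto simp: Cn_def dest: arg_cong[of _ _ "kato_form n"])
  have "Base ?y \<noteq> S v" if "v \<in> closure D" for v
    using m(3)[OF that] form r(3) kato_pi_Base[of n js depth ?y] by (metis not_less)
  then have "Base ?y \<in> Wi"
    using Base_pts[OF y] y(1) form r(2) by (auto simp: Wi_iff kato_D_eq)
  then show ?thesis using that c(1) by blast
qed

end

section \<open>The topology of an atlas and joint continuity\<close>

lemma continuous_map_mult:
  fixes f :: "'a \<Rightarrow> 'b :: real_normed_algebra"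
  assumes "continuous_map X euclidean f" "continuous_map X euclidean g"
  shows "continuous_map X euclidean (\<lambda>x. f x * g x)"
  using assms by (simp add: continuous_map_atin tendsto_mult)

text \<open>The conditions under which \<open>mfd_top\<close> has the intended open sets and
  \<open>pts M\<close> as underlying set.\<close>

definition proper_charts :: "nat \<Rightarrow> 'a cmfd \<Rightarrow> bool" where
  "proper_charts n M \<longleftrightarrow> (\<forall>U \<psi>. (U, \<psi>) \<in> charts M \<longrightarrow> open_Cn n U \<and> \<psi> ` U \<subseteq> pts M)"

lemma proper_chartsD:
  assumes "proper_charts n M" "(U, \<psi>) \<in> charts M"
  shows "open_Cn n U" "z \<in> U \<Longrightarrow> \<psi> z \<in> pts M"
  using assms unfolding proper_charts_def by blast+

lemma openin_mfd_top_iff: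
  assumes "proper_charts n M"
  shows "openin (mfd_top n M) V \<longleftrightarrow>
    V \<subseteq> pts M \<and> (\<forall>U \<psi>. (U, \<psi>) \<in> charts M \<longrightarrow> open_Cn n {z \<in> U. \<psi> z \<in> V})"
  by (subst openin_mfd_top) (use proper_chartsD(1)[OF assms] in blast)+

lemma topspace_mfd_top:
  assumes "proper_charts n M"
  shows "topspace (mfd_top n M) = pts M"
proof (rule equalityI)
  have "{z \<in> U. \<psi> z \<in> pts M} = U" if "(U, \<psi>) \<in> charts M" for U \<psi>
    using proper_chartsD(2)[OF assms that] by blast
  then have "openin (mfd_top n M) (pts M)"
    using proper_chartsD(1)[OF assms] by (simp add: openin_mfd_top_iff[OF assms])
  then show "pts M \<subseteq> topspace (mfd_top n M)" by (rule openin_subset)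
  show "topspace (mfd_top n M) \<subseteq> pts M"
    using openin_topspace[of "mfd_top n M"] openin_mfd_top_iff[OF assms] by blast
qed

text \<open>Local compactness of \<open>T\<close> makes the product of \<open>T\<close> with the quotient topology of the
  manifold again a quotient topology, so that joint continuity can be tested in the charts.\<close>

lemma continuous_map_prod_mfd_top:
  fixes T :: "'t topology" and M :: "'a cmfd"
  assumes T: "compact_space T" "Hausdorff_space T"
    and M: "proper_charts n M"
    and cover: "\<And>x. x \<in> pts M \<Longrightarrow> \<exists>U \<psi> z. (U, \<psi>) \<in> charts M \<and> z \<in> U \<and> x = \<psi> z"
    and f: "\<And>t x. t \<in> topspace T \<Longrightarrow> x \<in> pts M \<Longrightarrow> f t x \<in> pts M"
    and charts: "\<And>U \<psi> V. (U, \<psi>) \<in> charts M \<Longrightarrow> openin (mfd_top n M) V \<Longrightarrow>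
      openin (prod_topology T (top_of_set (Cn n))) {(t, z). t \<in> topspace T \<and> z \<in> U \<and> f t (\<psi> z) \<in> V}"
  shows "continuous_map (prod_topology T (mfd_top n M)) (mfd_top n M) (\<lambda>(t, x). f t x)"
proof -
  note open_charts = proper_chartsD(1)[OF M] and pts = proper_chartsD(2)[OF M]
  have top: "topspace (mfd_top n M) = pts M" by (rule topspace_mfd_top[OF M])
  have "openin (prod_topology T (mfd_top n M)) {y \<in> topspace T \<times> pts M. (case y of (t, x) \<Rightarrow> f t x) \<in> V}"
    if V: "openin (mfd_top n M) V" for V
    unfolding openin_prod_topology_alt
  proof (intro allI impI)
    fix t0 x0 assume "(t0, x0) \<in> {y \<in> topspace T \<times> pts M. (case y of (t, x) \<Rightarrow> f t x) \<in> V}"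
    then have t0: "t0 \<in> topspace T" and x0: "x0 \<in> pts M" and V0: "f t0 x0 \<in> V" by auto
    obtain U0 \<psi>0 z0 where U0: "(U0, \<psi>0) \<in> charts M" "z0 \<in> U0" "x0 = \<psi>0 z0" using cover[OF x0] by blast
    have z0: "z0 \<in> Cn n" using open_Cn_subset[OF open_charts[OF U0(1)]] U0(2) by blast
    have "continuous_map T (prod_topology T (top_of_set (Cn n))) (\<lambda>t. (t, z0))"
      using z0 by (intro continuous_map_pairedI) auto
    from openin_continuous_map_preimage[OF this charts[OF U0(1) V]]
    have opn: "openin T {t \<in> topspace T. f t x0 \<in> V}" using U0 by (simp add: conj_ac)
    have mem: "t0 \<in> {t \<in> topspace T. f t x0 \<in> V}" using t0 V0 by simp
    \<comment> \<open>Regularity gives \<open>t0\<close> a closed, hence compact, neighbourhood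
      \<open>K\<close> on which \<open>f t x0\<close> stays in \<open>V\<close>.\<close>
    have "neighbourhood_base_of (closedin T) T"
      using T by (simp add: neighbourhood_base_of_closedin compact_Hausdorff_imp_regular_space)
    from this[unfolded neighbourhood_base_of, rule_format, OF conjI[OF opn mem]]
    obtain A K where A: "openin T A" "closedin T K" "t0 \<in> A" "A \<subseteq> K" "K \<subseteq> {t \<in> topspace T. f t x0 \<in> V}"
      by (elim exE conjE)
    have K: "compactin T K" using T(1) A(2) by (rule closedin_compact_space)
    \<comment> \<open>\<open>X\<close> lives in the manifold and not in one chart, so its openness
      can be tested in each chart separately, where the tube lemma over the compact \<open>K\<close>
      yields it.\<close>
    define X where "X = {x \<in> pts M. \<forall>t\<in>K. f t x \<in> V}"
    have "open_Cn n {z \<in> U. \<psi> z \<in> X}" if U: "(U, \<psi>) \<in> charts M" for U \<psi>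
      unfolding open_Cn_def
    proof (subst openin_subopen, intro ballI)
      fix z assume z: "z \<in> {z \<in> U. \<psi> z \<in> X}"
      have zC: "z \<in> topspace (top_of_set (Cn n))"
        using open_Cn_subset[OF open_charts[OF U]] z by auto
      have "K \<times> {z} \<subseteq> {(t, z). t \<in> topspace T \<and> z \<in> U \<and> f t (\<psi> z) \<in> V}"
        using z A(5) by (auto simp: X_def)
      from tube_lemma_left[OF charts[OF U V] K zC this]
      obtain A' B where B: "openin (top_of_set (Cn n)) B" "K \<subseteq> A'" "z \<in> B"
        "A' \<times> B \<subseteq> {(t, z). t \<in> topspace T \<and> z \<in> U \<and> f t (\<psi> z) \<in> V}" by blast
      have "openin (top_of_set (Cn n)) (B \<inter> U)"
        using B(1) open_charts[OF U] unfolding open_Cn_def by (rule openin_Int)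
      moreover have "B \<inter> U \<subseteq> {z \<in> U. \<psi> z \<in> X}"
        using B(2,4) pts[OF U] by (auto simp: X_def)
      ultimately show "\<exists>B. openin (top_of_set (Cn n)) B \<and> z \<in> B \<and> B \<subseteq> {z \<in> U. \<psi> z \<in> X}"
        using B(3) z by blast
    qed
    then have "openin (mfd_top n M) X"
      unfolding openin_mfd_top_iff[OF M] by (auto simp: X_def)
    moreover have "x0 \<in> X" using x0 A(5) by (auto simp: X_def)
    moreover have "A \<times> X \<subseteq> {y \<in> topspace T \<times> pts M. (case y of (t, x) \<Rightarrow> f t x) \<in> V}"
      using A(4,5) by (auto simp: X_def)
    ultimately show "\<exists>A X. openin T A \<and> openin (mfd_top n M) X \<and> t0 \<in> A \<and> x0 \<in> X \<and>
        A \<times> X \<subseteq> {y \<in> topspace T \<times> pts M. (case y of (t, x) \<Rightarrow> f t x) \<in> V}"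
      using A(1,3) by blast
  qed
  then show ?thesis unfolding continuous_map_def using f top by auto
qed

subsection \<open>The compact torus\<close>

lemma circle_group: "group circle_group"
proof (rule groupI)
  fix x assume "x \<in> carrier circle_group"
  then show "\<exists>y\<in>carrier circle_group. y \<otimes>\<^bsub>circle_group\<^esub> x = \<one>\<^bsub>circle_group\<^esub>"
    by (intro bexI[of _ "cnj x"]) (simp_all add: circle_group_def cmod_1_cnj)
qed (auto simp: circle_group_def norm_mult)

lemma torus_group: "group (torus_group l)"
  unfolding torus_group_def by (rule product_group) (rule circle_group)

lemma torus_carrier: "carrier (torus_group l) = (\<Pi>\<^sub>E i\<in>{..<l}. sphere 0 1)"
  by (simp add: torus_group_def circle_group_def)

lemma topspace_torus_top: "topspace (torus_top l) = carrier (torus_group l)"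
  by (simp add: torus_top_def torus_carrier)

lemma compact_torus_top: "compact_space (torus_top l)"
  unfolding torus_top_def
  by (auto simp: compact_space_product_topology compact_space_subtopology intro!: compact_space_subtopology)

lemma Hausdorff_torus_top: "Hausdorff_space (torus_top l)"
  unfolding torus_top_def by (simp add: Hausdorff_space_product_topology Hausdorff_space_subtopology)

text \<open>Elements of the product group are \<open>undefined\<close> beyond index
  \<open>l\<close>; these entries are replaced by 1.\<close>

definition torus_weights :: "nat \<Rightarrow> (nat \<Rightarrow> complex) \<Rightarrow> cvec" where
  "torus_weights l t = (\<lambda>i. if i < l then t i else 1)"

lemma unitary_torus_weights: "t \<in> carrier (torus_group l) \<Longrightarrow> unitary l (torus_weights l t)"
  by (auto simp: torus_carrier unitary_def torus_weights_def PiE_iff)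

lemma torus_weights_mult:
  "torus_weights l (s \<otimes>\<^bsub>torus_group l\<^esub> t) = cscale (torus_weights l s) (torus_weights l t)"
  by (auto simp: torus_group_def torus_weights_def cscale_def circle_group_def fun_eq_iff)

lemma torus_weights_one: "torus_weights l \<one>\<^bsub>torus_group l\<^esub> = (\<lambda>_. 1)"
  by (auto simp: torus_group_def torus_weights_def circle_group_def fun_eq_iff)

lemma continuous_map_torus_weights: "continuous_map (torus_top l) euclidean (torus_weights l)"
proof -
  have "continuous_map (torus_top l) euclidean (\<lambda>t. torus_weights l t i)" for i
  proof (cases "i < l")
    case True
    then have "continuous_map (torus_top l) (top_of_set (sphere 0 1)) (\<lambda>t. t i)"
      unfolding torus_top_def by (intro continuous_map_product_projection) simp
    then show ?thesis using True by (simp add: torus_weights_def continuous_map_in_subtopology)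
  qed (simp add: torus_weights_def)
  then show ?thesis
    unfolding euclidean_product_topology[symmetric] continuous_map_componentwise_UNIV by blast
qed

section \<open>The action on the Kato manifold\<close>

context kato_data
begin

lemma M_proper_charts: "proper_charts n M"
  unfolding proper_charts_def using M_open M_chart_pts by blast

text \<open>Restricted to \<open>pts M\<close> because the elements of \<open>Bij\<close> are
  extensional functions.\<close>

definition torus_act :: "(nat \<Rightarrow> complex) \<Rightarrow> bpt set \<Rightarrow> bpt set" where
  "torus_act t = (\<lambda>c\<in>pts M. scale_bpt (torus_weights l t) ` c)"

lemma torus_act_pts: "t \<in> carrier (torus_group l) \<Longrightarrow> c \<in> pts M \<Longrightarrow> torus_act t c \<in> pts M"
  by (simp add: torus_act_def M_pts_scale unitary_torus_weights)

lemma torus_act_mult: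
  assumes "s \<in> carrier (torus_group l)" "t \<in> carrier (torus_group l)" "c \<in> pts M"
  shows "torus_act (s \<otimes>\<^bsub>torus_group l\<^esub> t) c = torus_act s (torus_act t c)"
proof -
  have "torus_act t c \<in> pts M" using torus_act_pts assms by blast
  then show ?thesis
    using assms(3) by (simp add: torus_act_def torus_weights_mult image_image scale_bpt_scale_bpt)
qed

lemma torus_act_one: "c \<in> pts M \<Longrightarrow> torus_act \<one>\<^bsub>torus_group l\<^esub> c = c"
  by (simp add: torus_act_def torus_weights_one)

lemma torus_act_inv:
  assumes "t \<in> carrier (torus_group l)" "c \<in> pts M"
  shows "torus_act (inv\<^bsub>torus_group l\<^esub> t) (torus_act t c) = c"
    "torus_act t (torus_act (inv\<^bsub>torus_group l\<^esub> t) c) = c"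
proof -
  interpret group "torus_group l" by (rule torus_group)
  show "torus_act (inv\<^bsub>torus_group l\<^esub> t) (torus_act t c) = c"
    "torus_act t (torus_act (inv\<^bsub>torus_group l\<^esub> t) c) = c"
    using assms torus_act_mult[symmetric] torus_act_one by simp_all
qed

lemma torus_act_bij: "t \<in> carrier (torus_group l) \<Longrightarrow> bij_betw (torus_act t) (pts M) (pts M)"
  by (rule bij_betw_byWitness[where f' = "torus_act (inv\<^bsub>torus_group l\<^esub> t)"])
    (use torus_act_inv torus_act_pts group.inv_closed[OF torus_group] in auto)

lemma torus_act_faithful_action:
  assumes "0 < l"
  shows "faithful_action (torus_group l) (pts M) torus_act"
proof -
  have Bij: "torus_act t \<in> Bij (pts M)" if "t \<in> carrier (torus_group l)" for t
    using torus_act_bij[OF that] by (simp add: Bij_def torus_act_def)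
  have "torus_act \<in> hom (torus_group l) (BijGroup (pts M))"
  proof (rule homI)
    fix s t assume st: "s \<in> carrier (torus_group l)" "t \<in> carrier (torus_group l)"
    have "torus_act (s \<otimes>\<^bsub>torus_group l\<^esub> t) = compose (pts M) (torus_act s) (torus_act t)"
    proof
      fix c show "torus_act (s \<otimes>\<^bsub>torus_group l\<^esub> t) c = compose (pts M) (torus_act s) (torus_act t) c"
        using torus_act_mult[OF st] by (cases "c \<in> pts M") (simp_all add: compose_def torus_act_def)
    qed
    then show "torus_act (s \<otimes>\<^bsub>torus_group l\<^esub> t) = torus_act s \<otimes>\<^bsub>BijGroup (pts M)\<^esub> torus_act t"
      using Bij st by (simp add: BijGroup_def)
  qed (use Bij in \<open>simp add: BijGroup_def\<close>)
  then have "group_hom (torus_group l) (BijGroup (pts M)) torus_act"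
    by (intro group_hom.intro group_hom_axioms.intro torus_group group_BijGroup)
  moreover have "inj_on torus_act (carrier (torus_group l))"
  proof (rule inj_onI)
    fix s t assume st: "s \<in> carrier (torus_group l)" "t \<in> carrier (torus_group l)" and eq: "torus_act s = torus_act t"
    obtain c where c: "c \<noteq> 0" "Base (\<lambda>i. if i < l then c else 0) \<in> Wi" using faithful_point[OF assms] .
    let ?y = "\<lambda>i. if i < l then c else 0"
    \<comment> \<open>A point of \<open>Wi\<close> is alone in its class, so equal images of this
      class mean equal rotated points.\<close>
    have "{Base ?y} \<in> pts M" using M_pts cls_Wi[OF c(2)] Wi_W[OF c(2)] by metis
    then have "cscale (torus_weights l s) ?y = cscale (torus_weights l t) ?y"
      using fun_cong[OF eq, of "{Base ?y}"] by (simp add: torus_act_def)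
    then have "s i = t i" if "i < l" for i
      using that c(1) by (auto simp: cscale_def torus_weights_def dest: fun_cong[of _ _ i])
    then show "s = t" using st by (auto simp: torus_carrier intro: PiE_ext)
  qed
  ultimately show ?thesis
    by (intro faithful_action.intro group_action.intro faithful_action_axioms.intro)
qed

lemma torus_act_continuous:
  "continuous_map (prod_topology (torus_top l) (mfd_top n M)) (mfd_top n M) (\<lambda>(t, x). torus_act t x)"
proof (rule continuous_map_prod_mfd_top[OF compact_torus_top Hausdorff_torus_top M_proper_charts])
  show "\<exists>U \<psi> z. (U, \<psi>) \<in> charts M \<and> z \<in> U \<and> x = \<psi> z" if "x \<in> pts M" for x
    using M_covered[OF that] by metis
  show "torus_act t x \<in> pts M" if "t \<in> topspace (torus_top l)" "x \<in> pts M" for t x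
    using torus_act_pts that by (simp add: topspace_torus_top)
next
  fix U \<Psi> V assume U: "(U, \<Psi>) \<in> charts M" and V: "openin (mfd_top n M) V"
  let ?T = "prod_topology (torus_top l) (top_of_set (Cn n))"
  obtain d where d: "\<And>i. continuous_on UNIV (\<lambda>u. d u i)" and d': "\<And>u. unitary l u \<Longrightarrow>
      \<exists>V. (V, \<Psi>) \<in> charts M \<and> (\<forall>z\<in>U. cscale (d u) z \<in> V \<and> \<Psi> (cscale (d u) z) = scale_bpt u ` \<Psi> z)"
    using M_chart_scale[OF U] by auto
  let ?g = "\<lambda>(t, z). cscale (d (torus_weights l t)) z"
  have "continuous_map ?T euclidean (\<lambda>x. ?g x i)" for i
  proof -
    have "continuous_map (torus_top l) euclidean ((\<lambda>u. d u i) \<circ> torus_weights l)"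
      using continuous_map_torus_weights d[of i] by (intro continuous_map_compose) auto
    then have 1: "continuous_map ?T euclidean (((\<lambda>u. d u i) \<circ> torus_weights l) \<circ> fst)"
      by (intro continuous_map_compose[OF continuous_map_fst])
    have "continuous_map (top_of_set (Cn n)) euclidean (\<lambda>z. z i)"
      by (simp add: continuous_on_coord)
    then have 2: "continuous_map ?T euclidean ((\<lambda>z. z i) \<circ> snd)"
      by (intro continuous_map_compose[OF continuous_map_snd])
    have "continuous_map ?T euclidean (\<lambda>x. (((\<lambda>u. d u i) \<circ> torus_weights l) \<circ> fst) x * ((\<lambda>z. z i) \<circ> snd) x)"
      using 1 2 by (rule continuous_map_mult)
    then show ?thesis by (simp add: case_prod_unfold cscale_def)
  qed
  then have "continuous_map ?T euclidean ?g"
    unfolding euclidean_product_topology[symmetric] continuous_map_componentwise_UNIV by blast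
  then have g: "continuous_map ?T (top_of_set (Cn n)) ?g"
    by (auto simp: continuous_map_in_subtopology)
  \<comment> \<open>The target domain varies with the torus element, but the chart map does not.
    Taking all domains of charts with map \<open>\<Psi>\<close> together gives one open set that
    serves every \<open>t\<close>.\<close>
  define B where "B = (\<Union>V' \<in> {V'. (V', \<Psi>) \<in> charts M}. {w \<in> V'. \<Psi> w \<in> V})"
  have "openin (top_of_set (Cn n)) B"
    using V unfolding B_def openin_mfd_top_iff[OF M_proper_charts] open_Cn_def by (intro openin_Union) auto
  from openin_continuous_map_preimage[OF g this]
  have 1: "openin ?T {x \<in> topspace ?T. ?g x \<in> B}" .
  have 2: "openin ?T (topspace (torus_top l) \<times> U)"
    using M_open[OF U] by (simp add: openin_prod_Times_iff open_Cn_def)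
  have act: "torus_act t (\<Psi> z) \<in> V \<longleftrightarrow> cscale (d (torus_weights l t)) z \<in> B"
    if t: "t \<in> topspace (torus_top l)" and z: "z \<in> U" for t z
  proof -
    have "unitary l (torus_weights l t)" using t unitary_torus_weights by (simp add: topspace_torus_top)
    from d'[OF this] obtain V' where V': "(V', \<Psi>) \<in> charts M" "cscale (d (torus_weights l t)) z \<in> V'"
      "\<Psi> (cscale (d (torus_weights l t)) z) = scale_bpt (torus_weights l t) ` \<Psi> z" using z by blast
    moreover have "torus_act t (\<Psi> z) = scale_bpt (torus_weights l t) ` \<Psi> z"
      using M_chart_pts[OF U z] by (simp add: torus_act_def)
    ultimately show ?thesis unfolding B_def by auto
  qed
  have "{(t, z). t \<in> topspace (torus_top l) \<and> z \<in> U \<and> torus_act t (\<Psi> z) \<in> V} =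
      (topspace (torus_top l) \<times> U) \<inter> {x \<in> topspace ?T. ?g x \<in> B}"
    using act open_Cn_subset[OF M_open[OF U]] by auto
  then show "openin ?T {(t, z). t \<in> topspace (torus_top l) \<and> z \<in> U \<and> torus_act t (\<Psi> z) \<in> V}"
    using openin_Int[OF 2 1] by simp
qed

text \<open>Stated for any \<open>f\<close> that agrees with the action on \<open>pts M\<close>, so
  that it also applies to the inverse. Continuity for fixed \<open>t\<close> is read off from joint
  continuity.\<close>

lemma torus_act_holomorphic:
  assumes t: "t \<in> carrier (torus_group l)" and f: "\<And>c. c \<in> pts M \<Longrightarrow> f c = torus_act t c"
  shows "holomorphic_map n M M f"
proof (rule holomorphic_map_scale[OF unitary_torus_weights[OF t]])
  show "f c = scale_bpt (torus_weights l t) ` c" if "c \<in> pts M" for c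
    using f that by (simp add: torus_act_def)
  have top: "topspace (mfd_top n M) = pts M"
    by (rule topspace_mfd_top[OF M_proper_charts])
  have "continuous_map (mfd_top n M) (prod_topology (torus_top l) (mfd_top n M)) (\<lambda>x. (t, x))"
    using t by (intro continuous_map_pairedI) (auto simp: topspace_torus_top)
  from continuous_map_compose[OF this torus_act_continuous]
  have "continuous_map (mfd_top n M) (mfd_top n M) (torus_act t)" by (simp add: comp_def)
  then show "continuous_map (mfd_top n M) (mfd_top n M) f"
    by (rule continuous_map_eq) (simp add: top f)
qed

lemma torus_act_biholomorphism:
  assumes t: "t \<in> carrier (torus_group l)"
  shows "biholomorphism n M M (torus_act t)"
  unfolding biholomorphism_def
proof (intro conjI)
  show bij: "bij_betw (torus_act t) (pts M) (pts M)" by (rule torus_act_bij[OF t])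
  show "holomorphic_map n M M (torus_act t)" by (rule torus_act_holomorphic[OF t refl])
  have inv: "inv\<^bsub>torus_group l\<^esub> t \<in> carrier (torus_group l)"
    using t group.inv_closed[OF torus_group] by blast
  show "holomorphic_map n M M (inv_into (pts M) (torus_act t))"
  proof (rule torus_act_holomorphic[OF inv])
    fix c assume c: "c \<in> pts M"
    show "inv_into (pts M) (torus_act t) c = torus_act (inv\<^bsub>torus_group l\<^esub> t) c"
      using torus_act_inv(2)[OF t c] torus_act_pts[OF inv c] bij
      by (intro inv_into_f_eq) (auto simp: bij_betw_def)
  qed
qed

end

theorem corollary6p2:
  fixes n l :: nat and A :: "int mat" and js :: "nat list"
  assumes "A \<in> carrier_mat n n" and "invertible_mat A"
    and "kato_matrix n A" and "kato_word n A js"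
    and "kato_type n A = l" and "l > 0"
  shows "\<exists>\<phi>. faithful_action (torus_group l) (pts (kato_manifold n js)) \<phi> \<and>
    continuous_map (prod_topology (torus_top l) (mfd_top n (kato_manifold n js)))
      (mfd_top n (kato_manifold n js)) (\<lambda>(t, x). \<phi> t x) \<and>
    (\<forall>t \<in> carrier (torus_group l). biholomorphism n (kato_manifold n js) (kato_manifold n js) (\<phi> t))"
proof -
  note word = kato_type_word[OF assms(1,3,4,5,6)]
  interpret kato_data n l js
    by unfold_locales (use word in auto)
  show ?thesis
    using torus_act_faithful_action[OF assms(6)] torus_act_continuous torus_act_biholomorphism by blast
qed

end
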